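(* For every positive integer $n$, $u_2(n) \leq 4n - 8$.
   Context: A graph $G$ is a $k$-planar unit distance graph if it admits a drawing in the plane in which the vertices are mapped to distinct points, every edge is drawn as a straight line segment of length exactly $1$ between its endpoints (not passing through any other vertex), and every edge is involved in at most $k$ crossings (a crossing being a common interior point of two edges). For integers $k \ge 0$ and $n \ge 1$, $u_k(n)$ denotes the maximum number of edges of a $k$-planar unit distance graph on $n$ vertices.
   Formalization: The bound is stated for n ≥ 3 instead of every positive n, since it fails for n = 1 (u_2(1) = 0 > -4) and n = 2 (a single unit edge gives u_2(2) = 1 > 0). *)

theory Defs
  imports "HOL-Analysis.Analysis"
begin

definition simple_graph :: "'a set \<Rightarrow> 'a set set \<Rightarrow> bool" where
  "simple_graph V E \<longleftrightarrow> finite V \<and> (\<forall>e\<in>E. e \<subseteq> V \<and> card e = 2)"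

text \<open>The straight-line edge with its endpoints removed.\<close>

definition edge_interior :: "('a \<Rightarrow> real ^ 2) \<Rightarrow> 'a set \<Rightarrow> (real ^ 2) set" where
  "edge_interior \<phi> e = \<Union>{open_segment (\<phi> u) (\<phi> v) | u v. e = {u, v}}"

definition unit_distance_drawing ::
    "'a set \<Rightarrow> 'a set set \<Rightarrow> ('a \<Rightarrow> real ^ 2) \<Rightarrow> bool" where
  "unit_distance_drawing V E \<phi> \<longleftrightarrow>
     inj_on \<phi> V \<and>
     (\<forall>u v. {u, v} \<in> E \<longrightarrow> dist (\<phi> u) (\<phi> v) = 1) \<and>
     (\<forall>e\<in>E. \<forall>w\<in>V - e. \<phi> w \<notin> edge_interior \<phi> e)"

text \<open>
  A crossing belongs to two edges: a crossing on \<open>e\<close> is recorded as the other edge together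
  with the common interior point. Hence if \<open>m\<close> edges pass through one point, each of them
  has \<open>m - 1\<close> crossings there.
\<close>

definition crossings :: "'a set set \<Rightarrow> ('a \<Rightarrow> real ^ 2) \<Rightarrow> 'a set \<Rightarrow> ('a set \<times> (real ^ 2)) set" where
  "crossings E \<phi> e =
     {(f, p). f \<in> E \<and> f \<noteq> e \<and> p \<in> edge_interior \<phi> e \<and> p \<in> edge_interior \<phi> f}"

definition k_planar_unit_distance_graph :: "nat \<Rightarrow> 'a set \<Rightarrow> 'a set set \<Rightarrow> bool" where
  "k_planar_unit_distance_graph k V E \<longleftrightarrow>
     simple_graph V E \<and>
     (\<exists>\<phi>. unit_distance_drawing V E \<phi> \<and>
          (\<forall>e\<in>E. finite (crossings E \<phi> e) \<and> card (crossings E \<phi> e) \<le> k))"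

definition edge_counts :: "nat \<Rightarrow> nat \<Rightarrow> nat set" where
  "edge_counts k n =
     {card E | (V :: nat set) E. card V = n \<and> k_planar_unit_distance_graph k V E}"

definition u_max :: "nat \<Rightarrow> nat \<Rightarrow> nat" where
  "u_max k n = Max (edge_counts k n)"

text \<open>\<open>Max\<close> is only meaningful on finite nonempty sets.\<close>

lemma finite_edge_counts: "finite (edge_counts k n)"
proof (rule finite_subset)
  show "edge_counts k n \<subseteq> {..2 ^ n}"
  proof
    fix x assume "x \<in> edge_counts k n"
    then obtain V :: "nat set" and E where x: "x = card E" "card V = n" "simple_graph V E"
      unfolding edge_counts_def k_planar_unit_distance_graph_def by blast
    from x(3) have "finite V" "E \<subseteq> Pow V"
      unfolding simple_graph_def by auto
    then have "card E \<le> card (Pow V)" by (simp add: card_mono)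
    with x \<open>finite V\<close> show "x \<in> {..2 ^ n}" by (simp add: card_Pow)
  qed
qed simp

lemma edge_counts_nonempty: "edge_counts k n \<noteq> {}"
proof -
  define \<phi> :: "nat \<Rightarrow> real ^ 2" where "\<phi> i = of_nat i *\<^sub>R axis 1 1" for i
  have "inj_on \<phi> {..<n}"
    unfolding inj_on_def \<phi>_def by (auto simp: axis_eq_0_iff)
  then have "k_planar_unit_distance_graph k {..<n} {}"
    unfolding k_planar_unit_distance_graph_def simple_graph_def unit_distance_drawing_def
    by auto
  then have "card ({} :: nat set set) \<in> edge_counts k n"
    unfolding edge_counts_def by (metis (mono_tags, lifting) card_lessThan mem_Collect_eq)
  then show ?thesis by blast
qed

text \<open>Restricting the vertices to natural numbers loses nothing.\<close>

lemma card_in_edge_counts: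
  fixes V :: "'a set"
  assumes "k_planar_unit_distance_graph k V E"
  shows "card E \<in> edge_counts k (card V)"
proof -
  have V: "finite V" and E: "\<And>e. e \<in> E \<Longrightarrow> e \<subseteq> V \<and> card e = 2"
    using assms unfolding k_planar_unit_distance_graph_def simple_graph_def by auto
  obtain \<phi> where \<phi>: "unit_distance_drawing V E \<phi>"
    and cr': "\<forall>e\<in>E. finite (crossings E \<phi> e) \<and> card (crossings E \<phi> e) \<le> k"
    using assms unfolding k_planar_unit_distance_graph_def by auto
  have cr: "finite (crossings E \<phi> e) \<and> card (crossings E \<phi> e) \<le> k" if "e \<in> E" for e
    using cr' that by (rule bspec)
  have inj: "inj_on \<phi> V"
    and unit: "\<And>a b. {a, b} \<in> E \<Longrightarrow> dist (\<phi> a) (\<phi> b) = 1"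
    and avoid: "\<And>e w. e \<in> E \<Longrightarrow> w \<in> V - e \<Longrightarrow> \<phi> w \<notin> edge_interior \<phi> e"
    using \<phi> unfolding unit_distance_drawing_def by simp_all
  obtain h :: "'a \<Rightarrow> nat" where h: "inj_on h V"
    using finite_imp_inj_to_nat_seg[OF V] by blast
  define g where "g = inv_into V h"
  have gh: "g (h v) = v" if "v \<in> V" for v
    using that h by (simp add: g_def)
  define \<psi> where "\<psi> = \<phi> \<circ> g"
  define E' where "E' = (`) h ` E"
  have inj_img: "inj_on ((`) h) E"
    using h E by (meson inj_onI inj_on_image_eq_iff)
  have ggh: "g ` h ` e = e" if "e \<in> E" for e
    using E[OF that] gh by (force simp: image_image)
  have int: "edge_interior \<psi> (h ` e) = edge_interior \<phi> e" if e: "e \<in> E" for e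
  proof -
    obtain a b where ab: "e = {a, b}" "a \<noteq> b"
      using E[OF e] by (meson card_2_iff)
    then have V: "a \<in> V" "b \<in> V" using E[OF e] by auto
    then have "h a \<noteq> h b" using h ab by (meson inj_onD)
    have "edge_interior \<phi> e = open_segment (\<phi> a) (\<phi> b)"
      unfolding edge_interior_def ab
      by (auto simp: doubleton_eq_iff open_segment_commute)
    moreover have "edge_interior \<psi> (h ` e) = open_segment (\<psi> (h a)) (\<psi> (h b))"
      unfolding edge_interior_def ab
      by (auto simp: doubleton_eq_iff open_segment_commute)
    ultimately show ?thesis using V by (simp add: \<psi>_def gh)
  qed
  have cross: "crossings E' \<psi> (h ` e) = (\<lambda>(f, p). (h ` f, p)) ` crossings E \<phi> e"
    if e: "e \<in> E" for e
  proof -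
    have ne: "h ` f = h ` e \<longleftrightarrow> f = e" if "f \<in> E" for f
      using inj_img e that by (auto dest: inj_onD)
    show ?thesis
      unfolding crossings_def E'_def using e by (auto simp: int ne image_iff)
  qed
  have "simple_graph (h ` V) E'"
    unfolding simple_graph_def E'_def
  proof (intro conjI ballI)
    show "finite (h ` V)" using V by simp
    fix e' assume "e' \<in> (`) h ` E"
    then obtain e where e: "e \<in> E" "e' = h ` e" by blast
    with E show "e' \<subseteq> h ` V" by blast
    have "inj_on h e" using E[OF e(1)] h by (meson inj_on_subset)
    then show "card e' = 2" using E[OF e(1)] e(2) by (simp add: card_image)
  qed
  moreover have "unit_distance_drawing (h ` V) E' \<psi>"
    unfolding unit_distance_drawing_def
  proof (intro conjI allI impI ballI)
    show "inj_on \<psi> (h ` V)"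
      using inj gh by (auto simp: inj_on_def \<psi>_def)
  next
    fix a b assume "{a, b} \<in> E'"
    then obtain e where e: "e \<in> E" "{a, b} = h ` e" unfolding E'_def by blast
    have "{g a, g b} = g ` {a, b}" by simp
    also have "\<dots> = e" using e ggh by simp
    finally have "{g a, g b} \<in> E" using e by simp
    then show "dist (\<psi> a) (\<psi> b) = 1" using unit by (simp add: \<psi>_def)
  next
    fix e' w assume "e' \<in> E'" "w \<in> h ` V - e'"
    then obtain e v where "e \<in> E" "e' = h ` e" "v \<in> V - e" "w = h v"
      unfolding E'_def by blast
    then show "\<psi> w \<notin> edge_interior \<psi> e'"
      using avoid int by (simp add: \<psi>_def gh)
  qed
  moreover have "finite (crossings E' \<psi> e') \<and> card (crossings E' \<psi> e') \<le> k"
    if "e' \<in> E'" for e'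
  proof -
    from that obtain e where e: "e \<in> E" "e' = h ` e" unfolding E'_def by blast
    from cr[OF e(1)] show ?thesis
      unfolding e(2) cross[OF e(1)] by (meson card_image_le finite_imageI le_trans)
  qed
  ultimately have "k_planar_unit_distance_graph k (h ` V) E'"
    unfolding k_planar_unit_distance_graph_def by blast
  moreover have "card E' = card E" "card (h ` V) = card V"
    using inj_img h by (simp_all add: E'_def card_image)
  ultimately show ?thesis
    unfolding edge_counts_def by (metis (mono_tags, lifting) mem_Collect_eq)
qed

end

(* Planarise the drawing, turning its crossing points into vertices, and let the faces be the closed
   walks obtained by always taking the next edge clockwise. For a face F let |F| be its length and
   v(F) the number of its corners at original vertices. By Euler's inequality, m <= 4 n - 8 follows
   once |F| + v(F) / 2 is at least 4 on average.
   Only triangles with at most one original corner fall short of 4. They receive 1/2 across their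
   sides without original corners. A face with at most one original corner that gives more than it
   can afford does so across two adjacent sides; these lie on two crossing unit segments, and since
   two opposite sides of the quadrilateral spanned by crossing unit segments have total length less
   than 2, one of them is not an edge. Hence the face opposite to a neighbouring corner is not a
   triangle and has 1/2 to spare.
   For Euler's inequality, sweep a vertical line: the regions directly above the edges, together
   with the bottom region, are glued by one link per vertex. *)
theory Submission
  imports Defs "HOL-Combinatorics.Orbits"
begin

section \<open>Gluing labels and cyclic successors\<close>


text \<open>Two crossings per edge matter as follows. If both ends of a side of the planarised
  drawing are crossing points, they use up the two crossings of its edge; so exactly one further
  edge passes through each, and beyond each the next point is an endpoint of the edge. Three edges
  may meet in a point, but this uses up their crossings, so every side there has an original end.
  The constants come from counting darts. If A darts start at original vertices and B at the c
  crossing points, then A >= 2m and B >= 4c, while Euler's inequality and the average 4 give A/2 + B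
  + 8 <= 4n + 4c. The crossing points cancel and m + 8 <= 4n remains. Faces are orbits of a
  permutation of the darts, so no components of the plane occur. Only one direction of Euler's
  formula is required, and it holds for disconnected graphs too. The sweep demands vertices with
  distinct abscissas, which a shear provides. Face walks must not turn back, so every vertex must
  have degree at least two; vertices of smaller degree are removed by induction.\<close>

lemma exists_labelling_respecting_links:
  assumes "finite N" "finite L"
  shows "\<exists>c :: 'a \<Rightarrow> 'a. (\<forall>(a, b)\<in>L. c a = c b) \<and> card N \<le> card (c ` N) + card L"
  using assms(2)
proof (induction L rule: finite_induct)
  case empty
  show ?case by (intro exI[of _ id]) simp
next
  case (insert l L)
  obtain a b where l: "l = (a, b)" by (cases l)
  obtain c :: "'a \<Rightarrow> 'a" where c: "\<forall>(a, b)\<in>L. c a = c b" "card N \<le> card (c ` N) + card L"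
    using insert.IH by blast
  \<comment> \<open>Composing with \<open>g\<close> merges the class of \<open>a\<close> into that
    of \<open>b\<close>, so one link costs at most one label.\<close>
  define g where "g y = (if y = c a then c b else y)" for y
  have "c ` N - {c a} \<subseteq> (g \<circ> c) ` N"
    by (force simp: g_def image_iff)
  then have "card (c ` N - {c a}) \<le> card ((g \<circ> c) ` N)"
    using assms(1) by (intro card_mono) auto
  moreover have "card (c ` N) \<le> Suc (card (c ` N - {c a}))"
    by (metis assms(1) card_Diff1_le card_Suc_Diff1 card_insert_le finite_imageI insert_Diff_single
        le_SucI order_refl Diff_empty Diff_insert0)
  ultimately have "card N \<le> card ((g \<circ> c) ` N) + card (insert l L)"
    using c(2) insert.hyps by simp
  moreover have "\<forall>(x, y)\<in>insert l L. (g \<circ> c) x = (g \<circ> c) y"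
    using c(1) by (auto simp: l g_def)
  ultimately show ?case by blast
qed

definition cyc_next :: "('a \<Rightarrow> real) \<Rightarrow> 'a set \<Rightarrow> 'a \<Rightarrow> 'a" where
  "cyc_next k A a =
     (if \<exists>b\<in>A. k a < k b then arg_min_on k {b \<in> A. k a < k b} else arg_min_on k A)"

context
  fixes k :: "'a \<Rightarrow> real" and A :: "'a set"
  assumes fin: "finite A" and inj: "inj_on k A"
begin

lemma arg_min_on_eqI:
  assumes "B \<subseteq> A" "b \<in> B" "\<And>c. c \<in> B \<Longrightarrow> k b \<le> k c"
  shows "arg_min_on k B = b"
proof -
  have "finite B" "B \<noteq> {}" using assms fin finite_subset by auto
  note m = arg_min_if_finite[OF this, of k]
  have "k (arg_min_on k B) = k b" using m assms by (meson order_antisym_conv not_le)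
  then show ?thesis using m(1) assms inj by (meson inj_onD subsetD)
qed

lemma cyc_next_eqI:
  assumes "b \<in> A" "k a < k b" "\<And>c. c \<in> A \<Longrightarrow> k a < k c \<Longrightarrow> k b \<le> k c"
  shows "cyc_next k A a = b"
proof -
  have "arg_min_on k {b \<in> A. k a < k b} = b"
    using assms by (intro arg_min_on_eqI) auto
  then show ?thesis using assms by (auto simp: cyc_next_def)
qed

lemma cyc_next_wrapI:
  assumes "b \<in> A" "\<And>c. c \<in> A \<Longrightarrow> k c \<le> k a" "\<And>c. c \<in> A \<Longrightarrow> k b \<le> k c"
  shows "cyc_next k A a = b"
proof -
  have "arg_min_on k A = b"
    using assms by (intro arg_min_on_eqI) auto
  moreover have "\<not> (\<exists>b\<in>A. k a < k b)" using assms(2) by (simp add: not_less)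
  ultimately show ?thesis by (simp only: cyc_next_def if_False)
qed

lemma cyc_next_cases:
  assumes "a \<in> A"
  obtains (up) "cyc_next k A a \<in> A" "k a < k (cyc_next k A a)"
      "\<And>c. c \<in> A \<Longrightarrow> k a < k c \<Longrightarrow> k (cyc_next k A a) \<le> k c"
    | (wrap) "cyc_next k A a \<in> A" "\<And>c. c \<in> A \<Longrightarrow> k c \<le> k a"
      "\<And>c. c \<in> A \<Longrightarrow> k (cyc_next k A a) \<le> k c"
proof (cases "\<exists>b\<in>A. k a < k b")
  case True
  define B where "B = {b \<in> A. k a < k b}"
  have "finite B" "B \<noteq> {}" using True fin by (auto simp: B_def)
  note m = arg_min_if_finite[OF this, of k]
  have "cyc_next k A a = arg_min_on k B" using True by (simp add: cyc_next_def B_def)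
  then have e: "cyc_next k A a \<in> B" "\<forall>x\<in>B. k (cyc_next k A a) \<le> k x"
    using m by (auto simp: not_less)
  show ?thesis by (rule up) (use e in \<open>auto simp: B_def\<close>)
next
  case False
  have "finite A" "A \<noteq> {}" using assms fin by auto
  note m = arg_min_if_finite[OF this, of k]
  have "cyc_next k A a = arg_min_on k A" using False by (auto simp: cyc_next_def)
  then have e: "cyc_next k A a \<in> A" "\<forall>x\<in>A. k (cyc_next k A a) \<le> k x"
    using m by (auto simp: not_less)
  show ?thesis by (rule wrap) (use e False in \<open>auto simp: not_less\<close>)
qed

lemma cyc_next_in: "a \<in> A \<Longrightarrow> cyc_next k A a \<in> A"
  by (erule cyc_next_cases)

lemma inj_on_cyc_next: "inj_on (cyc_next k A) A"
proof -
  have *: False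
    if "a \<in> A" "b \<in> A" "k a < k b" "cyc_next k A a = cyc_next k A b" for a b
    using that(1)
  proof (cases rule: cyc_next_cases)
    case up
    note u = this
    show ?thesis using that(2)
      by (cases rule: cyc_next_cases) (use u that in force)+
  next
    case wrap
    then show ?thesis using that by force
  qed
  show ?thesis
  proof (rule inj_onI)
    fix a b assume "a \<in> A" "b \<in> A" "cyc_next k A a = cyc_next k A b"
    then show "a = b" using *[of a b] *[of b a] inj
      by (metis inj_onD linorder_cases)
  qed
qed

lemma cyc_next_neq:
  assumes "a \<in> A" "b \<in> A" "b \<noteq> a"
  shows "cyc_next k A a \<noteq> a"
  using assms(1)
proof (cases rule: cyc_next_cases)
  case wrap
  then show ?thesis using assms inj by (metis inj_onD order_antisym)
qed auto

end

section \<open>Euler's inequality for straight-line plane graphs\<close>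


text \<open>Each edge is stored once, directed from left to right. Distinct abscissas let the sweep
  meet one vertex at a time.\<close>

locale line_graph =
  fixes V :: "'v set" and X Y :: "'v \<Rightarrow> real" and S :: "('v \<times> 'v) set"
  assumes finite_V: "finite V"
    and inj_X: "inj_on X V"
    and edgeD: "e \<in> S \<Longrightarrow> fst e \<in> V \<and> snd e \<in> V \<and> X (fst e) < X (snd e)"
begin

definition sl :: "'v \<times> 'v \<Rightarrow> real" where
  "sl e = (Y (snd e) - Y (fst e)) / (X (snd e) - X (fst e))"

definition ht :: "'v \<times> 'v \<Rightarrow> real \<Rightarrow> real" where
  "ht e x = Y (fst e) + (x - X (fst e)) * sl e"

text \<open>The strict bounds leave out both endpoints, so edges that share a vertex do not violate
  \<open>noncrossing\<close>.\<close>

definition act :: "real \<Rightarrow> ('v \<times> 'v) set" where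
  "act x = {e \<in> S. X (fst e) < x \<and> x < X (snd e)}"

end

locale plane_line_graph = line_graph V X Y S
  for V :: "'v set" and X Y :: "'v \<Rightarrow> real" and S :: "('v \<times> 'v) set" +
  assumes noncrossing: "\<lbrakk>e \<in> act x; f \<in> act x; ht e x = ht f x\<rbrakk> \<Longrightarrow> e = f"
    and avoids_vertices: "\<lbrakk>v \<in> V; e \<in> act (X v)\<rbrakk> \<Longrightarrow> ht e (X v) \<noteq> Y v"
begin

section \<open>Vertical order of the edges over an abscissa\<close>

lemma finite_S: "finite S"
proof (rule finite_subset)
  show "S \<subseteq> V \<times> V" using edgeD by (auto simp: mem_Times_iff)
qed (simp add: finite_V)

lemma finite_act: "A \<subseteq> act x \<Longrightarrow> finite A"
  using finite_S by (auto simp: act_def intro: finite_subset)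

lemma ht_fst [simp]: "ht e (X (fst e)) = Y (fst e)"
  by (simp add: ht_def)

lemma ht_snd_eq:
  assumes "e \<in> S"
  shows "ht e x = Y (snd e) + (x - X (snd e)) * sl e"
proof -
  have "(X (snd e) - X (fst e)) * sl e = Y (snd e) - Y (fst e)"
    using edgeD[OF assms] by (simp add: sl_def)
  then show ?thesis by (simp add: ht_def algebra_simps)
qed

text \<open>By the intermediate value theorem for the difference of the heights, the order cannot
  change without a common point.\<close>

lemma ht_less_const:
  assumes "x1 \<le> x2" "\<And>x. x1 \<le> x \<Longrightarrow> x \<le> x2 \<Longrightarrow> ht e x \<noteq> ht f x"
  shows "ht e x1 < ht f x1 \<longleftrightarrow> ht e x2 < ht f x2"
proof -
  define g where "g x = ht f x - ht e x" for x
  have cont: "continuous_on {x1..x2} g"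
    unfolding g_def ht_def by (intro continuous_intros)
  have nz: "g x \<noteq> 0" if "x1 \<le> x" "x \<le> x2" for x
    using assms(2)[OF that] by (simp add: g_def)
  have "\<not> (g x1 \<le> 0 \<and> 0 \<le> g x2)"
    using IVT'[of g x1 0 x2] cont nz assms(1) by blast
  moreover have "\<not> (g x2 \<le> 0 \<and> 0 \<le> g x1)"
    using IVT2'[of g x2 0 x1] cont nz assms(1) by blast
  ultimately show ?thesis by (auto simp: g_def)
qed

lemma act_between:
  assumes "e \<in> act x1" "e \<in> act x2" "x1 \<le> x" "x \<le> x2"
  shows "e \<in> act x"
  using assms by (auto simp: act_def)

lemma act_less_const:
  assumes "x1 \<le> x2" "e \<in> act x1" "e \<in> act x2" "f \<in> act x1" "f \<in> act x2"
  shows "ht e x1 < ht f x1 \<longleftrightarrow> ht e x2 < ht f x2"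
proof (cases "e = f")
  case False
  then show ?thesis
    using assms noncrossing by (intro ht_less_const) (blast intro: act_between)+
qed simp

definition topmost :: "real \<Rightarrow> ('v \<times> 'v) set \<Rightarrow> ('v \<times> 'v) option" where
  "topmost x A = (if A = {} then None else Some (arg_min_on (\<lambda>e. - ht e x) A))"

lemma topmost_empty [simp]: "topmost x {} = None"
  by (simp add: topmost_def)

lemma topmost_cases:
  assumes "A \<subseteq> act x" "A \<noteq> {}"
  obtains e where "e \<in> A" "topmost x A = Some e" "\<And>f. f \<in> A \<Longrightarrow> ht f x \<le> ht e x"
proof -
  note m = arg_min_if_finite[OF finite_act[OF assms(1)] assms(2), of "\<lambda>e. - ht e x"]
  show ?thesis by (rule that) (use m assms in \<open>auto simp: topmost_def not_less\<close>)
qed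

lemma topmost_eqI:
  assumes "A \<subseteq> act x" "e \<in> A" "\<And>f. f \<in> A \<Longrightarrow> ht f x \<le> ht e x"
  shows "topmost x A = Some e"
proof -
  from assms(2) have "A \<noteq> {}" by blast
  then obtain e' where e': "e' \<in> A" "topmost x A = Some e'" "\<And>f. f \<in> A \<Longrightarrow> ht f x \<le> ht e' x"
    using topmost_cases[OF assms(1)] by blast
  have "ht e x = ht e' x" using e'(1,3) assms(2,3) by (simp add: order_antisym)
  then have "e = e'" using noncrossing assms(1,2) e'(1) by (meson subsetD)
  then show ?thesis using e' by simp
qed

lemma topmost_cong:
  assumes "x1 \<le> x2" "A \<subseteq> act x1" "A \<subseteq> act x2"
  shows "topmost x1 A = topmost x2 A"
proof (cases "A = {}")
  case False
  then obtain e where e: "e \<in> A" "topmost x1 A = Some e" "\<And>f. f \<in> A \<Longrightarrow> ht f x1 \<le> ht e x1"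
    using topmost_cases[OF assms(2)] by blast
  have "ht f x2 \<le> ht e x2" if "f \<in> A" for f
    using e(3)[OF that] act_less_const[OF assms(1), of e f] e(1) that assms
    by (meson not_less subsetD)
  then have "topmost x2 A = Some e" by (intro topmost_eqI assms e)
  then show ?thesis using e by simp
qed simp

text \<open>The ceiling \<open>None\<close> lies above every edge, and a region bounded below by \<open>None\<close> is
  unbounded.\<close>

definition under :: "real \<Rightarrow> ('v \<times> 'v) option \<Rightarrow> real \<Rightarrow> bool" where
  "under x c y = (case c of None \<Rightarrow> True | Some e \<Rightarrow> y < ht e x)"

text \<open>At a fixed abscissa a region is determined by the edge that bounds it from below. The
  region under the ceiling \<open>c\<close> is therefore named by its floor, and \<open>None\<close>
  names the bottom region.\<close>

definition floor_of :: "real \<Rightarrow> ('v \<times> 'v) option \<Rightarrow> ('v \<times> 'v) option" where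
  "floor_of x c = topmost x {f \<in> act x. under x c (ht f x)}"

section \<open>Regions around a vertex\<close>

definition below_vertex :: "'v \<Rightarrow> ('v \<times> 'v) option" where
  "below_vertex v = topmost (X v) {f \<in> act (X v). ht f (X v) < Y v}"

definition left_edges :: "'v \<Rightarrow> ('v \<times> 'v) set" where
  "left_edges v = {e \<in> S. snd e = v}"

definition right_edges :: "'v \<Rightarrow> ('v \<times> 'v) set" where
  "right_edges v = {e \<in> S. fst e = v}"

text \<open>The name of the region that touches \<open>v\<close> from above on its left; of the
  edges ending in \<open>v\<close> the highest has the smallest slope. Linking this to
  \<open>top_right v\<close> expresses that the sweep passes freely above \<open>v\<close>. Below
  \<open>v\<close> the names agree by themselves, since the floor on either side is
  \<open>below_vertex v\<close>.\<close>

definition top_left :: "'v \<Rightarrow> ('v \<times> 'v) option" where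
  "top_left v = (if left_edges v = {} then below_vertex v
     else Some (arg_min_on sl (left_edges v)))"

definition top_right :: "'v \<Rightarrow> ('v \<times> 'v) option" where
  "top_right v = (if right_edges v = {} then below_vertex v
     else Some (arg_min_on (\<lambda>e. - sl e) (right_edges v)))"

definition near_left :: "'v \<Rightarrow> real \<Rightarrow> bool" where
  "near_left v x \<longleftrightarrow> x < X v \<and> (\<forall>u\<in>V. X u < x \<or> X v \<le> X u)"

definition near_right :: "'v \<Rightarrow> real \<Rightarrow> bool" where
  "near_right v x \<longleftrightarrow> X v < x \<and> (\<forall>u\<in>V. X u \<le> X v \<or> x < X u)"

text \<open>The picture on the vertical line at \<open>x\<close>, as seen from \<open>v\<close>: the edges of \<open>T\<close> at \<open>v\<close>,
  and the edges passing strictly below or above \<open>v\<close>.\<close>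

definition side :: "'v \<Rightarrow> real \<Rightarrow> ('v \<times> 'v) set \<Rightarrow> bool" where
  "side v x T \<longleftrightarrow> act x = act (X v) \<union> T \<and>
     (\<forall>f\<in>act (X v). \<forall>t\<in>T. (ht f x < ht t x \<longleftrightarrow> ht f (X v) < Y v) \<and>
                            (ht t x < ht f x \<longleftrightarrow> Y v < ht f (X v))) \<and>
     (\<forall>f\<in>act (X v). \<forall>g\<in>act (X v). ht f x < ht g x \<longleftrightarrow> ht f (X v) < ht g (X v)) \<and>
     (\<forall>A\<subseteq>act (X v). topmost x A = topmost (X v) A)"

text \<open>No edge begins or ends strictly between \<open>x\<close> and \<open>X v\<close>. Hence
  the active edges at \<open>x\<close> are those passing \<open>v\<close> and those ending in
  \<open>v\<close>, and their order persists up to \<open>X v\<close>, where the latter have height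
  \<open>Y v\<close>.\<close>

lemma near_left_side:
  assumes v: "v \<in> V" and x: "near_left v x"
  shows "side v x (left_edges v)"
proof -
  have xv: "x < X v" and gap: "\<And>u. u \<in> V \<Longrightarrow> X u < x \<or> X v \<le> X u"
    using x by (auto simp: near_left_def)
  have act: "act x = act (X v) \<union> left_edges v"
  proof (intro set_eqI iffI)
    fix e assume "e \<in> act x"
    then have e: "e \<in> S" "X (fst e) < x" "x < X (snd e)" by (auto simp: act_def)
    then have "X v \<le> X (snd e)" using gap[of "snd e"] edgeD[OF e(1)] by auto
    then show "e \<in> act (X v) \<union> left_edges v"
      using e xv edgeD[OF e(1)] inj_X v
      by (cases "X v = X (snd e)") (auto simp: act_def left_edges_def dest: inj_onD)
  next
    fix e assume "e \<in> act (X v) \<union> left_edges v"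
    then have e: "e \<in> S" "X (fst e) < X v" "X v \<le> X (snd e)"
      using edgeD by (auto simp: act_def left_edges_def)
    then show "e \<in> act x" using gap[of "fst e"] edgeD[OF e(1)] xv by (auto simp: act_def)
  qed
  have cmp: "ht f z \<noteq> ht t z"
    if "f \<in> act (X v)" "t \<in> left_edges v" "x \<le> z" "z \<le> X v" for f t z
  proof (cases "z = X v")
    case True
    have "ht t (X v) = Y v" using that by (auto simp: left_edges_def ht_snd_eq)
    then show ?thesis using avoids_vertices[OF v that(1)] True by simp
  next
    case False
    have "t \<in> act x" "f \<in> act x" using act that by auto
    then have "t \<in> act z" "f \<in> act z"
      using that False by (auto simp: left_edges_def act_def)
    moreover have "f \<noteq> t" using that by (auto simp: left_edges_def act_def)
    ultimately show ?thesis using noncrossing by blast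
  qed
  have tv: "ht t (X v) = Y v" if "t \<in> left_edges v" for t
    using that by (auto simp: left_edges_def ht_snd_eq)
  show ?thesis
    unfolding side_def
  proof (intro conjI ballI allI impI)
    fix f t assume ft: "f \<in> act (X v)" "t \<in> left_edges v"
    show "ht f x < ht t x \<longleftrightarrow> ht f (X v) < Y v"
      using ht_less_const[of x "X v" f t] cmp[OF ft] xv tv[OF ft(2)] by simp
    show "ht t x < ht f x \<longleftrightarrow> Y v < ht f (X v)"
      using ht_less_const[of x "X v" t f] cmp[OF ft, THEN not_sym] xv tv[OF ft(2)]
      by simp
  next
    fix f g assume fg: "f \<in> act (X v)" "g \<in> act (X v)"
    then show "ht f x < ht g x \<longleftrightarrow> ht f (X v) < ht g (X v)"
      using act xv by (intro act_less_const) auto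
  next
    fix A assume "A \<subseteq> act (X v)"
    then show "topmost x A = topmost (X v) A"
      using act xv by (intro topmost_cong) auto
  qed (rule act)
qed

lemma near_right_side:
  assumes v: "v \<in> V" and x: "near_right v x"
  shows "side v x (right_edges v)"
proof -
  have xv: "X v < x" and gap: "\<And>u. u \<in> V \<Longrightarrow> X u \<le> X v \<or> x < X u"
    using x by (auto simp: near_right_def)
  have act: "act x = act (X v) \<union> right_edges v"
  proof (intro set_eqI iffI)
    fix e assume "e \<in> act x"
    then have e: "e \<in> S" "X (fst e) < x" "x < X (snd e)" by (auto simp: act_def)
    then have "X (fst e) \<le> X v" using gap[of "fst e"] edgeD[OF e(1)] by auto
    then show "e \<in> act (X v) \<union> right_edges v"
      using e xv edgeD[OF e(1)] inj_X v
      by (cases "X v = X (fst e)") (auto simp: act_def right_edges_def dest: inj_onD)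
  next
    fix e assume "e \<in> act (X v) \<union> right_edges v"
    then have e: "e \<in> S" "X v < X (snd e)" "X (fst e) \<le> X v"
      using edgeD by (auto simp: act_def right_edges_def)
    then show "e \<in> act x" using gap[of "snd e"] edgeD[OF e(1)] xv by (auto simp: act_def)
  qed
  have cmp: "ht f z \<noteq> ht t z"
    if "f \<in> act (X v)" "t \<in> right_edges v" "X v \<le> z" "z \<le> x" for f t z
  proof (cases "z = X v")
    case True
    have "ht t (X v) = Y v" using that by (auto simp: right_edges_def)
    then show ?thesis using avoids_vertices[OF v that(1)] True by simp
  next
    case False
    have "t \<in> act x" "f \<in> act x" using act that by auto
    then have "t \<in> act z" "f \<in> act z"
      using that False by (auto simp: right_edges_def act_def)
    moreover have "f \<noteq> t" using that by (auto simp: right_edges_def act_def)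
    ultimately show ?thesis using noncrossing by blast
  qed
  have tv: "ht t (X v) = Y v" if "t \<in> right_edges v" for t
    using that by (auto simp: right_edges_def)
  show ?thesis
    unfolding side_def
  proof (intro conjI ballI allI impI)
    fix f t assume ft: "f \<in> act (X v)" "t \<in> right_edges v"
    show "ht f x < ht t x \<longleftrightarrow> ht f (X v) < Y v"
      using ht_less_const[of "X v" x f t] cmp[OF ft] xv tv[OF ft(2)] by simp
    show "ht t x < ht f x \<longleftrightarrow> Y v < ht f (X v)"
      using ht_less_const[of "X v" x t f] cmp[OF ft, THEN not_sym] xv tv[OF ft(2)]
      by simp
  next
    fix f g assume fg: "f \<in> act (X v)" "g \<in> act (X v)"
    then show "ht f x < ht g x \<longleftrightarrow> ht f (X v) < ht g (X v)"
      using act xv act_less_const[of "X v" x f g] by auto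
  next
    fix A assume "A \<subseteq> act (X v)"
    then show "topmost x A = topmost (X v) A"
      using act xv topmost_cong[of "X v" x A, symmetric] by (simp add: le_supI1)
  qed (rule act)
qed

text \<open>Near \<open>v\<close> the edges at \<open>v\<close> are consecutive in the vertical
  order: an edge passing below \<open>v\<close> is below all of them. So under \<open>e\<close>
  comes either the next edge at \<open>v\<close> or the edge under \<open>v\<close>.\<close>

lemma floor_at_side:
  assumes sd: "side v x T" and e: "e \<in> T"
  shows "floor_of x (Some e) =
    (if \<exists>t\<in>T. ht t x < ht e x then topmost x {t \<in> T. ht t x < ht e x} else below_vertex v)"
proof -
  define P where "P = {f \<in> act (X v). ht f (X v) < Y v}"
  define Q where "Q = {t \<in> T. ht t x < ht e x}"
  have low: "{f \<in> act x. under x (Some e) (ht f x)} = P \<union> Q"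
    using sd e by (auto simp: side_def under_def P_def Q_def)
  have PQ: "P \<union> Q \<subseteq> act x" using low by blast
  show ?thesis
  proof (cases "Q = {}")
    case True
    then have "floor_of x (Some e) = topmost x P" by (simp add: floor_of_def low)
    also have "\<dots> = below_vertex v"
      using sd by (auto simp: side_def P_def below_vertex_def)
    finally show ?thesis using True by (auto simp: Q_def)
  next
    case False
    then obtain q where q: "q \<in> Q" "topmost x Q = Some q" "\<And>f. f \<in> Q \<Longrightarrow> ht f x \<le> ht q x"
      using topmost_cases[of Q x] PQ by blast
    have "ht f x \<le> ht q x" if "f \<in> P" for f
      using that q(1) sd by (auto simp: side_def P_def Q_def intro: less_imp_le)
    then have "topmost x (P \<union> Q) = Some q"
      using q PQ by (intro topmost_eqI) auto
    then show ?thesis using q(1,2) by (auto simp: floor_of_def low Q_def)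
  qed
qed

text \<open>Only the region in which \<open>v\<close> lies feels the vertex. The first condition
  says that \<open>v\<close> lies below the ceiling with no edge in between; then the floor is the
  highest edge at \<open>v\<close> on this side, or the edge under \<open>v\<close> if there is
  none. In every other region the floor passes \<open>v\<close> unchanged.\<close>

lemma floor_across_side:
  assumes sd: "side v x T" and v: "v \<in> V"
    and c: "\<And>e. c = Some e \<Longrightarrow> e \<in> act x \<and> e \<in> act (X v)"
  shows "floor_of x c =
    (if under (X v) c (Y v) \<and> \<not> (\<exists>f\<in>act (X v). under (X v) c (ht f (X v)) \<and> Y v < ht f (X v))
     then if T = {} then below_vertex v else topmost x T
     else topmost (X v) {f \<in> act (X v). under (X v) c (ht f (X v))})"
proof -
  define P where "P = {f \<in> act (X v). under (X v) c (ht f (X v))}"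
  define Q where "Q = (if under (X v) c (Y v) then T else {})"
  have low: "{f \<in> act x. under x c (ht f x)} = P \<union> Q"
    using sd c by (auto simp: side_def under_def P_def Q_def split: option.splits)
  have PQ: "P \<union> Q \<subseteq> act x" using low by blast
  have Px: "topmost x P = topmost (X v) P"
    using sd by (auto simp: side_def P_def)
  consider (out) "\<not> under (X v) c (Y v)"
    | (mid) "under (X v) c (Y v)" "\<exists>f\<in>P. Y v < ht f (X v)"
    | (near) "under (X v) c (Y v)" "\<not> (\<exists>f\<in>P. Y v < ht f (X v))" by blast
  then show ?thesis
  proof cases
    case out
    then show ?thesis using Px by (simp add: floor_of_def low Q_def P_def)
  next
    case mid
    then obtain p where p: "p \<in> P" "topmost x P = Some p" "\<And>f. f \<in> P \<Longrightarrow> ht f x \<le> ht p x"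
      using topmost_cases[of P x] PQ by blast
    obtain p' where p': "p' \<in> P" "Y v < ht p' (X v)" using mid by blast
    have "ht f x \<le> ht p x" if "f \<in> Q" for f
    proof -
      have "f \<in> T" using that by (auto simp: Q_def split: if_splits)
      then have "ht f x < ht p' x" using p' sd by (auto simp: side_def P_def)
      then show ?thesis using p(3)[OF p'(1)] by simp
    qed
    then have "topmost x (P \<union> Q) = Some p"
      using p PQ by (intro topmost_eqI) auto
    then show ?thesis using p mid Px by (auto simp: floor_of_def low P_def)
  next
    case near
    have P: "P = {f \<in> act (X v). ht f (X v) < Y v}"
    proof (intro set_eqI iffI)
      fix f assume "f \<in> P"
      then show "f \<in> {f \<in> act (X v). ht f (X v) < Y v}"
        using near(2) avoids_vertices[OF v, of f] linorder_less_linear[of "ht f (X v)" "Y v"]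
        unfolding P_def by blast
    next
      fix f assume "f \<in> {f \<in> act (X v). ht f (X v) < Y v}"
      then show "f \<in> P" using near by (auto simp: P_def under_def split: option.splits)
    qed
    have Q: "Q = T" using near by (simp add: Q_def)
    have "topmost x (P \<union> T) = (if T = {} then below_vertex v else topmost x T)"
    proof (cases "T = {}")
      case True
      then show ?thesis using Px by (simp add: P below_vertex_def)
    next
      case False
      then obtain q where q: "q \<in> T" "topmost x T = Some q" "\<And>f. f \<in> T \<Longrightarrow> ht f x \<le> ht q x"
        using topmost_cases[of T x] PQ Q by blast
      have "ht f x \<le> ht q x" if "f \<in> P" for f
        using that q(1) sd by (auto simp: side_def P intro: less_imp_le)
      then have "topmost x (P \<union> T) = Some q"
        using q PQ Q by (intro topmost_eqI) auto
      then show ?thesis using False q by simp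
    qed
    then show ?thesis using near by (auto simp: floor_of_def low Q P_def)
  qed
qed

lemma left_less_iff:
  assumes "e \<in> left_edges v" "f \<in> left_edges v" "x < X v"
  shows "ht e x < ht f x \<longleftrightarrow> sl f < sl e"
  using assms by (auto simp: left_edges_def ht_snd_eq)

lemma right_less_iff:
  assumes "e \<in> right_edges v" "f \<in> right_edges v" "X v < x"
  shows "ht e x < ht f x \<longleftrightarrow> sl e < sl f"
  using assms by (auto simp: right_edges_def ht_def)

lemma top_left_topmost:
  assumes "near_left v x" "v \<in> V" "left_edges v \<noteq> {}"
  shows "top_left v = topmost x (left_edges v)"
proof -
  have fin: "finite (left_edges v)" using finite_S by (simp add: left_edges_def)
  note m = arg_min_if_finite[OF fin assms(3), of sl]
  have "topmost x (left_edges v) = Some (arg_min_on sl (left_edges v))"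
  proof (rule topmost_eqI)
    show "left_edges v \<subseteq> act x" using near_left_side[OF assms(2,1)] by (auto simp: side_def)
    fix f assume "f \<in> left_edges v"
    then show "ht f x \<le> ht (arg_min_on sl (left_edges v)) x"
      using left_less_iff[OF m(1), of f x] m assms by (auto simp: near_left_def not_less[symmetric])
  qed (rule m)
  then show ?thesis using assms by (simp add: top_left_def)
qed

lemma top_right_topmost:
  assumes "near_right v x" "v \<in> V" "right_edges v \<noteq> {}"
  shows "top_right v = topmost x (right_edges v)"
proof -
  have fin: "finite (right_edges v)" using finite_S by (simp add: right_edges_def)
  note m = arg_min_if_finite[OF fin assms(3), of "\<lambda>e. - sl e"]
  have "topmost x (right_edges v) = Some (arg_min_on (\<lambda>e. - sl e) (right_edges v))"
  proof (rule topmost_eqI)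
    show "right_edges v \<subseteq> act x" using near_right_side[OF assms(2,1)] by (auto simp: side_def)
    fix f assume "f \<in> right_edges v"
    then show "ht f x \<le> ht (arg_min_on (\<lambda>e. - sl e) (right_edges v)) x"
      using right_less_iff[OF m(1), of f x] m assms by (auto simp: near_right_def not_less[symmetric])
  qed (rule m)
  then show ?thesis using assms by (simp add: top_right_def)
qed

lemma floor_step:
  assumes "near_left v x1" "near_right v x2" "v \<in> V"
    and c: "\<And>e. c = Some e \<Longrightarrow> e \<in> act x1 \<and> e \<in> act x2"
    and L: "L (top_left v) = L (top_right v)"
  shows "L (floor_of x1 c) = L (floor_of x2 c)"
proof -
  have lt: "x1 < X v" "X v < x2" using assms by (auto simp: near_left_def near_right_def)
  then have c': "e \<in> act x1 \<and> e \<in> act (X v)" "e \<in> act x2 \<and> e \<in> act (X v)" if "c = Some e" for e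
    using c[OF that] act_between[of e x1 x2 "X v"] by auto
  have "top_left v = (if left_edges v = {} then below_vertex v else topmost x1 (left_edges v))"
    using top_left_topmost[OF assms(1,3)] by (auto simp: top_left_def)
  moreover have "top_right v = (if right_edges v = {} then below_vertex v else topmost x2 (right_edges v))"
    using top_right_topmost[OF assms(2,3)] by (auto simp: top_right_def)
  ultimately show ?thesis
    using L floor_across_side[OF near_left_side[OF assms(3,1)] assms(3) c'(1)]
      floor_across_side[OF near_right_side[OF assms(3,2)] assms(3) c'(2)]
    by auto
qed

text \<open>Induction on the number of vertices passed, splitting off the last one by
  \<open>floor_step\<close>. A ceiling that is active at both ends is active throughout, and between
  consecutive vertices nothing changes.\<close>

lemma floor_sweep:
  assumes "x1 \<le> x2" "x1 \<notin> X ` V" "x2 \<notin> X ` V"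
    and "\<And>e. c = Some e \<Longrightarrow> e \<in> act x1 \<and> e \<in> act x2"
    and "\<And>v. v \<in> V \<Longrightarrow> x1 < X v \<Longrightarrow> X v < x2 \<Longrightarrow> L (top_left v) = L (top_right v)"
  shows "L (floor_of x1 c) = L (floor_of x2 c)"
  using assms
proof (induction "card {v \<in> V. x1 < X v \<and> X v < x2}" arbitrary: x2 rule: less_induct)
  case less
  define B where "B = {v \<in> V. x1 < X v \<and> X v < x2}"
  have fin: "finite B" using finite_V by (simp add: B_def)
  show ?case
  proof (cases "B = {}")
    case True
    have nv: "X v < x1 \<or> x2 < X v" if "v \<in> V" for v
    proof -
      have "X v \<noteq> x1" "X v \<noteq> x2" using less.prems(2,3) that by auto
      then show ?thesis using True that unfolding B_def
        by (metis (mono_tags, lifting) empty_iff linorder_neqE_linordered_idom mem_Collect_eq)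
    qed
    have "act x1 = act x2"
      using nv edgeD less.prems(1) by (fastforce simp: act_def)
    moreover have "under x1 c (ht f x1) = under x2 c (ht f x2)" if "f \<in> act x1" for f
      using that less.prems(1,4) act_less_const[of x1 x2 f] calculation
      by (auto simp: under_def split: option.splits)
    ultimately have "{f \<in> act x1. under x1 c (ht f x1)} = {f \<in> act x2. under x2 c (ht f x2)}"
      by auto
    then have "floor_of x1 c = floor_of x2 c"
      unfolding floor_of_def using \<open>act x1 = act x2\<close> less.prems(1)
      by (metis (no_types, lifting) mem_Collect_eq subsetI topmost_cong)
    then show ?thesis by simp
  next
    case False
    define v where "v = arg_min_on (\<lambda>v. - X v) B"
    have v: "v \<in> B" "\<And>u. u \<in> B \<Longrightarrow> X u \<le> X v"
      using arg_min_if_finite[OF fin False, of "\<lambda>v. - X v"] by (auto simp: v_def not_less)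
    have vV: "v \<in> V" "x1 < X v" "X v < x2" using v by (auto simp: B_def)
    \<comment> \<open>Abscissa of the vertex passed before \<open>v\<close>, or \<open>x1\<close> if
      \<open>v\<close> is the only one; the sweep is cut halfway between it and
      \<open>v\<close>.\<close>
    define m0 where "m0 = Max (insert x1 (X ` (B - {v})))"
    have m0: "m0 < X v" "x1 \<le> m0" "\<And>u. u \<in> B - {v} \<Longrightarrow> X u \<le> m0"
    proof -
      have "X u < X v" if "u \<in> B - {v}" for u
      proof -
        have "X u \<noteq> X v" using that inj_X vV(1) by (auto simp: B_def dest: inj_onD)
        then show ?thesis using v(2)[of u] that by auto
      qed
      then show "m0 < X v" using vV fin by (auto simp: m0_def)
    qed (use fin in \<open>auto simp: m0_def intro: Max_ge\<close>)
    define m where "m = (m0 + X v) / 2"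
    have m: "x1 < m" "m0 < m" "m < X v" using m0 by (auto simp: m_def)
    have mV: "X u < m \<or> X v \<le> X u" if "u \<in> V" for u
    proof (cases "u \<in> B")
      case True
      then show ?thesis using m0(3)[of u] m by (cases "u = v") auto
    next
      case F: False
      then show ?thesis using that vV m by (auto simp: B_def)
    qed
    have mnot: "m \<notin> X ` V"
    proof
      assume "m \<in> X ` V"
      then obtain u where "u \<in> V" "X u = m" by blast
      then show False using mV[of u] m by simp
    qed
    have nl: "near_left v m" using mV m by (auto simp: near_left_def)
    have nr: "near_right v x2"
    proof -
      have "X u \<le> X v \<or> x2 < X u" if "u \<in> V" for u
      proof (cases "u \<in> B")
        case True then show ?thesis using v(2) by simp
      next
        case F: False
        have "X u \<noteq> x2" using less.prems(3) that by auto
        then show ?thesis using F that vV by (auto simp: B_def)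
      qed
      then show ?thesis using vV by (auto simp: near_right_def)
    qed
    have sub: "{v \<in> V. x1 < X v \<and> X v < m} \<subseteq> B - {v}"
      using m vV by (auto simp: B_def)
    have "card {v \<in> V. x1 < X v \<and> X v < m} \<le> card (B - {v})"
      using fin by (intro card_mono sub) auto
    also have "\<dots> < card B" using v(1) fin by (meson card_Diff1_less)
    finally have "L (floor_of x1 c) = L (floor_of m c)"
      using less.prems m vV mnot
      by (intro less.hyps) (auto simp: B_def intro: act_between)
    also have "\<dots> = L (floor_of x2 c)"
      using less.prems m vV nl nr by (intro floor_step) (auto intro: act_between)
    finally show ?thesis .
  qed
qed


text \<open>Equal slopes at a common end make the edges overlap: halfway from \<open>v\<close> to
  the nearer left end both are active and have the same height.\<close>

lemma left_same_slope:
  assumes "e \<in> left_edges v" "f \<in> left_edges v" "sl e = sl f"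
  shows "e = f"
proof -
  define x where "x = (max (X (fst e)) (X (fst f)) + X v) / 2"
  have "X (fst e) < X v" "X (fst f) < X v" using assms edgeD[of e] edgeD[of f] by (auto simp: left_edges_def)
  then have "e \<in> act x" "f \<in> act x" using assms by (auto simp: act_def left_edges_def x_def)
  moreover have "ht e x = ht f x" using assms by (simp add: left_edges_def ht_snd_eq)
  ultimately show ?thesis by (rule noncrossing)
qed

lemma right_same_slope:
  assumes "e \<in> right_edges v" "f \<in> right_edges v" "sl e = sl f"
  shows "e = f"
proof -
  define x where "x = (min (X (snd e)) (X (snd f)) + X v) / 2"
  have "X v < X (snd e)" "X v < X (snd f)" using assms edgeD[of e] edgeD[of f] by (auto simp: right_edges_def)
  then have "e \<in> act x" "f \<in> act x" using assms by (auto simp: act_def right_edges_def x_def)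
  moreover have "ht e x = ht f x" using assms by (simp add: right_edges_def ht_def)
  ultimately show ?thesis by (rule noncrossing)
qed

lemma ex_near_left:
  assumes "z < X v"
  obtains x where "z < x" "near_left v x"
proof -
  define m where "m = Max (insert z {X u | u. u \<in> V \<and> X u < X v})"
  have fin: "finite (insert z {X u | u. u \<in> V \<and> X u < X v})" using finite_V by simp
  have m: "m < X v" "z \<le> m" "\<And>u. u \<in> V \<Longrightarrow> X u < X v \<Longrightarrow> X u \<le> m"
    using fin assms unfolding m_def by (auto intro: Max_ge)
  show ?thesis
  proof (rule that)
    show "z < (m + X v) / 2" using m by simp
    show "near_left v ((m + X v) / 2)"
      using m by (fastforce simp: near_left_def)
  qed
qed

lemma ex_near_right:
  assumes "X v < z"
  obtains x where "x < z" "near_right v x"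
proof -
  define m where "m = Min (insert z {X u | u. u \<in> V \<and> X v < X u})"
  have fin: "finite (insert z {X u | u. u \<in> V \<and> X v < X u})" using finite_V by simp
  have m: "X v < m" "m \<le> z" "\<And>u. u \<in> V \<Longrightarrow> X v < X u \<Longrightarrow> m \<le> X u"
    using fin assms unfolding m_def by (auto intro: Min_le)
  show ?thesis
  proof (rule that)
    show "(m + X v) / 2 < z" using m by simp
    show "near_right v ((m + X v) / 2)"
      using m by (fastforce simp: near_right_def)
  qed
qed

lemma near_left_notin: "near_left v x \<Longrightarrow> x \<notin> X ` V"
  by (auto simp: near_left_def)

lemma near_right_notin: "near_right v x \<Longrightarrow> x \<notin> X ` V"
  by (auto simp: near_right_def)

text \<open>To the left of their common end the edge with the larger slope is the lower one, so
  \<open>g\<close> is the edge directly below \<open>e\<close>.\<close>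

lemma floor_left_eqI:
  assumes x: "near_left v x" "v \<in> V" and e: "e \<in> left_edges v" "g \<in> left_edges v" "sl e < sl g"
    and min: "\<And>f. f \<in> left_edges v \<Longrightarrow> sl e < sl f \<Longrightarrow> sl g \<le> sl f"
  shows "floor_of x (Some e) = Some g"
proof -
  have xv: "x < X v" using x by (simp add: near_left_def)
  have sd: "side v x (left_edges v)" by (rule near_left_side[OF x(2,1)])
  have "topmost x {t \<in> left_edges v. ht t x < ht e x} = Some g"
  proof (rule topmost_eqI)
    show "{t \<in> left_edges v. ht t x < ht e x} \<subseteq> act x" using sd by (auto simp: side_def)
    show "g \<in> {t \<in> left_edges v. ht t x < ht e x}"
      using e xv by (simp add: left_less_iff)
    fix f assume "f \<in> {t \<in> left_edges v. ht t x < ht e x}"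
    then have f: "f \<in> left_edges v" "sl e < sl f" using e xv by (auto simp: left_less_iff)
    show "ht f x \<le> ht g x"
      using min[OF f] left_less_iff[OF e(2) f(1) xv] by linarith
  qed
  then show ?thesis
    using floor_at_side[OF sd e(1)] e xv by (auto simp: left_less_iff)
qed

lemma floor_left_lowest:
  assumes x: "near_left v x" "v \<in> V" and e: "e \<in> left_edges v"
    and max: "\<And>f. f \<in> left_edges v \<Longrightarrow> sl f \<le> sl e"
  shows "floor_of x (Some e) = below_vertex v"
  using floor_at_side[OF near_left_side[OF x(2,1)] e] left_less_iff[OF _ e, of _ x] max x
  by (force simp: near_left_def)

lemma floor_right_eqI:
  assumes x: "near_right v x" "v \<in> V" and e: "e \<in> right_edges v" "g \<in> right_edges v" "sl g < sl e"
    and max: "\<And>f. f \<in> right_edges v \<Longrightarrow> sl f < sl e \<Longrightarrow> sl f \<le> sl g"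
  shows "floor_of x (Some e) = Some g"
proof -
  have xv: "X v < x" using x by (simp add: near_right_def)
  have sd: "side v x (right_edges v)" by (rule near_right_side[OF x(2,1)])
  have "topmost x {t \<in> right_edges v. ht t x < ht e x} = Some g"
  proof (rule topmost_eqI)
    show "{t \<in> right_edges v. ht t x < ht e x} \<subseteq> act x" using sd by (auto simp: side_def)
    show "g \<in> {t \<in> right_edges v. ht t x < ht e x}"
      using e xv by (simp add: right_less_iff)
    fix f assume "f \<in> {t \<in> right_edges v. ht t x < ht e x}"
    then have f: "f \<in> right_edges v" "sl f < sl e" using e xv by (auto simp: right_less_iff)
    show "ht f x \<le> ht g x"
      using max[OF f] right_less_iff[OF e(2) f(1) xv] by linarith
  qed
  then show ?thesis
    using floor_at_side[OF sd e(1)] e xv by (auto simp: right_less_iff)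
qed

lemma floor_right_lowest:
  assumes x: "near_right v x" "v \<in> V" and e: "e \<in> right_edges v"
    and min: "\<And>f. f \<in> right_edges v \<Longrightarrow> sl e \<le> sl f"
  shows "floor_of x (Some e) = below_vertex v"
  using floor_at_side[OF near_right_side[OF x(2,1)] e] right_less_iff[OF _ e, of _ x] min x
  by (force simp: near_right_def)

lemma top_left_eqI:
  assumes "e \<in> left_edges v" "\<And>f. f \<in> left_edges v \<Longrightarrow> sl e \<le> sl f"
  shows "top_left v = Some e"
proof -
  define m where "m = arg_min_on sl (left_edges v)"
  have "finite (left_edges v)" using finite_S by (simp add: left_edges_def)
  moreover have ne: "left_edges v \<noteq> {}" using assms by blast
  ultimately have m: "m \<in> left_edges v" "\<not> sl e < sl m"
    using arg_min_if_finite[of "left_edges v" sl] assms(1) unfolding m_def by blast+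
  then have "m = e"
    using assms(2)[OF m(1)] by (intro left_same_slope[OF m(1) assms(1)]) simp
  then show ?thesis using ne by (simp add: top_left_def m_def)
qed

lemma top_right_eqI:
  assumes "e \<in> right_edges v" "\<And>f. f \<in> right_edges v \<Longrightarrow> sl f \<le> sl e"
  shows "top_right v = Some e"
proof -
  define m where "m = arg_min_on (\<lambda>e. - sl e) (right_edges v)"
  have "finite (right_edges v)" using finite_S by (simp add: right_edges_def)
  moreover have ne: "right_edges v \<noteq> {}" using assms by blast
  ultimately have m: "m \<in> right_edges v" "\<not> - sl e < - sl m"
    using arg_min_if_finite[of "right_edges v" "\<lambda>e. - sl e"] assms(1) unfolding m_def by blast+
  then have "m = e"
    using assms(2)[OF m(1)] by (intro right_same_slope[OF m(1) assms(1)]) simp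
  then show ?thesis using ne by (simp add: top_right_def m_def)
qed

section \<open>Rotation at a vertex and labels of face walks\<close>

definition darts :: "('v \<times> 'v) set" where
  "darts = S \<union> {(w, u). (u, w) \<in> S}"

definition nbs :: "'v \<Rightarrow> 'v set" where
  "nbs w = {z. (w, z) \<in> darts}"

text \<open>The key increases clockwise around \<open>w\<close>, starting from the downward direction.\<close>

definition key :: "'v \<Rightarrow> 'v \<Rightarrow> real" where
  "key w z = (if X z < X w then 0 else 4) - arctan (sl (w, z))"

definition next_nb :: "'v \<Rightarrow> 'v \<Rightarrow> 'v" where
  "next_nb w u = cyc_next (key w) (nbs w) u"

lemma sl_swap: "sl (z, w) = sl (w, z)"
  unfolding sl_def fst_conv snd_conv
  by (metis minus_diff_eq minus_divide_divide)

lemma finite_nbs: "finite (nbs w)"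
proof (rule finite_subset)
  show "nbs w \<subseteq> V" using edgeD by (auto simp: nbs_def darts_def)
qed (rule finite_V)

lemma nbs_cases:
  assumes "z \<in> nbs w"
  obtains (left) "X z < X w" "(z, w) \<in> left_edges w" "key w z = - arctan (sl (z, w))"
      "(w, z) \<notin> S" "(z, w) \<in> S"
    | (right) "X w < X z" "(w, z) \<in> right_edges w" "key w z = 4 - arctan (sl (w, z))"
      "(w, z) \<in> S" "(z, w) \<notin> S"
proof (cases "(w, z) \<in> S")
  case True
  then have "X w < X z" using edgeD by force
  moreover from this have "(z, w) \<notin> S" using edgeD by force
  ultimately show ?thesis using True by (intro right) (auto simp: key_def right_edges_def)
next
  case False
  then have *: "(z, w) \<in> S" using assms by (auto simp: nbs_def darts_def)
  then have "X z < X w" using edgeD by force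
  then show ?thesis using False * sl_swap[of z w]
    by (intro left) (auto simp: key_def left_edges_def)
qed

lemma left_edges_nb: "e \<in> left_edges w \<Longrightarrow> fst e \<in> nbs w \<and> X (fst e) < X w \<and> e = (fst e, w)"
  using edgeD by (force simp: left_edges_def nbs_def darts_def)

lemma right_edges_nb: "e \<in> right_edges w \<Longrightarrow> snd e \<in> nbs w \<and> X w < X (snd e) \<and> e = (w, snd e)"
  using edgeD by (force simp: right_edges_def nbs_def darts_def)

lemma key_left_edge: "e \<in> left_edges w \<Longrightarrow> key w (fst e) = - arctan (sl e)"
  using left_edges_nb[of e w] sl_swap[of "fst e" w] by (auto simp: key_def)

lemma key_right_edge: "e \<in> right_edges w \<Longrightarrow> key w (snd e) = 4 - arctan (sl e)"
  using right_edges_nb[of e w] by (auto simp: key_def)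

text \<open>Coarse bounds that justify the offset 4 in \<open>key\<close>: keys of left neighbours
  lie between -2 and 2, those of right neighbours between 2 and 6.\<close>

lemma arctan_bounds: "- 2 < arctan x" "arctan x < 2"
  using arctan_lbound[of x] arctan_ubound[of x] pi_less_4 by auto

lemma key_left_right:
  assumes "e \<in> left_edges w" "f \<in> right_edges w"
  shows "key w (fst e) < key w (snd f)"
  using assms arctan_bounds[of "sl e"] arctan_bounds[of "sl f"]
  by (simp add: key_left_edge key_right_edge)

lemma inj_on_key: "inj_on (key w) (nbs w)"
proof (rule inj_onI)
  fix a b assume ab: "a \<in> nbs w" "b \<in> nbs w" "key w a = key w b"
  from ab(1) show "a = b"
  proof (cases rule: nbs_cases)
    case a: left
    from ab(2) show ?thesis
    proof (cases rule: nbs_cases)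
      case left
      then have "sl (a, w) = sl (b, w)" using a(3) ab(3) by (simp add: arctan_eq_iff)
      then show ?thesis using left_same_slope[OF a(2) left(2)] by simp
    next
      case right
      then show ?thesis using key_left_right[OF a(2) right(2)] ab(3) by simp
    qed
  next
    case a: right
    from ab(2) show ?thesis
    proof (cases rule: nbs_cases)
      case left
      then show ?thesis using key_left_right[OF left(2) a(2)] ab(3) by simp
    next
      case right
      then have "sl (w, a) = sl (w, b)" using a(3) ab(3) by (simp add: arctan_eq_iff)
      then show ?thesis using right_same_slope[OF a(2) right(2)] by simp
    qed
  qed
qed

context
  fixes c :: "('v \<times> 'v) option \<Rightarrow> ('v \<times> 'v) option"
  assumes links: "\<And>v. v \<in> V \<Longrightarrow> c (top_left v) = c (top_right v)"
begin

definition left_of :: "'v \<Rightarrow> real" where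
  "left_of v = (SOME x. near_left v x)"

text \<open>The label of the face on the left-hand side of a dart. For a dart to the right this is
  the region above its edge; for a dart to the left it is the region below, read off near the tail
  of the dart.\<close>

definition lab :: "'v \<times> 'v \<Rightarrow> ('v \<times> 'v) option" where
  "lab d = (if X (fst d) < X (snd d) then c (Some d)
     else c (floor_of (left_of (fst d)) (Some (snd d, fst d))))"

lemma near_left_of: "near_left v (left_of v)"
  unfolding left_of_def using ex_near_left[of "X v - 1" v] by (auto intro: someI)

lemma lab_right_end:
  assumes "e \<in> left_edges w"
  shows "lab (w, fst e) = c (floor_of (left_of w) (Some e))"
  using left_edges_nb[OF assms] by (auto simp: lab_def)

text \<open>The region under an edge is labelled at the right end of the edge. Sweeping with the
  edge itself as ceiling keeps the label, so it may equally be read off at the left end.\<close>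

lemma lab_left_end:
  assumes "e \<in> right_edges u"
  obtains x where "near_right u x" "lab (snd e, u) = c (floor_of x (Some e))"
proof -
  have e: "e \<in> S" "fst e = u" "X u < X (snd e)" "u \<in> V" "snd e \<in> V"
    using assms edgeD[of e] by (auto simp: right_edges_def)
  define x2 where "x2 = left_of (snd e)"
  have x2: "near_left (snd e) x2" unfolding x2_def by (rule near_left_of)
  then have "X u < x2" using e by (force simp: near_left_def)
  then obtain x where x: "x < x2" "near_right u x" using ex_near_right by blast
  have "c (floor_of x (Some e)) = c (floor_of x2 (Some e))"
  proof (rule floor_sweep)
    show "x \<notin> X ` V" "x2 \<notin> X ` V" using x(2) x2 near_right_notin near_left_notin by auto
    fix f assume "Some e = Some f"
    then show "f \<in> act x \<and> f \<in> act x2"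
      using e x x2 by (auto simp: act_def near_left_def near_right_def)
  qed (use x links in auto)
  then have "lab (snd e, u) = c (floor_of x (Some e))"
    using e by (auto simp: lab_def x2_def)
  then show ?thesis using that x(2) by blast
qed

text \<open>The face on the left of \<open>(u, w)\<close> fills the angle at \<open>w\<close> from
  \<open>u\<close> clockwise to the next neighbour. If both are on the same side of \<open>w\<close>
  without wrapping round, one edge is the floor of the other. If the angle contains the upward
  direction, the link at \<open>w\<close> is used; if it contains the downward direction, the label
  is that of \<open>below_vertex w\<close>. With neighbours on one side only, the angle that wraps
  round can contain both directions.\<close>

lemma lab_next:
  assumes "(u, w) \<in> darts"
  shows "lab (w, next_nb w u) = lab (u, w)"
proof -
  define z where "z = next_nb w u"
  have u: "u \<in> nbs w" and w: "w \<in> V" using assms edgeD by (auto simp: nbs_def darts_def)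
  note cases = cyc_next_cases[OF finite_nbs inj_on_key u, folded next_nb_def, folded z_def]
  have x: "near_left w (left_of w)" by (rule near_left_of)
  from u have "lab (w, z) = lab (u, w)"
  proof (cases rule: nbs_cases)
    case e: left
    then have lab_e: "lab (u, w) = c (Some (u, w))" by (simp add: lab_def)
    show ?thesis
    proof (cases rule: cases[case_names up wrap])
      case up
      from up(1) show ?thesis
      proof (cases rule: nbs_cases)
        case left
        have "floor_of (left_of w) (Some (z, w)) = Some (u, w)"
        proof (rule floor_left_eqI[OF x w])
          show "sl (z, w) < sl (u, w)" using up(2) left e by (simp add: arctan_less_iff)
          fix f assume f: "f \<in> left_edges w" "sl (z, w) < sl f"
          show "sl (u, w) \<le> sl f"
          proof (rule ccontr)
            assume "\<not> sl (u, w) \<le> sl f"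
            then have "key w u < key w (fst f)"
              using e f by (simp add: key_left_edge arctan_less_iff)
            then have "key w z \<le> key w (fst f)" using up(3) left_edges_nb[OF f(1)] by blast
            then show False using left f by (simp add: key_left_edge arctan_le_iff)
          qed
        qed (use left e in auto)
        then show ?thesis using lab_right_end[OF left(2)] lab_e by simp
      next
        case right
        have "top_left w = Some (u, w)"
        proof (rule top_left_eqI)
          fix f assume f: "f \<in> left_edges w"
          show "sl (u, w) \<le> sl f"
          proof (rule ccontr)
            assume "\<not> sl (u, w) \<le> sl f"
            then have "key w u < key w (fst f)"
              using e f by (simp add: key_left_edge arctan_less_iff)
            then have "key w z \<le> key w (fst f)" using up(3) left_edges_nb[OF f] by blast
            then show False using key_left_right[OF f right(2)] by simp
          qed
        qed (rule e)
        moreover have "top_right w = Some (w, z)"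
        proof (rule top_right_eqI)
          fix f assume f: "f \<in> right_edges w"
          have "key w z \<le> key w (snd f)"
            using up(3) right_edges_nb[OF f] key_left_right[OF e(2) f] by simp
          then show "sl f \<le> sl (w, z)" using f right by (simp add: key_right_edge arctan_le_iff)
        qed (rule right)
        ultimately show ?thesis using links[OF w] lab_e right by (simp add: lab_def)
      qed
    next
      case wrap
      have nr: "right_edges w = {}"
        using key_left_right[OF e(2)] wrap(2) right_edges_nb by fastforce
      have "top_left w = Some (u, w)"
      proof (rule top_left_eqI)
        fix f assume f: "f \<in> left_edges w"
        then have "key w (fst f) \<le> key w u" using wrap(2) left_edges_nb by blast
        then show "sl (u, w) \<le> sl f" using e f by (simp add: key_left_edge arctan_le_iff)
      qed (rule e)
      moreover have "top_right w = below_vertex w" using nr by (simp add: top_right_def)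
      moreover from wrap(1) have "lab (w, z) = c (below_vertex w)"
      proof (cases rule: nbs_cases)
        case left
        have "floor_of (left_of w) (Some (z, w)) = below_vertex w"
        proof (rule floor_left_lowest[OF x w left(2)])
          fix f assume f: "f \<in> left_edges w"
          then have "key w z \<le> key w (fst f)" using wrap(3) left_edges_nb by blast
          then show "sl f \<le> sl (z, w)" using left f by (simp add: key_left_edge arctan_le_iff)
        qed
        then show ?thesis using lab_right_end[OF left(2)] by simp
      qed (use nr in auto)
      ultimately show ?thesis using links[OF w] lab_e by simp
    qed
  next
    case e: right
    from lab_left_end[OF e(2)] obtain x' where x':
      "near_right w x'" "lab (u, w) = c (floor_of x' (Some (w, u)))" by auto
    show ?thesis
    proof (cases rule: cases[case_names up wrap])
      case up
      from up(1) show ?thesis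
      proof (cases rule: nbs_cases)
        case left
        then show ?thesis using up(2) key_left_right[OF left(2) e(2)] by simp
      next
        case right
        have "floor_of x' (Some (w, u)) = Some (w, z)"
        proof (rule floor_right_eqI[OF x'(1) w])
          show "sl (w, z) < sl (w, u)" using up(2) right e by (simp add: arctan_less_iff)
          fix f assume f: "f \<in> right_edges w" "sl f < sl (w, u)"
          then have "key w u < key w (snd f)" using e by (simp add: key_right_edge arctan_less_iff)
          then have "key w z \<le> key w (snd f)" using up(3) right_edges_nb[OF f(1)] by blast
          then show "sl f \<le> sl (w, z)" using right f by (simp add: key_right_edge arctan_le_iff)
        qed (use right e in auto)
        then show ?thesis using x' right by (simp add: lab_def)
      qed
    next
      case wrap
      have "floor_of x' (Some (w, u)) = below_vertex w"
      proof (rule floor_right_lowest[OF x'(1) w e(2)])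
        fix f assume f: "f \<in> right_edges w"
        then have "key w (snd f) \<le> key w u" using wrap(2) right_edges_nb by blast
        then show "sl (w, u) \<le> sl f" using e f by (simp add: key_right_edge arctan_le_iff)
      qed
      then have lab_e: "lab (u, w) = c (below_vertex w)" using x' by simp
      from wrap(1) show ?thesis
      proof (cases rule: nbs_cases)
        case left
        have "floor_of (left_of w) (Some (z, w)) = below_vertex w"
        proof (rule floor_left_lowest[OF x w left(2)])
          fix f assume f: "f \<in> left_edges w"
          then have "key w z \<le> key w (fst f)" using wrap(3) left_edges_nb by blast
          then show "sl f \<le> sl (z, w)" using left f by (simp add: key_left_edge arctan_le_iff)
        qed
        then show ?thesis using lab_right_end[OF left(2)] lab_e by simp
      next
        case right
        have "left_edges w = {}"
          using key_left_right[OF _ right(2)] wrap(3) left_edges_nb by fastforce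
        then have "top_left w = below_vertex w" by (simp add: top_left_def)
        moreover have "top_right w = Some (w, z)"
        proof (rule top_right_eqI)
          fix f assume f: "f \<in> right_edges w"
          then have "key w z \<le> key w (snd f)" using wrap(3) right_edges_nb by blast
          then show "sl f \<le> sl (w, z)" using f right by (simp add: key_right_edge arctan_le_iff)
        qed (rule right)
        ultimately show ?thesis using links[OF w] lab_e right by (simp add: lab_def)
      qed
    qed
  qed
  then show ?thesis by (simp add: z_def)
qed

end

text \<open>One link per vertex glues the regions above the edges (and the bottom region) into faces.
  The link at the rightmost vertex is redundant: the topmost region has already been joined to
  the bottom one around the leftmost vertex.\<close>

theorem euler_inequality:
  assumes S: "S \<noteq> {}" and noiso: "\<And>v. v \<in> V \<Longrightarrow> nbs v \<noteq> {}"
  shows "\<exists>l :: 'v \<times> 'v \<Rightarrow> ('v \<times> 'v) option.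
    (\<forall>(u, w)\<in>darts. l (w, next_nb w u) = l (u, w)) \<and> card S + 2 \<le> card V + card (l ` darts)"
proof -
  have V: "V \<noteq> {}" using S edgeD by blast
  define v0 where "v0 = arg_min_on X V"
  have v0: "v0 \<in> V" "\<And>u. u \<in> V \<Longrightarrow> X v0 \<le> X u"
    using arg_min_if_finite[OF finite_V V, of X] by (auto simp: v0_def not_less)
  define v1 where "v1 = arg_min_on (\<lambda>v. - X v) V"
  have v1: "v1 \<in> V" "\<And>u. u \<in> V \<Longrightarrow> X u \<le> X v1"
    using arg_min_if_finite[OF finite_V V, of "\<lambda>v. - X v"] by (auto simp: v1_def not_less)
  obtain e where "e \<in> S" using S by blast
  then have "X v0 < X v1" using edgeD[of e] v0(2)[of "fst e"] v1(2)[of "snd e"] by auto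
  then have v01: "v0 \<noteq> v1" by auto
  have act0: "act x = {}" if "x \<le> X v0" for x
    using that v0(2) edgeD by (force simp: act_def)
  have act1: "act (X v1) = {}"
    using v1(2) edgeD by (force simp: act_def)
  have nl0: "left_edges v0 = {}" using left_edges_nb v0(2) nbs_def darts_def edgeD
    by (fastforce simp: left_edges_def)
  have nr1: "right_edges v1 = {}" using v1(2) edgeD by (force simp: right_edges_def)
  obtain z where "z \<in> nbs v0" using noiso[OF v0(1)] by blast
  then have r0: "right_edges v0 \<noteq> {}"
    by (cases rule: nbs_cases) (use nl0 in auto)
  obtain z' where "z' \<in> nbs v1" using noiso[OF v1(1)] by blast
  then have l1: "left_edges v1 \<noteq> {}"
    by (cases rule: nbs_cases) (use nr1 in auto)
  define N where "N = insert None (Some ` S)"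
  define Lk where "Lk = (\<lambda>v. (top_left v, top_right v)) ` (V - {v1})"
  have "finite N" "finite Lk" using finite_S finite_V by (auto simp: N_def Lk_def)
  from exists_labelling_respecting_links[OF this]
  obtain c :: "('v \<times> 'v) option \<Rightarrow> ('v \<times> 'v) option"
    where c: "\<forall>(a, b)\<in>Lk. c a = c b" "card N \<le> card (c ` N) + card Lk" by blast
  have link': "c (top_left v) = c (top_right v)" if "v \<in> V" "v \<noteq> v1" for v
    using c(1) that by (auto simp: Lk_def)
  have "c (top_left v1) = c (top_right v1)"
  proof -
    have "X v0 - 1 < X v1" using v0(2)[OF v1(1)] by simp
    then obtain x where x: "X v0 - 1 < x" "near_left v1 x" using ex_near_left by blast
    \<comment> \<open>The ceiling \<open>None\<close> follows the topmost region from the left of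
      all vertices, where its floor is \<open>None\<close>, to \<open>v1\<close>, where its floor is
      \<open>top_left v1\<close>.\<close>
    have "c (floor_of (X v0 - 1) None) = c (floor_of x None)"
    proof (rule floor_sweep)
      show "X v0 - 1 \<notin> X ` V" using v0(2) by force
      show "x \<notin> X ` V" using x near_left_notin by blast
      fix v assume "v \<in> V" "X v < x"
      then show "c (top_left v) = c (top_right v)"
        using x by (intro link') (auto simp: near_left_def)
    qed (use x in auto)
    moreover have "floor_of (X v0 - 1) None = None"
      using act0[of "X v0 - 1"] by (simp add: floor_of_def)
    moreover have "floor_of x None = top_left v1"
      using near_left_side[OF v1(1) x(2)] act1 top_left_topmost[OF x(2) v1(1) l1]
      by (simp add: floor_of_def side_def under_def)
    moreover have "top_right v1 = None"
      using nr1 act1 by (simp add: top_right_def below_vertex_def)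
    ultimately show ?thesis by simp
  qed
  then have links: "c (top_left v) = c (top_right v)" if "v \<in> V" for v
    using link' that by blast
  define l where "l = lab c"
  have l_S: "l e = c (Some e)" if "e \<in> S" for e
    using edgeD[OF that] by (simp add: l_def lab_def[OF links])
  have "top_left v0 = None"
    using nl0 act0[of "X v0"] by (simp add: top_left_def below_vertex_def)
  moreover have "top_right v0 \<in> Some ` S"
    using r0 arg_min_if_finite(1)[OF _ r0, of "\<lambda>e. - sl e"] finite_S
    by (auto simp: top_right_def right_edges_def)
  \<comment> \<open>The link at \<open>v0\<close> gives the bottom region the label of an edge, so
    all labels counted in \<open>N\<close> occur on darts.\<close>
  ultimately have "c None \<in> c ` Some ` S" using links[OF v0(1)] by (metis imageI)
  then have "c ` N = c ` Some ` S" by (auto simp: N_def)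
  also have "\<dots> = l ` S" using l_S by (auto simp: image_iff)
  finally have "card (c ` N) \<le> card (l ` darts)"
    using finite_S by (auto simp: darts_def image_Un intro!: card_mono finite_imageI
        finite_subset[of "{(w, u). (u, w) \<in> S}" "prod.swap ` S"])
  moreover have "card N = card S + 1"
    using finite_S by (simp add: N_def card_image card_insert_if image_iff)
  moreover have "card Lk \<le> card V - 1"
    using card_image_le[of "V - {v1}" "\<lambda>v. (top_left v, top_right v)"] finite_V v1(1)
    by (simp add: Lk_def)
  moreover have "card V \<ge> 1" using V finite_V by (simp add: Suc_leI card_gt_0_iff)
  ultimately have "card S + 2 \<le> card V + card (l ` darts)" using c(2) by linarith
  moreover have "\<forall>(u, w)\<in>darts. l (w, next_nb w u) = l (u, w)"
    using lab_next[OF links] by (auto simp: l_def)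
  ultimately show ?thesis by blast
qed

end

section \<open>Discharging\<close>


text \<open>A dart is a directed edge; \<open>nx w u\<close> is the neighbour of \<open>w\<close> that follows \<open>u\<close> in
  clockwise order. \<open>V\<close> are the original vertices and \<open>C\<close> the points where exactly two edges
  cross, so that applying \<open>nx x\<close> twice leads to the other side of \<open>x\<close> on the same edge.\<close>

locale crossing_map =
  fixes D :: "('a :: euclidean_space \<times> 'a) set" and V C :: "'a set" and nx :: "'a \<Rightarrow> 'a \<Rightarrow> 'a"
  assumes finite_D: "finite D"
    and D_sym: "(p, q) \<in> D \<Longrightarrow> (q, p) \<in> D"
    and D_irrefl: "(p, p) \<notin> D"
    and nx_D: "(u, w) \<in> D \<Longrightarrow> (w, nx w u) \<in> D"
    and nx_inj: "\<lbrakk>(u, w) \<in> D; (u', w) \<in> D; nx w u = nx w u'\<rbrakk> \<Longrightarrow> u = u'"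
    and nx_neq: "(u, w) \<in> D \<Longrightarrow> nx w u \<noteq> u"
    and C_V: "x \<in> C \<Longrightarrow> x \<notin> V"
    and nx_four: "\<lbrakk>x \<in> C; (u, x) \<in> D\<rbrakk> \<Longrightarrow> nx x (nx x (nx x (nx x u))) = u"
    and nx_straight: "\<lbrakk>x \<in> C; (u, x) \<in> D\<rbrakk> \<Longrightarrow> x \<in> open_segment u (nx x (nx x u))"
    and D_nearest: "\<lbrakk>(p, x) \<in> D; (p, y) \<in> D; x \<in> open_segment p a; y \<in> open_segment p a\<rbrakk> \<Longrightarrow> x = y"
    and inner_C: "\<lbrakk>(p, q) \<in> D; p \<notin> V; q \<notin> V\<rbrakk> \<Longrightarrow> p \<in> C"
    and inner_V: "\<lbrakk>(p, q) \<in> D; p \<notin> V; q \<notin> V\<rbrakk> \<Longrightarrow> nx p (nx p q) \<in> V"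
    and inner_between: "\<lbrakk>(p, q) \<in> D; p \<notin> V; q \<notin> V\<rbrakk> \<Longrightarrow>
       p \<in> open_segment (nx p (nx p q)) (nx q (nx q p))"
    and inner_short: "\<lbrakk>(x, z) \<in> D; x \<notin> V; z \<notin> V; y = nx z x; y \<notin> V\<rbrakk> \<Longrightarrow>
       dist (nx x (nx x z)) (nx z (nx z y)) + dist (nx z (nx z x)) (nx y (nx y z)) < 2"
    and D_unit: "\<lbrakk>(p, q) \<in> D; p \<in> V; q \<in> V\<rbrakk> \<Longrightarrow> dist p q = 1"
begin

abbreviation opp :: "'a \<Rightarrow> 'a \<Rightarrow> 'a" where
  "opp x u \<equiv> nx x (nx x u)"

text \<open>Fixing everything outside \<open>D\<close> makes this a permutation of the whole type,
  so that faces are orbits in the sense of the library.\<close>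

definition fnext :: "'a \<times> 'a \<Rightarrow> 'a \<times> 'a" where
  "fnext d = (if d \<in> D then (snd d, nx (snd d) (fst d)) else d)"

definition rev :: "'a \<times> 'a \<Rightarrow> 'a \<times> 'a" where
  "rev d = (snd d, fst d)"

definition face :: "'a \<times> 'a \<Rightarrow> ('a \<times> 'a) set" where
  "face d = orbit fnext d"

definition inner :: "'a \<times> 'a \<Rightarrow> bool" where
  "inner d \<longleftrightarrow> d \<in> D \<and> fst d \<notin> V \<and> snd d \<notin> V"

lemma rev_simps [simp]: "rev (p, q) = (q, p)" "fst (rev d) = snd d" "snd (rev d) = fst d"
  "rev (rev d) = d"
  by (simp_all add: rev_def)

lemma rev_D [simp]: "rev d \<in> D \<longleftrightarrow> d \<in> D"
  by (cases d) (auto intro: D_sym)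

lemma inner_rev [simp]: "inner (rev d) \<longleftrightarrow> inner d"
  by (auto simp: inner_def)

lemma fnext_eq: "(u, w) \<in> D \<Longrightarrow> fnext (u, w) = (w, nx w u)"
  by (simp add: fnext_def)

lemma fnext_D [simp]: "d \<in> D \<Longrightarrow> fnext d \<in> D"
  by (cases d) (simp add: fnext_eq nx_D)

lemma fst_fnext [simp]: "d \<in> D \<Longrightarrow> fst (fnext d) = snd d"
  by (simp add: fnext_def)

lemma funpow_fnext_D [simp]: "d \<in> D \<Longrightarrow> (fnext ^^ i) d \<in> D"
  by (induction i) auto

lemma inj_on_fnext: "inj_on fnext D"
  by (rule inj_onI) (auto simp: fnext_def dest: nx_inj)

lemma fnext_permutes: "fnext permutes D"
proof (rule bij_imp_permutes)
  show "bij_betw fnext D D"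
    unfolding bij_betw_def using inj_on_fnext finite_D
    by (meson endo_inj_surj fnext_D image_subsetI)
qed (simp add: fnext_def)

lemma permutation_fnext: "permutation fnext"
  using fnext_permutes finite_D permutation_permutes by blast

lemma self_in_face: "d \<in> face d"
  unfolding face_def by (rule permutation_self_in_orbit[OF permutation_fnext])

lemma face_eq: "d' \<in> face d \<Longrightarrow> face d' = face d"
  unfolding face_def
  by (rule orbit_cyclic_eq3[OF cyclic_on_orbit[OF fnext_permutes finite_D]])

lemma face_subset: "d \<in> D \<Longrightarrow> face d \<subseteq> D"
  unfolding face_def by (rule permutes_orbit_subset[OF fnext_permutes])

lemma finite_face: "d \<in> D \<Longrightarrow> finite (face d)"
  using face_subset finite_D finite_subset by blast

lemma fnext_in_face: "d' \<in> face d \<Longrightarrow> fnext d' \<in> face d"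
  unfolding face_def by (rule orbit.step)

lemma face_enum:
  assumes "d \<in> D"
  defines "s \<equiv> card (face d)"
  shows "face d = (\<lambda>i. (fnext ^^ i) d) ` {..<s}" "inj_on (\<lambda>i. (fnext ^^ i) d) {..<s}"
    "(fnext ^^ s) d = d"
proof -
  have d: "d \<in> orbit fnext d" using self_in_face by (simp add: face_def)
  define k where "k = funpow_dist1 fnext d d"
  have o: "face d = (\<lambda>i. (fnext ^^ i) d) ` {..<k}"
    using orbit_conv_funpow_dist1[OF d] by (simp add: face_def k_def atLeast0LessThan)
  have i: "inj_on (\<lambda>i. (fnext ^^ i) d) {..<k}"
    using inj_on_funpow_dist1[OF d] by (simp add: k_def atLeast0LessThan)
  have "s = k" using o i by (simp add: s_def card_image)
  then show "face d = (\<lambda>i. (fnext ^^ i) d) ` {..<s}" "inj_on (\<lambda>i. (fnext ^^ i) d) {..<s}"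
    using o i by auto
  show "(fnext ^^ s) d = d"
    using funpow_dist1_prop[OF d] \<open>s = k\<close> by (simp add: k_def)
qed

lemma face_sum:
  fixes g :: "_ \<Rightarrow> real"
  assumes "d \<in> D"
  shows "sum g (face d) = (\<Sum>i<card (face d). g ((fnext ^^ i) d))"
  using face_enum[OF assms] by (metis (mono_tags, lifting) sum.reindex_cong)

lemma fnext2_neq: "d \<in> D \<Longrightarrow> fnext (fnext d) \<noteq> d"
proof (cases d)
  fix u w assume "d \<in> D" "d = (u, w)"
  then show ?thesis
    using nx_neq[of u w] nx_D[of u w] by (simp add: fnext_eq)
qed

lemma fnext_neq: "d \<in> D \<Longrightarrow> fnext d \<noteq> d"
  using fnext2_neq[of d] by auto

text \<open>By \<open>nx_neq\<close> a face walk never turns straight back.\<close>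

lemma card_face_ge_3: "d \<in> D \<Longrightarrow> 3 \<le> card (face d)"
proof -
  assume d: "d \<in> D"
  have "{d, fnext d, fnext (fnext d)} \<subseteq> face d"
    using self_in_face fnext_in_face by simp
  moreover have "card {d, fnext d, fnext (fnext d)} = 3"
    using fnext_neq[OF d] fnext2_neq[OF d] fnext_neq[of "fnext d"] d by auto
  ultimately show ?thesis using card_mono[OF finite_face[OF d]] by metis
qed

lemma nx_C:
  assumes "x \<in> C" "(u, x) \<in> D"
  shows "nx x (opp x (nx x u)) = u" "(x, opp x u) \<in> D" "(opp x u, x) \<in> D" "opp x (opp x u) = u"
proof -
  show "nx x (opp x (nx x u)) = u" "opp x (opp x u) = u" using nx_four[OF assms] by auto
  show "(x, opp x u) \<in> D" by (meson D_sym assms nx_D)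
  then show "(opp x u, x) \<in> D" by (rule D_sym)
qed

lemma inner_pairD:
  assumes "inner (p, q)"
  shows "(p, q) \<in> D" "(q, p) \<in> D" "p \<notin> V" "q \<notin> V" "p \<in> C" "q \<in> C" "opp p q \<in> V" "opp q p \<in> V"
  using assms inner_C[of p q] inner_V[of p q] inner_C[of q p] inner_V[of q p] D_sym[of p q]
  by (auto simp: inner_def)

definition big :: "('a \<times> 'a) set \<Rightarrow> bool" where
  "big F \<longleftrightarrow> 2 \<le> card {d \<in> F. fst d \<in> V}"

text \<open>A triangle whose inner side \<open>d\<close> is opposite an original corner; across this
  side it asks for support.\<close>

definition tri :: "'a \<times> 'a \<Rightarrow> bool" where
  "tri d \<longleftrightarrow> inner d \<and> fnext (fnext (fnext d)) = d \<and> fst (fnext (fnext d)) \<in> V"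

text \<open>The discharging rules: if \<open>pay d\<close>, the face of \<open>d\<close> gives \<open>1/2\<close> to the face of
  \<open>rev d\<close>; if \<open>pat d\<close>, it gives \<open>1/2\<close> to the face of \<open>opp_corner d\<close>, which is the face
  in the opposite angle at the head of \<open>d\<close>.\<close>

definition pay :: "'a \<times> 'a \<Rightarrow> bool" where
  "pay d \<longleftrightarrow> inner d \<and> (big (face d) \<or> tri (rev d))"

definition pat :: "'a \<times> 'a \<Rightarrow> bool" where
  "pat d \<longleftrightarrow> d \<in> D \<and> fst d \<in> V \<and> snd d \<in> C \<and> snd (fnext d) \<in> V \<and> fnext (fnext (fnext d)) \<noteq> d"

definition opp_corner :: "'a \<times> 'a \<Rightarrow> 'a \<times> 'a" where
  "opp_corner d = (opp (snd d) (fst d), snd d)"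

text \<open>The recipient's side of \<open>pat\<close>: the corner in question is the one at the
  head of \<open>d\<close>.\<close>

definition rcv :: "'a \<times> 'a \<Rightarrow> bool" where
  "rcv d \<longleftrightarrow> d \<in> D \<and> snd d \<in> C \<and> pat (opp_corner d)"

lemma bigI:
  assumes "d \<in> D" "d1 \<in> face d" "d2 \<in> face d" "d1 \<noteq> d2" "fst d1 \<in> V" "fst d2 \<in> V"
  shows "big (face d)"
proof -
  have "card {d1, d2} \<le> card {e \<in> face d. fst e \<in> V}"
    using assms finite_face[OF assms(1)] by (intro card_mono) auto
  then show ?thesis using assms by (simp add: big_def)
qed

text \<open>The face on the other side of the inner dart \<open>(x, z)\<close> enters that side from \<open>opp z y\<close>
  and leaves it towards \<open>opp x w\<close>.\<close>

lemma tri_revD: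
  assumes "(w, x) \<in> D" "nx x w = z" "nx z x = y" and tri: "tri (z, x)"
  shows "opp x w = opp z y" "opp x w \<in> V" "(opp x w, z) \<in> D"
proof -
  have i: "inner (z, x)" using tri by (simp add: tri_def)
  note i = inner_pairD[OF i]
  have f1: "fnext (z, x) = (x, opp x w)" using i assms(2) by (simp add: fnext_eq)
  have "(x, opp x w) \<in> D" using nx_C[OF i(6) assms(1)] by simp
  then have f2: "fnext (fnext (z, x)) = (opp x w, nx (opp x w) x)"
    using f1 by (simp add: fnext_eq)
  have D2: "(opp x w, nx (opp x w) x) \<in> D" using f2 i(1) by (metis fnext_D)
  then have f3: "fnext (fnext (fnext (z, x))) = (nx (opp x w) x, nx (nx (opp x w) x) (opp x w))"
    using f2 by (simp add: fnext_eq)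
  then have q: "nx (opp x w) x = z" "nx z (opp x w) = x" using tri by (auto simp: tri_def)
  show "opp x w \<in> V" using tri f2 by (simp add: tri_def)
  show D3: "(opp x w, z) \<in> D" using D2 q by simp
  have "nx z (opp z y) = x" using nx_C(1)[OF i(5,2)] assms(3) by simp
  moreover have "(opp z y, z) \<in> D"
    using nx_C(3)[OF i(5)] nx_D[OF i(2)] assms(3) D_sym by blast
  ultimately show "opp x w = opp z y" using nx_inj[OF D3] q(2) by metis
qed

text \<open>Two such triangles on the common side \<open>(x, z)\<close> would have their remaining
  corners joined by a straight line through \<open>x\<close> and by another through
  \<open>z\<close>. Both lines are the same, and \<open>x\<close>, \<open>z\<close> would both be
  nearest to \<open>w\<close> on it.\<close>

lemma not_tri_rev_of_triangle:
  assumes "inner d" "fnext (fnext (fnext d)) = d"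
  shows "\<not> tri (rev d)"
proof
  assume t: "tri (rev d)"
  obtain x z where d: "d = (x, z)" by (cases d)
  define w where "w = nx z x"
  have i: "inner (x, z)" using assms d by simp
  note i = inner_pairD[OF i]
  have zw: "(z, w) \<in> D" using nx_D[OF i(1)] by (simp add: w_def)
  have "fnext (fnext (x, z)) = (w, nx w z)" using i zw by (simp add: fnext_eq w_def[symmetric])
  then have "nx w z = x" "nx x w = z" using assms d nx_D[OF zw] by (auto simp: fnext_eq)
  moreover from this have wx: "(w, x) \<in> D" using nx_D[OF zw] by simp
  ultimately have *: "opp x w = opp z w" using tri_revD(1)[OF wx _ refl] t d w_def by simp
  have "x = z"
  proof (rule D_nearest[OF wx D_sym[OF zw]])
    show "x \<in> open_segment w (opp x w)" by (rule nx_straight[OF i(5) wx])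
    show "z \<in> open_segment w (opp x w)" using nx_straight[OF i(6) D_sym[OF zw]] * by simp
  qed
  then show False using i D_irrefl by simp
qed

text \<open>Triangles across two opposite sides of the quadrilateral would make the lines along the
  other two sides meet in both apexes. These lines would coincide, which forces
  \<open>x1 = x2\<close>.\<close>

lemma not_tri_opposite:
  assumes d: "inner d" "inner (fnext d)" "inner (fnext (fnext d))" "inner (fnext (fnext (fnext d)))"
    and four: "fnext (fnext (fnext (fnext d))) = d"
  shows "\<not> (tri (rev (fnext d)) \<and> tri (rev (fnext (fnext (fnext d)))))"
proof
  assume t: "tri (rev (fnext d)) \<and> tri (rev (fnext (fnext (fnext d))))"
  obtain x0 x1 where d0: "d = (x0, x1)" by (cases d)
  define x2 where "x2 = nx x1 x0"
  define x3 where "x3 = nx x2 x1"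
  have d1: "fnext d = (x1, x2)" using d d0 by (simp add: inner_def fnext_eq x2_def)
  then have d2: "fnext (fnext d) = (x2, x3)" using d by (simp add: inner_def fnext_eq x3_def)
  then have d3: "fnext (fnext (fnext d)) = (x3, nx x3 x2)" using d by (simp add: inner_def fnext_eq)
  then have x0: "nx x3 x2 = x0" "nx x0 x3 = x1"
    using four d d0 by (auto simp: inner_def fnext_eq)
  note i0 = inner_pairD[OF d(1)[unfolded d0]]
    and i1 = inner_pairD[OF d(2)[unfolded d1]]
    and i2 = inner_pairD[OF d(3)[unfolded d2]]
    and i3 = inner_pairD[OF d(4)[unfolded d3 x0]]
  have a: "opp x1 x0 = opp x2 x3" using tri_revD(1)[OF i0(1)] t d1 by (simp add: x2_def x3_def)
  have b: "opp x3 x2 = opp x0 x1" using tri_revD(1)[OF i2(1)] t d3 x0 by simp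
  have "x1 = x2"
  proof (rule D_nearest)
    show "(opp x1 x0, x1) \<in> D" using nx_C(3) i0 by blast
    show "(opp x1 x0, x2) \<in> D" using nx_C(3) i2 a by metis
    show "x1 \<in> open_segment (opp x1 x0) (opp x0 x1)" using inner_between i0 by blast
    show "x2 \<in> open_segment (opp x1 x0) (opp x0 x1)" unfolding a b[symmetric]
      using inner_between i2 by blast
  qed
  then show False using i1 D_irrefl by simp
qed

text \<open>The face across the middle side comes from the original vertex \<open>opp z y\<close>
  and goes on to the original vertex \<open>opp x w\<close>. If these are different corners the face
  is big and pays; if they are the same corner it is a triangle.\<close>

lemma tri_or_pay_across:
  assumes d: "d \<in> D" "inner d" "inner (fnext d)" "inner (fnext (fnext d))"
  shows "tri (rev (fnext d)) \<or> pay (rev (fnext d))"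
proof -
  obtain w x where d0: "d = (w, x)" by (cases d)
  define z where "z = nx x w"
  define y where "y = nx z x"
  have d1: "fnext d = (x, z)" using d d0 by (simp add: fnext_eq z_def)
  then have d2: "fnext (fnext d) = (z, y)" using d by (simp add: inner_def fnext_eq y_def)
  note i0 = inner_pairD[OF d(2)[unfolded d0]]
    and i1 = inner_pairD[OF d(3)[unfolded d1]]
    and i2 = inner_pairD[OF d(4)[unfolded d2]]
  define p1 where "p1 = (opp z y, z)"
  define p2 where "p2 = fnext (x, opp x w)"
  have p1D: "p1 \<in> D" unfolding p1_def using nx_C(3) i2 by blast
  have "fnext p1 = (z, x)" unfolding p1_def
    using p1D nx_C(1)[OF i1(6,1)] by (simp add: p1_def fnext_eq y_def)
  moreover have xw: "(x, opp x w) \<in> D" using nx_C(2) i0 by blast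
  moreover have f1: "fnext (z, x) = (x, opp x w)" using i1 by (simp add: fnext_eq z_def)
  ultimately have in_face: "p2 \<in> face (z, x)" "(z, x) \<in> face p1"
    using fnext_in_face[OF self_in_face] fnext_in_face[OF fnext_in_face[OF self_in_face]]
    unfolding p2_def by metis+
  then have in_face': "p1 \<in> face (z, x)" using face_eq self_in_face by metis
  have V: "fst p1 \<in> V" "fst p2 \<in> V" using i0 i2 xw by (auto simp: p1_def p2_def)
  show ?thesis
  proof (cases "p1 = p2")
    case True
    then have "fnext (fnext (fnext (z, x))) = (z, x)"
      using \<open>fnext p1 = (z, x)\<close> f1 by (simp add: p2_def)
    moreover have "fst (fnext (fnext (z, x))) \<in> V" using V f1 by (simp add: p2_def)
    ultimately have "tri (z, x)" using d(3) d1 inner_rev[of "(x, z)"] by (simp add: tri_def)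
    then show ?thesis by (simp add: d1)
  next
    case False
    then have "big (face (z, x))" using bigI[OF i1(2) in_face' in_face(1)] V by blast
    then show ?thesis using d(3) inner_rev[of "(x, z)"] by (simp add: d1 pay_def)
  qed
qed

text \<open>The two sides lie on unit edges crossing at \<open>z\<close>. If \<open>rcv\<close> failed at both
  neighbouring corners, two opposite sides of the quadrilateral spanned by these edges would be
  edges as well.\<close>

lemma conflict:
  assumes d: "d \<in> D" "inner (fnext d)" "inner (fnext (fnext d))"
    and t: "tri (rev (fnext d))" "tri (rev (fnext (fnext d)))"
  shows "rcv d \<or> rcv (fnext (fnext d))"
proof -
  obtain w x where d0: "d = (w, x)" by (cases d)
  define z where "z = nx x w"
  define y where "y = nx z x"
  define q where "q = nx y z"
  have wx: "(w, x) \<in> D" using d d0 by simp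
  have d1: "fnext d = (x, z)" using d d0 by (simp add: fnext_eq z_def)
  then have d2: "fnext (fnext d) = (z, y)" using d by (simp add: inner_def fnext_eq y_def)
  note i1 = inner_pairD[OF d(2)[unfolded d1]]
    and i2 = inner_pairD[OF d(3)[unfolded d2]]
  have "tri (z, x)" "tri (y, z)" using t d1 d2 by auto
  note t1 = tri_revD[OF wx z_def[symmetric] y_def[symmetric] this(1)]
    and t2 = tri_revD[OF i1(1) y_def[symmetric] q_def[symmetric] this(2)]
  have yq: "(y, q) \<in> D" using nx_D[OF i2(1)] by (simp add: q_def)
  have "dist (opp x z) (opp z y) + dist (opp z x) (opp y z) < 2"
    by (rule inner_short[OF i1(1,3,4) y_def i2(4)])
  then consider "dist (opp x z) (opp z y) \<noteq> 1" | "dist (opp z x) (opp y z) \<noteq> 1" by linarith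
  then show ?thesis
  proof cases
    case 1
    \<comment> \<open>The corner opposite to the one at \<open>x\<close>. If its face were a
      triangle, its third side would join \<open>opp x z\<close> and
      \<open>opp x w = opp z y\<close>, two original vertices, and would have length 1, which this
      case excludes.\<close>
    let ?A = "(opp x w, x)"
    have AD: "?A \<in> D" "(x, opp x z) \<in> D" using nx_C[OF i1(5)] wx i1(2) by auto
    have f: "fnext ?A = (x, opp x z)" using AD by (simp add: fnext_eq z_def)
    have "fnext (fnext (fnext ?A)) \<noteq> ?A"
    proof
      assume "fnext (fnext (fnext ?A)) = ?A"
      then have "fnext (opp x z, nx (opp x z) x) = ?A" using AD f by (simp add: fnext_eq)
      moreover have "(opp x z, nx (opp x z) x) \<in> D" using nx_D[OF AD(2)] by simp
      ultimately have "(opp x z, opp x w) \<in> D" by (auto simp: fnext_eq)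
      then show False using D_unit[of "opp x z" "opp x w"] t1 i1 1 by simp
    qed
    then have "pat ?A" using AD t1 i1 f by (simp add: pat_def)
    then have "rcv d" using d i1 by (simp add: rcv_def d0 opp_corner_def)
    then show ?thesis by simp
  next
    case 2
    let ?B = "(opp y z, y)"
    have BD: "?B \<in> D" "(y, opp y q) \<in> D" using nx_C[OF i2(6)] i2(1) yq D_sym by auto
    have f: "fnext ?B = (y, opp y q)" using BD by (simp add: fnext_eq q_def)
    have "fnext (fnext (fnext ?B)) \<noteq> ?B"
    proof
      assume "fnext (fnext (fnext ?B)) = ?B"
      then have "fnext (opp y q, nx (opp y q) y) = ?B" using BD f by (simp add: fnext_eq)
      moreover have "(opp y q, nx (opp y q) y) \<in> D" using nx_D[OF BD(2)] by simp
      ultimately have "(opp y q, opp y z) \<in> D" by (auto simp: fnext_eq)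
      then show False using D_unit[of "opp y q" "opp y z"] t2 i2 2 by simp
    qed
    then have "pat ?B" using BD t2 i2 f by (simp add: pat_def)
    then have "rcv (z, y)" using i2 by (simp add: rcv_def opp_corner_def)
    then show ?thesis using d2 by simp
  qed
qed


text \<open>A dart contributes 1 to the length of its face and 1/2 if the corner at its tail is
  original; the remaining terms are the transfers across it and at the corner at its head.\<close>

definition charge :: "'a \<times> 'a \<Rightarrow> real" where
  "charge d = 1 + of_bool (fst d \<in> V) / 2 +
     (of_bool (pay (rev d)) - of_bool (pay d) + of_bool (rcv d) - of_bool (pat d)) / 2"

lemma sum_charge:
  assumes "finite F"
  shows "sum charge F = card F + card {d \<in> F. fst d \<in> V} / 2 +
    (real (card {d \<in> F. pay (rev d)}) - card {d \<in> F. pay d} + card {d \<in> F. rcv d}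
      - card {d \<in> F. pat d}) / 2"
proof -
  have c: "(\<Sum>d\<in>F. of_bool (P d)) = real (card {d \<in> F. P d})" for P
    using assms by (simp add: Int_def)
  have "sum charge F = (\<Sum>d\<in>F. 1) + (\<Sum>d\<in>F. of_bool (fst d \<in> V)) / 2 +
    ((\<Sum>d\<in>F. of_bool (pay (rev d))) - (\<Sum>d\<in>F. of_bool (pay d)) + (\<Sum>d\<in>F. of_bool (rcv d))
      - (\<Sum>d\<in>F. of_bool (pat d))) / 2"
    unfolding charge_def
    by (simp only: sum.distrib sum_subtractf sum_divide_distrib[symmetric])
  then show ?thesis unfolding c by simp
qed

text \<open>Reversal matches the two ends of every transfer across a side, and the involution
  \<open>opp_corner\<close> those of every transfer at a corner, so the transfers cancel.\<close>

lemma sum_charge_D: "sum charge D = card D + card {d \<in> D. fst d \<in> V} / 2"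
proof -
  have "bij_betw rev {d \<in> D. pay (rev d)} {d \<in> D. pay d}"
    by (rule bij_betw_byWitness[of _ rev]) (auto dest: D_sym)
  then have 1: "card {d \<in> D. pay (rev d)} = card {d \<in> D. pay d}" by (rule bij_betw_same_card)
  have inv: "opp_corner (opp_corner d) = d" "opp_corner d \<in> D" if "d \<in> D" "snd d \<in> C" for d
    using nx_C(3,4)[of "snd d" "fst d"] that by (auto simp: opp_corner_def)
  have "bij_betw opp_corner {d \<in> D. rcv d} {d \<in> D. pat d}"
  proof (rule bij_betw_byWitness[of _ opp_corner])
    show "\<forall>d\<in>{d \<in> D. rcv d}. opp_corner (opp_corner d) = d"
      "opp_corner ` {d \<in> D. rcv d} \<subseteq> {d \<in> D. pat d}"
      "\<forall>d\<in>{d \<in> D. pat d}. opp_corner (opp_corner d) = d"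
      using inv by (auto simp: rcv_def pat_def)
    show "opp_corner ` {d \<in> D. pat d} \<subseteq> {d \<in> D. rcv d}"
    proof
      fix e assume "e \<in> opp_corner ` {d \<in> D. pat d}"
      then obtain d where d: "e = opp_corner d" "d \<in> D" "pat d" by blast
      then have "snd d \<in> C" by (simp add: pat_def)
      then show "e \<in> {d \<in> D. rcv d}" using d inv[of d] by (simp add: rcv_def) (simp add: opp_corner_def)
    qed
  qed
  then have 2: "card {d \<in> D. rcv d} = card {d \<in> D. pat d}" by (rule bij_betw_same_card)
  show ?thesis unfolding sum_charge[OF finite_D] 1 2 by simp
qed

section \<open>Every face ends with charge at least 4\<close>

lemma fnext_image_face:
  assumes "d \<in> D"
  shows "fnext ` face d = face d"
proof (rule endo_inj_surj)
  show "inj_on fnext (face d)" using inj_on_fnext face_subset[OF assms] by (rule inj_on_subset)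
qed (use finite_face[OF assms] fnext_in_face in blast)+

text \<open>The walk leaves and enters \<open>V\<close> equally often, so the length is
  \<open>a + 2b + i\<close>. Payments across sides number at most \<open>i\<close>, those at corners
  \<open>k\<close>, with \<open>k\<close> at most \<open>b\<close>. What remains is at least 3a/2 +
  5b/2 + i/2 - k/2, hence at least 3a/2 + 2b + i/2. This suffices unless \<open>a = b = 1\<close>
  and \<open>i = 0\<close>, or \<open>b = 0\<close> and \<open>a = 2\<close>.\<close>

lemma charge_big:
  assumes d: "d \<in> D" and big: "big (face d)"
  shows "4 \<le> sum charge (face d)"
proof -
  define F where "F = face d"
  have fin: "finite F" and FD: "F \<subseteq> D" using finite_face face_subset d by (auto simp: F_def)
  have face_F: "face e = F" if "e \<in> F" for e using face_eq that by (simp add: F_def)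
  define a where "a = card {e \<in> F. fst e \<in> V \<and> snd e \<in> V}"
  define b where "b = card {e \<in> F. fst e \<in> V \<and> snd e \<notin> V}"
  define b' where "b' = card {e \<in> F. fst e \<notin> V \<and> snd e \<in> V}"
  define i where "i = card {e \<in> F. fst e \<notin> V \<and> snd e \<notin> V}"
  define k where "k = card {e \<in> F. pat e}"
  have split: "card {e \<in> F. P e} = card {e \<in> F. P e \<and> Q e} + card {e \<in> F. P e \<and> \<not> Q e}" for P Q
  proof -
    have "{e \<in> F. P e} = {e \<in> F. P e \<and> Q e} \<union> {e \<in> F. P e \<and> \<not> Q e}" by auto
    moreover have "{e \<in> F. P e \<and> Q e} \<inter> {e \<in> F. P e \<and> \<not> Q e} = {}" by auto
    ultimately show ?thesis using fin by (metis (no_types, lifting) card_Un_disjoint finite_Un finite_subset mem_Collect_eq subsetI)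
  qed
  have ab: "card {e \<in> F. fst e \<in> V} = a + b"
    using split[of "\<lambda>e. fst e \<in> V" "\<lambda>e. snd e \<in> V"] by (simp add: a_def b_def)
  have ab': "card {e \<in> F. snd e \<in> V} = a + b'"
    using split[of "\<lambda>e. snd e \<in> V" "\<lambda>e. fst e \<in> V"] by (simp add: a_def b'_def conj_commute)
  have s: "card F = a + b + b' + i"
    using split[of "\<lambda>e. True" "\<lambda>e. fst e \<in> V"] ab
      split[of "\<lambda>e. fst e \<notin> V" "\<lambda>e. snd e \<in> V"] by (simp add: b'_def i_def)
  have "{e \<in> F. fst e \<in> V} = fnext ` {e \<in> F. snd e \<in> V}"
  proof -
    have *: "fst (fnext e) = snd e" "fnext e \<in> F" if "e \<in> F" for e
      using that FD fnext_in_face by (auto simp: F_def)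
    show ?thesis
    proof (intro set_eqI iffI)
      fix e assume e: "e \<in> {e \<in> F. fst e \<in> V}"
      then obtain e' where "e' \<in> F" "e = fnext e'"
        using fnext_image_face[OF d] unfolding F_def by blast
      then show "e \<in> fnext ` {e \<in> F. snd e \<in> V}" using e *(1)[of e'] by simp
    next
      fix e assume "e \<in> fnext ` {e \<in> F. snd e \<in> V}"
      then obtain e' where "e' \<in> F" "snd e' \<in> V" "e = fnext e'" by blast
      then show "e \<in> {e \<in> F. fst e \<in> V}" using *[of e'] by simp
    qed
  qed
  moreover have "inj_on fnext {e \<in> F. snd e \<in> V}"
    by (rule inj_on_subset[OF inj_on_fnext]) (use FD in auto)
  ultimately have "a + b = a + b'" using ab ab' by (simp add: card_image)
  then have b': "b' = b" by simp
  have v: "2 \<le> a + b" using big ab by (simp add: big_def F_def)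
  have s3: "3 \<le> card F" using card_face_ge_3[OF d] by (simp add: F_def)
  have kb: "k \<le> b" unfolding k_def b_def
    using fin C_V by (intro card_mono) (auto simp: pat_def)
  \<comment> \<open>A walk that starts in \<open>V\<close> and never leaves it has no inner side;
    the length is then \<open>a\<close>, and \<open>a = 2\<close> contradicts length at least
    3.\<close>
  have b0: "i = 0" if "b = 0"
  proof -
    have e0: "{e \<in> F. fst e \<in> V \<and> snd e \<notin> V} = {}" using that fin by (simp add: b_def)
    have "{e \<in> F. fst e \<in> V} \<noteq> {}" using v ab by (metis card.empty not_numeral_le_zero)
    then obtain e where e: "e \<in> F" "fst e \<in> V" by blast
    have "(fnext ^^ j) e \<in> F \<and> fst ((fnext ^^ j) e) \<in> V" for j
    proof (induction j)
      case (Suc j)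
      then have "snd ((fnext ^^ j) e) \<in> V" using e0 by blast
      then show ?case using Suc FD fnext_in_face by (auto simp: F_def)
    qed (use e in simp)
    moreover have "\<exists>j. e' = (fnext ^^ j) e" if "e' \<in> F" for e'
      using that face_enum(1)[of e] face_F[OF e(1)] subsetD[OF FD e(1)] by auto
    ultimately have "fst e' \<in> V" if "e' \<in> F" for e'
      using that by blast
    then have "{e \<in> F. fst e \<notin> V \<and> snd e \<notin> V} = {}" by blast
    then show ?thesis by (simp only: i_def card.empty)
  qed
  \<comment> \<open>A triangle with two original corners has exactly 4 and nothing to spare, which
    is why \<open>pat\<close> excludes triangles.\<close>
  have tri: "k = 0" if "a = 1" "b = 1" "i = 0"
  proof -
    have "card F = 3" using that s b' by simp
    then have "fnext (fnext (fnext e)) = e" if "e \<in> F" for e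
      using face_enum(3)[of e] face_F[OF that] that FD by (auto simp: eval_nat_numeral)
    then have "{e \<in> F. pat e} = {}" unfolding pat_def by blast
    then show ?thesis by (simp only: k_def card.empty)
  qed
  have pi: "card {e \<in> F. pay e} \<le> i" unfolding i_def
    using fin by (intro card_mono) (auto simp: pay_def inner_def)
  have "card F + real (a + b) / 2 - (real i + k) / 2 \<le> sum charge F"
    unfolding sum_charge[OF fin] ab using pi by (simp add: k_def field_simps)
  moreover have "4 \<le> card F + real (a + b) / 2 - (real i + k) / 2"
  proof -
    consider "2 \<le> b" | "b = 1" "2 \<le> a" | "b = 1" "a = 1" "1 \<le> i" | "b = 1" "a = 1" "i = 0"
      | "b = 0" "3 \<le> a" | "b = 0" "a = 2" using v by linarith
    then show ?thesis
    proof cases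
      case 4
      then show ?thesis using tri s b' by simp
    next
      case 5
      then show ?thesis using b0 kb s b' by simp
    next
      case 6
      then show ?thesis using b0 s b' s3 by simp
    qed (use s b' kb in \<open>simp_all add: field_simps\<close>)
  qed
  ultimately show ?thesis by (simp add: F_def)
qed

text \<open>Started at its original corner, the face has \<open>s - 2\<close> inner sides. A
  triangle has 7/2, pays nothing, and receives 1/2 across its inner side. A quadrilateral has 9/2;
  if it pays twice, \<open>conflict\<close> returns 1/2 to it. From length 5 on, s + 1/2 - (s - 2)/2
  is at least 4 without help.\<close>

lemma charge_one:
  assumes d: "d \<in> D" "fst d \<in> V" and small: "\<not> big (face d)"
  shows "4 \<le> sum charge (face d)"
proof -
  define s where "s = card (face d)"
  define f where "f i = (fnext ^^ i) d" for i
  note en = face_enum[OF d(1), folded s_def]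
  have fD: "f i \<in> D" for i using d by (simp add: f_def)
  have fst_f: "fst (f (Suc i)) = snd (f i)" for i
    using fD[of i] by (simp add: f_def)
  have fnext_f: "fnext (f i) = f (Suc i)" for i by (simp add: f_def)
  have f0: "f 0 = d" and fs: "f s = d" using en(3) by (simp_all add: f_def)
  have fst_notin: "fst (f i) \<notin> V" if "0 < i" "i < s" for i
  proof
    assume "fst (f i) \<in> V"
    moreover have "f i \<noteq> d"
      using inj_onD[OF en(2), of i 0] that by (auto simp: f_def)
    moreover have "f i \<in> face d" using en(1) that by (auto simp: f_def)
    ultimately show False using bigI[OF d(1) _ self_in_face] d(2) small by blast
  qed
  have inner_f: "inner (f i)" if "0 < i" "Suc i < s" for i
    using that fst_notin[of i] fst_notin[of "Suc i"] fst_f[of i] fD by (simp add: inner_def)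
  have not_inner: "\<not> inner (f i)" if "i = 0 \<or> Suc i = s" for i
    using that d f0 fs fst_f[of i] by (auto simp: inner_def)
  have face_f: "face (f i) = face d" for i
  proof (rule face_eq)
    show "f i \<in> face d" unfolding f_def by (induction i) (auto simp: self_in_face fnext_in_face)
  qed
  have pay_f: "pay (f i) \<longleftrightarrow> inner (f i) \<and> tri (rev (f i))" for i
    using small by (auto simp: pay_def face_f)
  have s3: "3 \<le> s" using card_face_ge_3[OF d(1)] by (simp add: s_def)
  have pat_f: "\<not> pat (f i)" if i: "i < s" for i
  proof
    assume p: "pat (f i)"
    then have "i = 0" using fst_notin[of i] i by (auto simp: pat_def)
    then have "fst (f 2) \<in> V" using p fst_f[of 1] by (simp add: pat_def fnext_f numeral_2_eq_2)
    then show False using fst_notin[of 2] s3 by simp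
  qed
  have sum: "sum charge (face d) = (\<Sum>i<s. charge (f i))"
    using face_sum[OF d(1)] by (simp add: s_def f_def)
  have c0: "charge (f 0) = 3/2 + of_bool (pay (rev (f 0))) / 2 + of_bool (rcv (f 0)) / 2"
    using d f0 not_inner[of 0] pat_f[of 0] s3 by (simp add: charge_def pay_def)
  consider "s = 3" | "s = 4" | "5 \<le> s" using s3 by linarith
  then show ?thesis
  proof cases
    case 1
    have p3: "fnext (fnext (fnext (f 1))) = f 1"
      using fs f0 1 by (simp add: fnext_f) (metis fnext_f One_nat_def numeral_3_eq_3)
    have i1: "inner (f 1)" using inner_f[of 1] 1 by simp
    have "\<not> pay (f 1)" using pay_f not_tri_rev_of_triangle[OF i1 p3] by simp
    moreover have "tri (f 1)" using i1 p3 d f0 fs 1 fnext_f[of 0]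
      by (simp add: tri_def fnext_f numeral_3_eq_3)
    then have "pay (rev (f 1))" using i1 by (simp add: pay_def)
    ultimately have c1: "3/2 \<le> charge (f 1)"
      using pat_f[of 1] 1 by (simp add: charge_def)
    have "1 \<le> charge (f 2)"
      using pat_f[of 2] not_inner[of 2] 1 by (simp add: charge_def pay_def)
    then show ?thesis using c0 c1 unfolding sum 1 by (simp add: eval_nat_numeral)
  next
    case 2
    have i12: "inner (f 1)" "inner (f 2)" using inner_f 2 by auto
    have "1 \<le> charge (f 3)"
      using pat_f[of 3] not_inner[of 3] 2 by (simp add: charge_def pay_def)
    moreover have "1 - of_bool (pay (f 1)) / 2 \<le> charge (f 1)"
      "1 - of_bool (pay (f 2)) / 2 + of_bool (rcv (f 2)) / 2 \<le> charge (f 2)"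
      using pat_f[of 1] pat_f[of 2] 2 by (auto simp: charge_def)
    moreover have "rcv (f 0) \<or> rcv (f 2)" if "pay (f 1)" "pay (f 2)"
      using conflict[OF fD[of 0]] i12 that by (simp add: pay_f fnext_f numeral_2_eq_2)
    ultimately show ?thesis using c0 unfolding sum 2
      by (auto simp: eval_nat_numeral of_bool_def split: if_splits)
  next
    case 3
    have F: "finite (face d)" by (rule finite_face[OF d(1)])
    have pat0: "{e \<in> face d. pat e} = {}" using pat_f en(1) by (auto simp: f_def)
    have "{e \<in> face d. pay e} \<subseteq> f ` {0<..<s - 1}"
    proof
      fix e assume e: "e \<in> {e \<in> face d. pay e}"
      then obtain j where j: "e = f j" "j < s" using en(1) by (auto simp: f_def)
      then have "inner (f j)" using e by (simp add: pay_def)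
      then have "j \<noteq> 0 \<and> Suc j \<noteq> s" using not_inner[of j] by (cases "j = 0 \<or> Suc j = s") auto
      then show "e \<in> f ` {0<..<s - 1}" using j by auto
    qed
    then have "card {e \<in> face d. pay e} \<le> s - 2"
      using surj_card_le[of "{0<..<s - 1}" _ f] by (simp add: numeral_2_eq_2)
    moreover have "card {d} \<le> card {e \<in> face d. fst e \<in> V}"
      using d(2) self_in_face[of d] F by (intro card_mono) auto
    ultimately show ?thesis unfolding sum_charge[OF F] pat0 using 3 s_def[symmetric]
      by (simp add: field_simps)
  qed
qed

text \<open>All sides are inner, and across each side the face pays or receives 1/2. The charge is
  therefore at least 3s/2 minus the number of paying sides plus half the number of corners that
  receive. Triangles pay nowhere, quadrilaterals across at most two sides. For lengths 5 to 7
  \<open>conflict\<close> limits the loss, and from 8 on the remaining 1/2 per side is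
  enough.\<close>

lemma charge_none:
  assumes d: "d \<in> D" and none: "\<And>e. e \<in> face d \<Longrightarrow> fst e \<notin> V"
  shows "4 \<le> sum charge (face d)"
proof -
  define s where "s = card (face d)"
  define f where "f i = (fnext ^^ i) d" for i
  define p where "p i \<longleftrightarrow> tri (rev (f i))" for i
  define r where "r i \<longleftrightarrow> rcv (f i)" for i
  note en = face_enum[OF d(1), folded s_def]
  have fD: "f i \<in> D" for i using d by (simp add: f_def)
  have fst_f: "fst (f (Suc i)) = snd (f i)" for i
    using fD[of i] by (simp add: f_def)
  have fnext_f: "fnext (f i) = f (Suc i)" for i by (simp add: f_def)
  have fF: "f i \<in> face d" for i
    unfolding f_def by (induction i) (auto simp: self_in_face fnext_in_face)
  then have face_f: "face (f i) = face d" for i by (rule face_eq)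
  have per: "f (i + s) = f i" for i
    unfolding f_def funpow_add by (simp add: en(3))
  have inner_f: "inner (f i)" for i
    using none[OF fF[of i]] none[OF fF[of "Suc i"]] fst_f[of i] fD by (simp add: inner_def)
  have "\<not> big (face d)" using none by (auto simp: big_def cong: conj_cong)
  then have pay_f: "pay (f i) \<longleftrightarrow> p i" for i
    using inner_f by (auto simp: pay_def face_f p_def)
  have across: "p i \<or> pay (rev (f i))" for i
  proof -
    have "p (Suc j) \<or> pay (rev (f (Suc j)))" for j
      using tri_or_pay_across[OF fD[of j]] inner_f by (simp add: fnext_f p_def)
    \<comment> \<open>Adding a period before subtracting 1 reaches the side with index 0 as
      well.\<close>
    from this[of "i + s - 1"] show ?thesis
      using per[of i] card_face_ge_3[OF d] by (simp add: p_def s_def)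
  qed
  have pat_f: "\<not> pat (f i)" for i using none[OF fF] by (auto simp: pat_def)
  have ch: "3/2 - of_bool (p i) + of_bool (r i) / 2 \<le> charge (f i)" for i
    using across[of i] none[OF fF] pay_f[of i] pat_f[of i]
    by (auto simp: charge_def r_def)
  have conf: "r i \<or> r (Suc (Suc i))" if "p (Suc i)" "p (Suc (Suc i))" for i
    using conflict[OF fD[of i]] inner_f that by (simp add: p_def r_def fnext_f)
  have pper: "p (i + s) = p i" "r (i + s) = r i" for i using per by (auto simp: p_def r_def)
  have sum: "(\<Sum>i<s. 3/2 - of_bool (p i) + of_bool (r i) / 2) \<le> sum charge (face d)"
    unfolding face_sum[OF d(1)] s_def[symmetric] f_def[symmetric] by (intro sum_mono ch)
  have s3: "3 \<le> s" using card_face_ge_3[OF d(1)] by (simp add: s_def)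
  \<comment> \<open>Real-valued indicators turn the cyclic conditions into linear
    inequalities.\<close>
  define P R :: "nat \<Rightarrow> real" where "P i = of_bool (p i)" and "R i = of_bool (r i)" for i
  note sum = sum[folded P_def R_def]
  have P: "0 \<le> P i" "P i \<le> 1" and R: "0 \<le> R i" "R i \<le> 1" for i
    by (auto simp: P_def R_def)
  have PR: "P (Suc i) + P (Suc (Suc i)) \<le> 1 + R i + R (Suc (Suc i))" for i
    using conf[of i] by (auto simp: P_def R_def)
  have Pper: "P (i + s) = P i" "R (i + s) = R i" for i using pper by (auto simp: P_def R_def)
  consider "s = 3" | "s = 4" | "s = 5" | "s = 6" | "s = 7" | "8 \<le> s" using s3 by linarith
  then show ?thesis
  proof cases
    case 1
    have "\<not> p i" for i
      using not_tri_rev_of_triangle[OF inner_f[of i]] per[of i] 1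
      by (simp add: p_def fnext_f eval_nat_numeral)
    then have "P i = 0" for i by (simp add: P_def)
    then show ?thesis using sum R(1)[of 0] R(1)[of 1] R(1)[of 2] unfolding 1
      by (simp add: eval_nat_numeral)
  next
    case 2
    have "\<not> (p (Suc i) \<and> p (Suc (Suc (Suc i))))" for i
      using not_tri_opposite[OF inner_f[of i]] inner_f per[of i] 2
      by (simp add: p_def fnext_f eval_nat_numeral)
    from this[of 0] this[of 1] have "P 1 + P 3 \<le> 1" "P 2 + P 4 \<le> 1"
      by (auto simp: P_def eval_nat_numeral)
    moreover have "P 4 = P 0" using Pper(1)[of 0] 2 by simp
    moreover have "(\<Sum>i<4. 3/2 - P i + R i / 2) \<ge> 6 - (P 0 + P 1 + P 2 + P 3)"
      using R(1)[of 0] R(1)[of 1] R(1)[of 2] R(1)[of 3] by (simp add: eval_nat_numeral)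
    ultimately show ?thesis using sum unfolding 2 by linarith
  next
    case 3
    have *: "P 5 = P 0" "P 6 = P 1" "R 5 = R 0" "R 6 = R 1"
      using Pper[of 0] Pper[of 1] 3 by simp_all
    have c: "P 1 + P 2 \<le> 1 + R 0 + R 2" "P 2 + P 3 \<le> 1 + R 1 + R 3"
      "P 3 + P 4 \<le> 1 + R 2 + R 4" "P 4 + P 0 \<le> 1 + R 3 + R 0" "P 0 + P 1 \<le> 1 + R 4 + R 1"
      using PR[of 0] PR[of 1] PR[of 2] PR[of 3] PR[of 4] * by (simp_all add: eval_nat_numeral)
    have e: "(\<Sum>i<5. 3/2 - P i + R i / 2) =
        15/2 - (P 0 + P 1 + P 2 + P 3 + P 4) + (R 0 + R 1 + R 2 + R 3 + R 4) / 2"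
      by (simp add: eval_nat_numeral)
    have "4 \<le> (\<Sum>i<5. 3/2 - P i + R i / 2)"
    proof (cases "P 0 + P 1 + P 2 + P 3 + P 4 \<le> 4")
      case True
      have "2 * (P 0 + P 1 + P 2 + P 3 + P 4) \<le> 5 + 2 * (R 0 + R 1 + R 2 + R 3 + R 4)"
        using add_mono[OF c(1) add_mono[OF c(2) add_mono[OF c(3) add_mono[OF c(4,5)]]]] by simp
      then show ?thesis unfolding e using True by argo
    next
      case False
      have "P i = 0 \<or> P i = 1" for i by (simp add: P_def)
      then have 1: "P 0 = 1" "P 1 = 1" "P 2 = 1" "P 3 = 1" "P 4 = 1"
        using False P(2)[of 0] P(2)[of 1] P(2)[of 2] P(2)[of 3] P(2)[of 4] by smt+
      have r01: "R i = 0 \<or> R i = 1" for i by (simp add: R_def)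
      \<comment> \<open>If all five sides pay, every two corners at cyclic distance two include a
        recipient. These pairs form a 5-cycle, and a vertex cover of a 5-cycle has at least three
        elements; then 15/2 - 5 + 3/2 = 4.\<close>
      have "3 \<le> R 0 + R 1 + R 2 + R 3 + R 4"
        using c r01[of 0] r01[of 1] r01[of 2] r01[of 3] r01[of 4] unfolding 1 by auto
      then show ?thesis unfolding e 1 by argo
    qed
    then show ?thesis using sum unfolding 3 by linarith
  next
    case 4
    have *: "P 6 = P 0" "P 7 = P 1" "R 6 = R 0" "R 7 = R 1"
      using Pper[of 0] Pper[of 1] 4 by simp_all
    have c: "P 1 + P 2 \<le> 1 + R 0 + R 2" "P 2 + P 3 \<le> 1 + R 1 + R 3"
      "P 3 + P 4 \<le> 1 + R 2 + R 4" "P 4 + P 5 \<le> 1 + R 3 + R 5" "P 5 + P 0 \<le> 1 + R 4 + R 0"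
      "P 0 + P 1 \<le> 1 + R 5 + R 1"
      using PR[of 0] PR[of 1] PR[of 2] PR[of 3] PR[of 4] PR[of 5] * by (simp_all add: eval_nat_numeral)
    have "(\<Sum>i<6. 3/2 - P i + R i / 2) =
        9 - (P 0 + P 1 + P 2 + P 3 + P 4 + P 5) + (R 0 + R 1 + R 2 + R 3 + R 4 + R 5) / 2"
      by (simp add: eval_nat_numeral)
    moreover have "2 * (P 0 + P 1 + P 2 + P 3 + P 4 + P 5) \<le> 6 + 2 * (R 0 + R 1 + R 2 + R 3 + R 4 + R 5)"
      using add_mono[OF c(1) add_mono[OF c(2) add_mono[OF c(3) add_mono[OF c(4) add_mono[OF c(5,6)]]]]]
      by simp
    moreover have "P 0 + P 1 + P 2 + P 3 + P 4 + P 5 \<le> 6"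
      using P(2)[of 0] P(2)[of 1] P(2)[of 2] P(2)[of 3] P(2)[of 4] P(2)[of 5] by simp
    ultimately show ?thesis using sum unfolding 4 by argo
  next
    case 5
    have c: "P 1 + P 2 \<le> 1 + R 0 + R 2" using PR[of 0] by (simp add: eval_nat_numeral)
    have "(\<Sum>i<7. 3/2 - P i + R i / 2) =
        21/2 - (P 0 + P 1 + P 2 + P 3 + P 4 + P 5 + P 6) + (R 0 + R 1 + R 2 + R 3 + R 4 + R 5 + R 6) / 2"
      by (simp add: eval_nat_numeral)
    moreover have "P 0 + P 3 + P 4 + P 5 + P 6 \<le> 5" "P 1 + P 2 \<le> 2"
      using P(2)[of 0] P(2)[of 1] P(2)[of 2] P(2)[of 3] P(2)[of 4] P(2)[of 5] P(2)[of 6] by simp_all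
    moreover have "R 0 + R 2 \<le> R 0 + R 1 + R 2 + R 3 + R 4 + R 5 + R 6"
      using R(1)[of 1] R(1)[of 3] R(1)[of 4] R(1)[of 5] R(1)[of 6] by simp
    ultimately show ?thesis using sum c unfolding 5 by argo
  next
    case 6
    have "1/2 \<le> 3/2 - P i + R i / 2" for i using P(2)[of i] R(1)[of i] by simp
    then have "real s * (1/2) \<le> (\<Sum>i<s. 3/2 - P i + R i / 2)"
      using sum_mono[of "{..<s}" "\<lambda>i. 1/2" "\<lambda>i. 3/2 - P i + R i / 2"] by simp
    then show ?thesis using sum 6 by linarith
  qed
qed

lemma charge_face:
  assumes "d \<in> D"
  shows "4 \<le> sum charge (face d)"
proof (cases "\<exists>e\<in>face d. fst e \<in> V")
  case True
  then obtain e where e: "e \<in> face d" "fst e \<in> V" by blast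
  then have "e \<in> D" "face e = face d"
    using subsetD[OF face_subset[OF assms] e(1)] face_eq[OF e(1)] by auto
  then show ?thesis using charge_one[of e] charge_big[of e] e by metis
qed (use charge_none assms in blast)

text \<open>A labelling that is constant along face walks has at most as many values as there are
  orbits. The orbits partition \<open>D\<close>, and each carries charge at least 4.\<close>

theorem faces_le:
  assumes l: "\<And>u w. (u, w) \<in> D \<Longrightarrow> l (w, nx w u) = l (u, w)"
  shows "4 * real (card (l ` D)) \<le> card D + card {d \<in> D. fst d \<in> V} / 2"
proof -
  have "l (fnext d) = l d" for d using l by (cases d) (auto simp: fnext_def)
  then have iter: "l ((fnext ^^ i) d) = l d" for i d by (induction i) auto
  have lf: "l e = l d" if "d \<in> D" "e \<in> face d" for d e
  proof -
    have "e \<in> (\<lambda>i. (fnext ^^ i) d) ` {..<card (face d)}"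
      using face_enum(1)[OF that(1)] that(2) by simp
    then obtain i where "e = (fnext ^^ i) d" by blast
    then show ?thesis by (simp add: iter)
  qed
  define pick where "pick F = l (SOME d. d \<in> F)" for F
  have "l d = pick (face d)" if "d \<in> D" for d
    unfolding pick_def using lf[OF that someI[of "\<lambda>e. e \<in> face d", OF self_in_face]] by simp
  then have "l ` D = pick ` face ` D" by (auto simp: image_iff)
  then have "card (l ` D) \<le> card (face ` D)" using finite_D by (simp add: card_image_le)
  then have "4 * real (card (l ` D)) \<le> (\<Sum>F\<in>face ` D. 4)" by simp
  also have "\<dots> \<le> (\<Sum>F\<in>face ` D. sum charge F)"
    by (rule sum_mono) (use charge_face in auto)
  also have "\<dots> = sum charge (\<Union> (face ` D))"
  proof (rule sum.Union_disjoint[unfolded comp_def, symmetric])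
    show "\<forall>A\<in>face ` D. finite A" using finite_face by auto
    show "\<forall>A\<in>face ` D. \<forall>B\<in>face ` D. A \<noteq> B \<longrightarrow> A \<inter> B = {}"
      using face_eq by (metis (no_types, opaque_lifting) disjoint_iff imageE)
  qed
  also have "\<Union> (face ` D) = D" using face_subset self_in_face by blast
  finally show ?thesis by (simp add: sum_charge_D)
qed

end

section \<open>Planarisation of a unit distance drawing\<close>


lemma param_in_open_segment:
  fixes a d :: "'a :: euclidean_space"
  assumes "d \<noteq> 0" "u < w" "w < v"
  shows "a + w *\<^sub>R d \<in> open_segment (a + u *\<^sub>R d) (a + v *\<^sub>R d)"
proof -
  define \<theta> where "\<theta> = (w - u) / (v - u)"
  have \<theta>: "0 < \<theta>" "\<theta> < 1" "\<theta> * (v - u) = w - u" using assms by (auto simp: \<theta>_def)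
  have "w *\<^sub>R d = ((1 - \<theta>) * u + \<theta> * v) *\<^sub>R d"
    using \<theta>(3) by (simp add: algebra_simps)
  then have "a + w *\<^sub>R d = (1 - \<theta>) *\<^sub>R (a + u *\<^sub>R d) + \<theta> *\<^sub>R (a + v *\<^sub>R d)"
    by (simp add: algebra_simps)
  moreover have "a + u *\<^sub>R d \<noteq> a + v *\<^sub>R d" using assms by simp
  ultimately show ?thesis using \<theta> unfolding in_segment by blast
qed

lemma closed_segment_paramE:
  fixes a b :: "'a :: euclidean_space"
  assumes "x \<in> closed_segment a b"
  obtains u where "0 \<le> u" "u \<le> 1" "x = a + u *\<^sub>R (b - a)"
  using assms by (auto simp: in_segment algebra_simps)

lemma closed_segment_same_ray:
  fixes p a :: "'a :: euclidean_space"
  assumes "x \<in> closed_segment p a" "y \<in> closed_segment p a" "x \<noteq> p" "y \<noteq> p" "x \<noteq> y"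
  shows "x \<in> open_segment p y \<or> y \<in> open_segment p x"
proof -
  obtain u where u: "0 \<le> u" "x = p + u *\<^sub>R (a - p)" using closed_segment_paramE[OF assms(1)] by metis
  obtain v where v: "0 \<le> v" "y = p + v *\<^sub>R (a - p)" using closed_segment_paramE[OF assms(2)] by metis
  have ne: "a - p \<noteq> 0" "0 < u" "0 < v" "u \<noteq> v" using u v assms by (auto simp: less_le)
  show ?thesis
  proof (cases "u < v")
    case True
    then show ?thesis using param_in_open_segment[OF ne(1), of 0 u v p] ne u v by simp
  next
    case False
    then show ?thesis using param_in_open_segment[OF ne(1), of 0 v u p] ne u v by simp
  qed
qed

lemma closed_segment_split:
  fixes a b :: "'a :: euclidean_space"
  assumes "x \<in> closed_segment a b" "y \<in> closed_segment a b"
  shows "y \<in> closed_segment x a \<or> y \<in> closed_segment x b"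
proof (cases "a = b \<or> y = x \<or> y = a \<or> y = b")
  case True
  then show ?thesis using assms by auto
next
  case False
  obtain u where u: "0 \<le> u" "u \<le> 1" "x = a + u *\<^sub>R (b - a)" using closed_segment_paramE[OF assms(1)] by metis
  obtain v where v: "0 \<le> v" "v \<le> 1" "y = a + v *\<^sub>R (b - a)" using closed_segment_paramE[OF assms(2)] by metis
  have ne: "b - a \<noteq> 0" "u \<noteq> v" "v \<noteq> 0" "v \<noteq> 1" using False u v by auto
  show ?thesis
  proof (cases "u < v")
    case True
    then have "y \<in> open_segment x b"
      using param_in_open_segment[OF ne(1), of u v 1 a] ne v u by simp
    then show ?thesis by (simp add: open_closed_segment)
  next
    case False
    then have "y \<in> open_segment a x"
      using param_in_open_segment[OF ne(1), of 0 v u a] ne v u by simp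
    then show ?thesis by (simp add: open_closed_segment open_segment_commute)
  qed
qed

lemma open_segment_opposite:
  fixes a b :: "'a :: euclidean_space"
  assumes "x \<in> open_segment a b" "u \<in> closed_segment x a" "v \<in> closed_segment x b" "u \<noteq> x" "v \<noteq> x"
  shows "x \<in> open_segment u v"
proof -
  obtain c where c: "0 < c" "c < 1" "x = a + c *\<^sub>R (b - a)" and ab: "a \<noteq> b"
    using assms(1) by (auto simp: in_segment algebra_simps)
  obtain s where s: "0 \<le> s" "s \<le> 1" "u = x + s *\<^sub>R (a - x)" using closed_segment_paramE[OF assms(2)] by metis
  obtain t where t: "0 \<le> t" "t \<le> 1" "v = x + t *\<^sub>R (b - x)" using closed_segment_paramE[OF assms(3)] by metis
  have st: "0 < s" "0 < t" using s t assms by (auto simp: less_le)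
  have u: "u = x + (- s * c) *\<^sub>R (b - a)" unfolding s c(3) by (simp add: algebra_simps)
  have v: "v = x + (t * (1 - c)) *\<^sub>R (b - a)" unfolding t c(3) by (simp add: algebra_simps)
  have "x + 0 *\<^sub>R (b - a) \<in> open_segment u v"
    unfolding u v by (rule param_in_open_segment) (use ab st c in auto)
  then show ?thesis by simp
qed

text \<open>A linear function is strictly monotone along a segment on which it is not constant, so
  it detects betweenness. It is applied to the sheared abscissa to compare pieces of the same
  edge.\<close>

lemma between_by_coordinate:
  fixes f :: "'a :: euclidean_space \<Rightarrow> real"
  assumes f: "linear f"
    and seg: "p \<in> closed_segment a b" "q \<in> closed_segment a b" "r \<in> closed_segment a b"
    and lt: "f p < f r" "f r < f q"
  shows "r \<in> open_segment p q"
proof -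
  obtain u where u: "p = a + u *\<^sub>R (b - a)" using closed_segment_paramE[OF seg(1)] by metis
  obtain v where v: "q = a + v *\<^sub>R (b - a)" using closed_segment_paramE[OF seg(2)] by metis
  obtain w where w: "r = a + w *\<^sub>R (b - a)" using closed_segment_paramE[OF seg(3)] by metis
  define c where "c = f (b - a)"
  have "f (a + s *\<^sub>R (b - a)) = f a + s * c" for s
    using f by (simp add: linear_add linear_scale c_def)
  then have *: "u * c < w * c" "w * c < v * c" using lt u v w by auto
  then have d: "b - a \<noteq> 0" using f by (auto simp: c_def linear_0)
  consider "u < w" "w < v" | "v < w" "w < u" using * by (auto simp: mult_less_cancel_right)
  then show ?thesis
  proof cases
    case 1
    then show ?thesis unfolding u v w by (intro param_in_open_segment d)
  next
    case 2
    then have "r \<in> open_segment q p" unfolding u v w by (intro param_in_open_segment d)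
    then show ?thesis by (simp add: open_segment_commute)
  qed
qed

text \<open>Rewrites the far end as a multiple of \<open>z - a\<close> added to \<open>z\<close>, so
  that far ends on the same ray can be compared.\<close>

lemma end_beyond:
  fixes a c z :: "'a :: real_vector"
  assumes "z = a + u *\<^sub>R (c - a)" "u \<noteq> 0"
  shows "c = z + (1/u - 1) *\<^sub>R (z - a)"
proof -
  have "(1/u) *\<^sub>R (z - a) = c - a" using assms by simp
  then show ?thesis by (simp add: scaleR_left_diff_distrib)
qed

lemma closed_segment_mono:
  "x \<in> closed_segment p q \<Longrightarrow> p \<in> closed_segment a b \<Longrightarrow> q \<in> closed_segment a b \<Longrightarrow> x \<in> closed_segment a b"
  by (meson subset_closed_segment subsetD)

text \<open>Two unit segments crossing at \<open>z\<close>: if equality held in the triangle inequality, they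
  would overlap beyond \<open>z\<close>.\<close>

lemma crossing_dist_less:
  fixes z :: "'a :: euclidean_space"
  assumes z: "z \<in> open_segment a b" "z \<in> open_segment c d"
    and len: "dist a b = 1" "dist c d = 1"
    and single: "\<And>y. y \<in> closed_segment a b \<Longrightarrow> y \<in> closed_segment c d \<Longrightarrow> y = z"
  shows "dist a c + dist b d < 2"
proof -
  have s: "dist a z + dist z b = 1" "dist c z + dist z d = 1"
    using z len open_closed_segment between between_mem_segment by metis+
  have t: "dist a c \<le> dist a z + dist z c" "dist b d \<le> dist b z + dist z d"
    by (simp_all add: dist_triangle)
  have ne: "a \<noteq> z" "b \<noteq> z" "c \<noteq> z" "d \<noteq> z" using z by (auto simp: open_segment_def)
  have "dist a c \<noteq> dist a z + dist z c"
  proof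
    assume "dist a c = dist a z + dist z c"
    then have "z \<in> closed_segment a c" using between between_mem_segment by metis
    then obtain u where u: "0 \<le> u" "u \<le> 1" "z = a + u *\<^sub>R (c - a)" using closed_segment_paramE by metis
    obtain v where v: "0 < v" "v < 1" "z = a + v *\<^sub>R (b - a)"
      using z(1) by (auto simp: in_segment algebra_simps)
    have u': "0 < u" "u < 1" using u ne by (auto simp: less_le)
    define e where "e = z - a"
    have "e \<noteq> 0" using ne by (simp add: e_def)
    have c: "c = z + (1/u - 1) *\<^sub>R e" and b: "b = z + (1/v - 1) *\<^sub>R e"
      unfolding e_def using u'(1) v(1) by (intro end_beyond[OF u(3)] end_beyond[OF v(3)]; linarith)+
    have pos: "0 < 1/u - 1" "0 < 1/v - 1" using u' v(1,2) by simp_all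
    show False
    proof (cases "1/u - 1 < 1/v - 1")
      case True
      then have "c \<in> open_segment z b"
        unfolding b c using param_in_open_segment[OF \<open>e \<noteq> 0\<close> pos(1) True, of z] by simp
      then have "c \<in> closed_segment a b"
        using z(1) closed_segment_mono[of c z b a b] by (simp add: open_closed_segment)
      then show False using single[of c] ne by simp
    next
      case False
      then have "b \<in> closed_segment z c"
      proof (cases "1/u - 1 = 1/v - 1")
        case F: False
        then have "1/v - 1 < 1/u - 1" using False by (metis linorder_neqE_linordered_idom)
        then show ?thesis
          unfolding b c using param_in_open_segment[OF \<open>e \<noteq> 0\<close> pos(2), of _ z] open_closed_segment
          by fastforce
      qed (use b c in auto)
      then have "b \<in> closed_segment c d"
        using z(2) closed_segment_mono[of b z c c d] by (simp add: open_closed_segment)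
      then show False using single[of b] ne by simp
    qed
  qed
  then show ?thesis using s t by (simp add: dist_commute)
qed

section \<open>The planarised graph of a drawing\<close>

lemma edge_interior_id [simp]: "edge_interior (\<lambda>x. x) {a, b} = open_segment a b"
  unfolding edge_interior_def by (auto simp: doubleton_eq_iff open_segment_commute)

text \<open>The vertices are the points of the drawing themselves, so the drawing map is the
  identity.\<close>

locale unit_drawing =
  fixes V :: "(real ^ 2) set" and E :: "(real ^ 2) set set"
  assumes finite_V: "finite V"
    and edgeE': "e \<in> E \<Longrightarrow> \<exists>a b. e = {a, b} \<and> a \<in> V \<and> b \<in> V \<and> dist a b = 1"
    and avoid: "\<lbrakk>{a, b} \<in> E; v \<in> V\<rbrakk> \<Longrightarrow> v \<notin> open_segment a b"
    and crossings_le: "e \<in> E \<Longrightarrow> finite (crossings E (\<lambda>x. x) e) \<and> card (crossings E (\<lambda>x. x) e) \<le> 2"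
begin

lemma edgeE:
  assumes "e \<in> E"
  obtains a b where "e = {a, b}" "a \<in> V" "b \<in> V" "dist a b = 1"
  using edgeE'[OF assms] by blast

lemma edge_props:
  assumes "{a, b} \<in> E"
  shows "a \<in> V" "b \<in> V" "dist a b = 1" "a \<noteq> b"
proof -
  obtain c d where "{a, b} = {c, d}" "c \<in> V" "d \<in> V" "dist c d = 1" using edgeE[OF assms] by metis
  then show "a \<in> V" "b \<in> V" "dist a b = 1" "a \<noteq> b"
    by (auto simp: doubleton_eq_iff dist_commute)
qed

lemma finite_E: "finite E"
proof (rule finite_subset)
  show "E \<subseteq> Pow V" using edgeE by blast
qed (simp add: finite_V)

text \<open>Two common points would give a whole common segment and hence infinitely many
  crossings.\<close>

lemma edges_meet_once:
  assumes "{a, b} \<in> E" "{c, d} \<in> E" "{a, b} \<noteq> {c, d}"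
    "p \<in> closed_segment a b" "p \<in> closed_segment c d" "q \<in> closed_segment a b" "q \<in> closed_segment c d"
  shows "p = q"
proof (rule ccontr)
  assume "p \<noteq> q"
  have "open_segment p q \<subseteq> open_segment a b" "open_segment p q \<subseteq> open_segment c d"
    using assms by (auto simp: subset_open_segment)
  then have "(\<lambda>r. ({c, d}, r)) ` open_segment p q \<subseteq> crossings E (\<lambda>x. x) {a, b}"
    using assms by (auto simp: crossings_def)
  then have "finite ((\<lambda>r. ({c, d}, r)) ` open_segment p q)"
    using crossings_le[OF assms(1)] finite_subset by blast
  then have "finite (open_segment p q)" by (rule finite_imageD) (simp add: inj_on_def)
  then show False using \<open>p \<noteq> q\<close> by simp
qed

definition crosspoints :: "(real ^ 2) set" where
  "crosspoints = (\<Union>e\<in>E. snd ` crossings E (\<lambda>x. x) e)"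

definition W :: "(real ^ 2) set" where
  "W = V \<union> crosspoints"

lemma finite_crosspoints: "finite crosspoints"
  unfolding crosspoints_def using finite_E crossings_le by blast

lemma finite_W: "finite W"
  using finite_V finite_crosspoints by (simp add: W_def)

lemma crosspointI:
  assumes "{a, b} \<in> E" "{c, d} \<in> E" "{a, b} \<noteq> {c, d}" "x \<in> open_segment a b" "x \<in> open_segment c d"
  shows "x \<in> crosspoints"
proof -
  have "({c, d}, x) \<in> crossings E (\<lambda>x. x) {a, b}" using assms by (simp add: crossings_def)
  then show ?thesis unfolding crosspoints_def using assms(1) by force
qed

lemma crosspointE:
  assumes "x \<in> crosspoints"
  obtains a b c d where "{a, b} \<in> E" "{c, d} \<in> E" "{a, b} \<noteq> {c, d}"
    "x \<in> open_segment a b" "x \<in> open_segment c d"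
proof -
  obtain e f where "e \<in> E" "(f, x) \<in> crossings E (\<lambda>x. x) e"
    using assms unfolding crosspoints_def by force
  then have ef: "e \<in> E" "f \<in> E" "f \<noteq> e" "x \<in> edge_interior (\<lambda>x. x) e" "x \<in> edge_interior (\<lambda>x. x) f"
    unfolding crossings_def by blast+
  obtain a b where ab: "e = {a, b}" using edgeE[OF ef(1)] by metis
  obtain c d where cd: "f = {c, d}" using edgeE[OF ef(2)] by metis
  show ?thesis by (rule that[of a b c d]) (use ef ab cd in simp_all)
qed

lemma crosspoint_notin_V: "x \<in> crosspoints \<Longrightarrow> x \<notin> V"
  using crosspointE avoid by metis

lemma crosspoint_interior:
  assumes "x \<in> crosspoints" "{a, b} \<in> E" "x \<in> closed_segment a b"
  shows "x \<in> open_segment a b"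
proof -
  have "x \<notin> V" by (rule crosspoint_notin_V[OF assms(1)])
  then show ?thesis using assms(3) edge_props[OF assms(2)] by (auto simp: open_segment_def)
qed

lemma interior_in_W_crosspoint:
  assumes "x \<in> W" "x \<in> open_segment a b" "{a, b} \<in> E"
  shows "x \<in> crosspoints"
  using assms avoid by (auto simp: W_def)

definition D :: "((real ^ 2) \<times> (real ^ 2)) set" where
  "D = {(p, q). p \<in> W \<and> q \<in> W \<and> p \<noteq> q \<and> open_segment p q \<inter> W = {} \<and>
      (\<exists>a b. {a, b} \<in> E \<and> p \<in> closed_segment a b \<and> q \<in> closed_segment a b)}"

lemma DE:
  assumes "(p, q) \<in> D"
  obtains a b where "{a, b} \<in> E" "p \<in> closed_segment a b" "q \<in> closed_segment a b"
  using assms by (auto simp: D_def)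

lemma D_sym: "(p, q) \<in> D \<Longrightarrow> (q, p) \<in> D"
  by (auto simp: D_def open_segment_commute)

lemma finite_D: "finite D"
proof (rule finite_subset)
  show "D \<subseteq> W \<times> W" by (auto simp: D_def)
qed (simp add: finite_W)

lemma nearest_unique:
  assumes "(p, x) \<in> D" "(p, y) \<in> D" "x \<in> closed_segment p a" "y \<in> closed_segment p a"
  shows "x = y"
  using closed_segment_same_ray[OF assms(3,4)] assms(1,2) by (auto simp: D_def)

lemma ex_neighbour:
  assumes "{a, b} \<in> E" "p \<in> closed_segment a b" "p \<in> W" "p \<noteq> b"
  obtains q where "(p, q) \<in> D" "q \<in> closed_segment p b" "q \<noteq> p"
proof -
  define A where "A = {q \<in> W. q \<in> closed_segment p b \<and> q \<noteq> p}"
  have "b \<in> A" using edge_props[OF assms(1)] assms(4) by (auto simp: A_def W_def)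
  then have A: "finite A" "A \<noteq> {}" using finite_W by (auto simp: A_def)
  define q where "q = arg_min_on (dist p) A"
  have q: "q \<in> A" "\<And>r. r \<in> A \<Longrightarrow> dist p q \<le> dist p r"
    using arg_min_if_finite[OF A, of "dist p"] by (auto simp: q_def not_less)
  have sub: "closed_segment p b \<subseteq> closed_segment a b"
    using assms(2) by (simp add: subset_closed_segment)
  have "open_segment p q \<inter> W = {}"
  proof (rule ccontr)
    assume "open_segment p q \<inter> W \<noteq> {}"
    then obtain r where r: "r \<in> open_segment p q" "r \<in> W" by blast
    have "r \<in> closed_segment p b"
      using r(1) q(1) closed_segment_mono[of r p q p b] by (simp add: A_def open_closed_segment)
    moreover have "r \<noteq> p" using r by (auto simp: open_segment_def)
    ultimately have "dist p q \<le> dist p r" using q(2) r by (simp add: A_def)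
    then show False using dist_in_open_segment[OF r(1)] by (simp add: dist_commute)
  qed
  then have "(p, q) \<in> D" using q(1) assms sub by (auto simp: D_def A_def)
  then show ?thesis using that q(1) by (simp add: A_def)
qed

definition nbrs :: "real ^ 2 \<Rightarrow> (real ^ 2) set" where
  "nbrs p = {q. (p, q) \<in> D}"

lemma finite_nbrs: "finite (nbrs p)"
proof (rule finite_subset)
  show "nbrs p \<subseteq> W" by (auto simp: nbrs_def D_def)
qed (rule finite_W)

text \<open>Take the nearest point of \<open>W\<close> in each of the four directions. Neighbours on
  different edges are distinct because the edges share only \<open>x\<close>.\<close>

lemma crossing_neighbours:
  assumes e: "{a, b} \<in> E" "{c, d} \<in> E" "{a, b} \<noteq> {c, d}"
    and x: "x \<in> open_segment a b" "x \<in> open_segment c d"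
  obtains u1 u2 u3 u4 where "{u1, u2, u3, u4} \<subseteq> nbrs x" "card {u1, u2, u3, u4} = 4"
    "x \<in> open_segment u1 u2" "x \<in> open_segment u3 u4"
    "u1 \<in> closed_segment x a" "u2 \<in> closed_segment x b"
    "u3 \<in> closed_segment x c" "u4 \<in> closed_segment x d"
proof -
  have X: "x \<in> W" using crosspointI[OF e x] by (simp add: W_def)
  have xc: "x \<in> closed_segment a b" "x \<in> closed_segment c d" "x \<noteq> a" "x \<noteq> b" "x \<noteq> c" "x \<noteq> d"
    using x by (auto simp: open_segment_def)
  obtain u2 where u2: "(x, u2) \<in> D" "u2 \<in> closed_segment x b" "u2 \<noteq> x"
    using ex_neighbour[OF e(1) xc(1) X xc(4)] by blast
  obtain u1 where u1: "(x, u1) \<in> D" "u1 \<in> closed_segment x a" "u1 \<noteq> x"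
    using ex_neighbour[of b a x] e(1) xc X by (metis closed_segment_commute insert_commute)
  obtain u4 where u4: "(x, u4) \<in> D" "u4 \<in> closed_segment x d" "u4 \<noteq> x"
    using ex_neighbour[OF e(2) xc(2) X xc(6)] by blast
  obtain u3 where u3: "(x, u3) \<in> D" "u3 \<in> closed_segment x c" "u3 \<noteq> x"
    using ex_neighbour[of d c x] e(2) xc X by (metis closed_segment_commute insert_commute)
  have o: "x \<in> open_segment u1 u2" "x \<in> open_segment u3 u4"
    using open_segment_opposite x u1 u2 u3 u4 by blast+
  have in_ab: "u1 \<in> closed_segment a b" "u2 \<in> closed_segment a b"
    and in_cd: "u3 \<in> closed_segment c d" "u4 \<in> closed_segment c d"
    using closed_segment_mono[OF u1(2) xc(1) ends_in_segment(1)]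
      closed_segment_mono[OF u2(2) xc(1) ends_in_segment(2)]
      closed_segment_mono[OF u3(2) xc(2) ends_in_segment(1)]
      closed_segment_mono[OF u4(2) xc(2) ends_in_segment(2)] by simp_all
  have "u1 \<noteq> u2" "u3 \<noteq> u4" using o by (auto simp: open_segment_def)
  moreover have "u \<noteq> v" if "u \<in> {u1, u2}" "v \<in> {u3, u4}" for u v
    using edges_meet_once[OF e xc(1,2), of u] that in_ab in_cd u1 u2 by auto
  then have "u1 \<noteq> u3" "u1 \<noteq> u4" "u2 \<noteq> u3" "u2 \<noteq> u4" by blast+
  ultimately have "card {u1, u2, u3, u4} = 4" by (simp add: card_insert_if)
  moreover have "{u1, u2, u3, u4} \<subseteq> nbrs x" using u1 u2 u3 u4 by (simp add: nbrs_def)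
  ultimately show ?thesis using that o u1 u2 u3 u4 by blast
qed

text \<open>Only an inequality, since three edges through \<open>x\<close> yield six
  neighbours.\<close>

lemma card_nbrs_crosspoint:
  assumes "x \<in> crosspoints"
  shows "4 \<le> card (nbrs x)"
proof -
  obtain a b c d where "{a, b} \<in> E" "{c, d} \<in> E" "{a, b} \<noteq> {c, d}"
    "x \<in> open_segment a b" "x \<in> open_segment c d" using crosspointE[OF assms] by metis
  then obtain u1 u2 u3 u4 where "{u1, u2, u3, u4} \<subseteq> nbrs x" "card {u1, u2, u3, u4} = 4"
    using crossing_neighbours by metis
  then show ?thesis using card_mono[OF finite_nbrs] by metis
qed

lemma card_darts_at_crosspoints: "4 * card crosspoints \<le> card {d \<in> D. fst d \<notin> V}"
proof -
  have "4 * card crosspoints = (\<Sum>x\<in>crosspoints. 4)" by simp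
  also have "\<dots> \<le> (\<Sum>x\<in>crosspoints. card (nbrs x))"
    by (rule sum_mono) (rule card_nbrs_crosspoint)
  also have "\<dots> = card (Sigma crosspoints nbrs)"
    using finite_crosspoints finite_nbrs by simp
  also have "\<dots> \<le> card {d \<in> D. fst d \<notin> V}"
    using finite_D crosspoint_notin_V by (intro card_mono) (auto simp: nbrs_def)
  finally show ?thesis .
qed

definition first_nb :: "real ^ 2 \<Rightarrow> real ^ 2 \<Rightarrow> real ^ 2" where
  "first_nb a b = (SOME q. (a, q) \<in> D \<and> q \<in> closed_segment a b \<and> q \<noteq> a)"

lemma first_nb:
  assumes "{a, b} \<in> E"
  shows "(a, first_nb a b) \<in> D" "first_nb a b \<in> closed_segment a b" "first_nb a b \<noteq> a"
proof -
  have "a \<in> W" using edge_props[OF assms] by (simp add: W_def)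
  then obtain q where "(a, q) \<in> D \<and> q \<in> closed_segment a b \<and> q \<noteq> a"
    using ex_neighbour[OF assms, of a] edge_props[OF assms] by auto
  from someI[of "\<lambda>q. (a, q) \<in> D \<and> q \<in> closed_segment a b \<and> q \<noteq> a", OF this]
  show "(a, first_nb a b) \<in> D" "first_nb a b \<in> closed_segment a b" "first_nb a b \<noteq> a"
    by (simp_all add: first_nb_def)
qed

lemma first_nb_inj:
  assumes "{a, b} \<in> E" "{a, c} \<in> E" "first_nb a b = first_nb a c"
  shows "b = c"
proof (rule ccontr)
  assume "b \<noteq> c"
  then have "{a, b} \<noteq> {a, c}" by (auto simp: doubleton_eq_iff)
  then have "first_nb a b = a"
    using edges_meet_once[OF assms(1,2), of "first_nb a b" a] first_nb[OF assms(1)]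
      first_nb[OF assms(2)] assms(3) by auto
  then show False using first_nb[OF assms(1)] by simp
qed

text \<open>Each edge has a first dart from either end, and first darts of different edges from a
  common vertex differ because these edges meet only there.\<close>

lemma card_darts_at_vertices: "2 * card E \<le> card {d \<in> D. fst d \<in> V}"
proof -
  define A where "A = {(a, b). {a, b} \<in> E}"
  define B where "B e = {(a, b). e = {a, b}}" for e :: "(real ^ 2) set"
  have B: "card (B e) = 2 \<and> finite (B e)" if e: "e \<in> E" for e
  proof -
    obtain a b where "e = {a, b}" "dist a b = 1" using edgeE[OF e] by metis
    then have "B e = {(a, b), (b, a)}" "a \<noteq> b" by (auto simp: B_def doubleton_eq_iff)
    then show ?thesis by simp
  qed
  have "A = (\<Union>e\<in>E. B e)" by (auto simp: A_def B_def)
  moreover have "card (\<Union>e\<in>E. B e) = (\<Sum>e\<in>E. card (B e))"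
    using finite_E B by (intro card_UN_disjoint) (auto simp: B_def)
  moreover have "(\<Sum>e\<in>E. card (B e)) = 2 * card E" using B by simp
  ultimately have "2 * card E = card A" by simp
  also have "\<dots> = card ((\<lambda>(a, b). (a, first_nb a b)) ` A)"
    by (intro card_image[symmetric] inj_onI) (auto simp: A_def dest: first_nb_inj)
  also have "\<dots> \<le> card {d \<in> D. fst d \<in> V}"
    using finite_D first_nb edge_props by (intro card_mono) (auto simp: A_def)
  finally show ?thesis .
qed

end


section \<open>The sheared drawing as a plane line graph\<close>

lemma closed_segment_doubleton:
  "{a, b} = {c, d} \<Longrightarrow> closed_segment a b = closed_segment c d"
  by (auto simp: doubleton_eq_iff closed_segment_commute)

lemma between_dist:
  fixes x :: "'a :: euclidean_space"
  shows "x \<in> closed_segment a b \<Longrightarrow> dist a b = dist a x + dist x b"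
  using between between_mem_segment by metis

text \<open>The shear is linear and thus keeps segments and betweenness; only the sweep uses the
  sheared coordinates, while lengths stay Euclidean. Two edges at every vertex are what
  \<open>nx_neq\<close> rests on.\<close>

locale sheared_unit_drawing = unit_drawing +
  fixes t :: real
  assumes inj_shear: "inj_on (\<lambda>p. p $ 1 + t * p $ 2) W"
    and two_edges: "v \<in> V \<Longrightarrow> \<exists>a b. a \<noteq> b \<and> {v, a} \<in> E \<and> {v, b} \<in> E"
begin

definition xc :: "real ^ 2 \<Rightarrow> real" where "xc p = p $ 1 + t * p $ 2"

definition yc :: "real ^ 2 \<Rightarrow> real" where "yc p = p $ 2"

definition S :: "((real ^ 2) \<times> (real ^ 2)) set" where
  "S = {(p, q) \<in> D. xc p < xc q}"

lemma linear_xc: "linear xc" and linear_yc: "linear yc"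
  by (auto simp: xc_def yc_def algebra_simps intro!: linearI)

lemma xc_yc_eqI: "xc p = xc q \<Longrightarrow> yc p = yc q \<Longrightarrow> p = q"
  by (simp add: xc_def yc_def vec_eq_iff forall_2)

lemma inj_xc: "inj_on xc W"
  using inj_shear by (simp add: xc_def[abs_def])

interpretation lg: line_graph W xc yc S
  by unfold_locales (use finite_W inj_xc in \<open>auto simp: S_def D_def\<close>)

lemma S_iff: "(p, q) \<in> S \<longleftrightarrow> (p, q) \<in> D \<and> xc p < xc q"
  by (simp add: S_def)

lemma act_iff: "(p, q) \<in> lg.act x \<longleftrightarrow> (p, q) \<in> D \<and> xc p < x \<and> x < xc q"
  by (auto simp: lg.act_def S_iff)

lemma act_point:
  assumes "(p, q) \<in> lg.act x"
  obtains r where "r \<in> open_segment p q" "xc r = x" "yc r = lg.ht (p, q) x"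
proof -
  have pq: "xc p < x" "x < xc q" using assms by (auto simp: act_iff)
  define u where "u = (x - xc p) / (xc q - xc p)"
  have u: "0 < u" "u < 1" "u * (xc q - xc p) = x - xc p" using pq by (auto simp: u_def)
  define r where "r = (1 - u) *\<^sub>R p + u *\<^sub>R q"
  have lin: "f r = f p + u * (f q - f p)" if "linear f" for f :: "real ^ 2 \<Rightarrow> real"
  proof -
    have "f r = (1 - u) * f p + u * f q" using that by (simp add: r_def linear_add linear_scale)
    then show ?thesis by (simp add: algebra_simps)
  qed
  have "r \<in> open_segment p q" using u pq by (auto simp: in_segment r_def)
  moreover have "xc r = x" using lin[OF linear_xc] u by simp
  moreover have "yc r = lg.ht (p, q) x"
    unfolding lin[OF linear_yc] by (simp add: lg.ht_def lg.sl_def u_def)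
  ultimately show ?thesis using that by blast
qed

text \<open>A common point of two open pieces is not in \<open>W\<close>, so the pieces belong to
  the same edge. On this edge no endpoint of one piece lies inside the other, so the endpoints
  agree.\<close>

lemma act_unique:
  assumes e: "(p, q) \<in> lg.act x" "(p', q') \<in> lg.act x"
    and eq: "lg.ht (p, q) x = lg.ht (p', q') x"
  shows "(p, q) = (p', q')"
proof -
  obtain r where r: "r \<in> open_segment p q" "xc r = x" "yc r = lg.ht (p, q) x"
    using act_point[OF e(1)] by blast
  obtain r' where r': "r' \<in> open_segment p' q'" "xc r' = x" "yc r' = lg.ht (p', q') x"
    using act_point[OF e(2)] by blast
  have rr: "r' = r" using r r' eq by (intro xc_yc_eqI) auto
  have pq: "(p, q) \<in> D" "(p', q') \<in> D" "xc p < x" "x < xc q" "xc p' < x" "x < xc q'"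
    using e by (auto simp: act_iff)
  obtain a b where ab: "{a, b} \<in> E" "p \<in> closed_segment a b" "q \<in> closed_segment a b"
    using DE[OF pq(1)] by metis
  obtain a' b' where ab': "{a', b'} \<in> E" "p' \<in> closed_segment a' b'" "q' \<in> closed_segment a' b'"
    using DE[OF pq(2)] by metis
  have "open_segment p q \<subseteq> open_segment a b" "open_segment p' q' \<subseteq> open_segment a' b'"
    using ab ab' by (auto simp: subset_open_segment)
  then have "r \<in> open_segment a b" "r \<in> open_segment a' b'" using r r' rr by auto
  moreover have "r \<notin> W" using r(1) pq(1) by (auto simp: D_def)
  ultimately have "{a, b} = {a', b'}" using crosspointI[OF ab(1) ab'(1)] by (auto simp: W_def)
  then have in_ab: "p' \<in> closed_segment a b" "q' \<in> closed_segment a b"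
    using ab' closed_segment_doubleton by blast+
  note betw = between_by_coordinate[OF linear_xc]
  have W: "p \<in> W" "q \<in> W" "p' \<in> W" "q' \<in> W" using pq by (auto simp: D_def)
  have "\<not> xc p < xc p'" using betw[OF ab(2,3) in_ab(1)] pq W by (auto simp: D_def)
  moreover have "\<not> xc p' < xc p" using betw[OF in_ab ab(2)] pq W by (auto simp: D_def)
  moreover have "\<not> xc q < xc q'" using betw[OF in_ab ab(3)] pq W by (auto simp: D_def)
  moreover have "\<not> xc q' < xc q" using betw[OF ab(2,3) in_ab(2)] pq W by (auto simp: D_def)
  ultimately have "xc p = xc p'" "xc q = xc q'" by auto
  then show ?thesis using inj_xc W by (auto dest: inj_onD)
qed

interpretation pl: plane_line_graph W xc yc S
proof unfold_locales
  fix e f x assume "e \<in> lg.act x" "f \<in> lg.act x" "lg.ht e x = lg.ht f x"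
  then show "e = f" using act_unique by (metis surj_pair)
next
  fix v e assume v: "v \<in> W" and e: "e \<in> lg.act (xc v)"
  obtain p q where pq: "e = (p, q)" by (cases e)
  show "lg.ht e (xc v) \<noteq> yc v"
  proof
    assume "lg.ht e (xc v) = yc v"
    moreover obtain r where r: "r \<in> open_segment p q" "xc r = xc v" "yc r = lg.ht (p, q) (xc v)"
      using act_point e pq by blast
    ultimately have "r = v" using pq by (intro xc_yc_eqI) auto
    moreover have "(p, q) \<in> D" using e pq by (auto simp: act_iff)
    ultimately show False using r v by (auto simp: D_def)
  qed
qed

lemma D_xc_neq: "(p, q) \<in> D \<Longrightarrow> xc p \<noteq> xc q"
  using inj_xc by (auto simp: D_def dest: inj_onD)

lemma darts_eq: "pl.darts = D"
proof (rule set_eqI)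
  fix d show "d \<in> pl.darts \<longleftrightarrow> d \<in> D"
  proof (cases d)
    case (Pair p q)
    then show ?thesis using D_xc_neq[of p q] D_sym[of p q] D_sym[of q p]
      by (auto simp: pl.darts_def S_iff)
  qed
qed

lemma nbs_eq: "pl.nbs = nbrs"
  by (auto simp: pl.nbs_def nbrs_def darts_eq fun_eq_iff)

abbreviation nx :: "real ^ 2 \<Rightarrow> real ^ 2 \<Rightarrow> real ^ 2" where
  "nx \<equiv> pl.next_nb"

lemma nx_def': "nx w u = cyc_next (pl.key w) (nbrs w) u"
  by (simp add: pl.next_nb_def nbs_eq)

lemma finite_nbrs': "finite (nbrs w)" and inj_key: "inj_on (pl.key w) (nbrs w)"
  using pl.finite_nbs pl.inj_on_key by (simp_all add: nbs_eq)

lemma two_nbrs: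
  assumes "w \<in> W"
  obtains u u' where "u \<in> nbrs w" "u' \<in> nbrs w" "u \<noteq> u'"
proof (cases "w \<in> V")
  case True
  then obtain a b where ab: "a \<noteq> b" "{w, a} \<in> E" "{w, b} \<in> E" using two_edges by metis
  show ?thesis
  proof (rule that)
    show "first_nb w a \<in> nbrs w" "first_nb w b \<in> nbrs w" using first_nb ab by (auto simp: nbrs_def)
    show "first_nb w a \<noteq> first_nb w b" using first_nb_inj ab by blast
  qed
next
  case False
  then have "4 \<le> card (nbrs w)" using assms card_nbrs_crosspoint by (auto simp: W_def)
  then have "\<not> nbrs w \<subseteq> {u}" for u using card_mono[of "{u}" "nbrs w"] by auto
  then show ?thesis using that by blast
qed

section \<open>Rotation at points where exactly two edges cross\<close>

definition C :: "(real ^ 2) set" where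
  "C = {x \<in> crosspoints. card {e \<in> E. x \<in> edge_interior (\<lambda>x. x) e} = 2}"

text \<open>The full configuration at a simple crossing as one predicate, so that its symmetries can
  be used to bring it into a standard position. The neighbours \<open>u1\<close>, \<open>u2\<close>
  point towards \<open>a\<close>, \<open>b\<close>, and \<open>u3\<close>, \<open>u4\<close> towards
  \<open>c\<close>, \<open>d\<close>.\<close>

definition crosses :: "real ^ 2 \<Rightarrow> real ^ 2 \<Rightarrow> real ^ 2 \<Rightarrow> real ^ 2 \<Rightarrow> real ^ 2 \<Rightarrow>
    real ^ 2 \<Rightarrow> real ^ 2 \<Rightarrow> real ^ 2 \<Rightarrow> real ^ 2 \<Rightarrow> bool" where
  "crosses x a b c d u1 u2 u3 u4 \<longleftrightarrow> {a, b} \<in> E \<and> {c, d} \<in> E \<and> {a, b} \<noteq> {c, d} \<and>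
     x \<in> open_segment a b \<and> x \<in> open_segment c d \<and>
     nbrs x = {u1, u2, u3, u4} \<and> card {u1, u2, u3, u4} = 4 \<and>
     x \<in> open_segment u1 u2 \<and> x \<in> open_segment u3 u4 \<and>
     u1 \<in> closed_segment x a \<and> u2 \<in> closed_segment x b \<and>
     u3 \<in> closed_segment x c \<and> u4 \<in> closed_segment x d"

lemma crosses_swap:
  assumes "crosses x a b c d u1 u2 u3 u4"
  shows "crosses x b a c d u2 u1 u3 u4" "crosses x a b d c u1 u2 u4 u3" "crosses x c d a b u3 u4 u1 u2"
  using assms unfolding crosses_def
  by (simp_all add: insert_commute open_segment_commute) (metis insert_commute)+

lemma ex_crosses:
  assumes "x \<in> C"
  shows "\<exists>a b c d u1 u2 u3 u4. crosses x a b c d u1 u2 u3 u4"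
proof -
  have X: "x \<in> crosspoints" and two: "card {e \<in> E. x \<in> edge_interior (\<lambda>x. x) e} = 2"
    using assms by (auto simp: C_def)
  obtain a b c d where e: "{a, b} \<in> E" "{c, d} \<in> E" "{a, b} \<noteq> {c, d}"
    "x \<in> open_segment a b" "x \<in> open_segment c d" using crosspointE[OF X] by metis
  obtain u1 u2 u3 u4 where u: "{u1, u2, u3, u4} \<subseteq> nbrs x" "card {u1, u2, u3, u4} = 4"
    "x \<in> open_segment u1 u2" "x \<in> open_segment u3 u4"
    "u1 \<in> closed_segment x a" "u2 \<in> closed_segment x b"
    "u3 \<in> closed_segment x c" "u4 \<in> closed_segment x d"
    using crossing_neighbours[OF e] by metis
  have "{{a, b}, {c, d}} \<subseteq> {e \<in> E. x \<in> edge_interior (\<lambda>x. x) e}" using e by auto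
  moreover have "card {{a, b}, {c, d}} = 2" using e by simp
  ultimately have edges: "{{a, b}, {c, d}} = {e \<in> E. x \<in> edge_interior (\<lambda>x. x) e}"
    using two finite_E by (intro card_seteq) auto
  have "q \<in> {u1, u2, u3, u4}" if q: "q \<in> nbrs x" for q
  proof -
    have xq: "(x, q) \<in> D" using q by (simp add: nbrs_def)
    then obtain g h where gh: "{g, h} \<in> E" "x \<in> closed_segment g h" "q \<in> closed_segment g h"
      using DE by metis
    then have "x \<in> open_segment g h" using crosspoint_interior X by blast
    then have "{g, h} \<in> {{a, b}, {c, d}}" using gh edges by simp
    then consider "q \<in> closed_segment a b" | "q \<in> closed_segment c d"
      using gh(3) closed_segment_doubleton by blast
    then show ?thesis
    proof cases
      case 1
      then have "q \<in> closed_segment x a \<or> q \<in> closed_segment x b"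
        using closed_segment_split e(4) open_closed_segment by blast
      then show ?thesis using nearest_unique[OF xq] u by (auto simp: nbrs_def)
    next
      case 2
      then have "q \<in> closed_segment x c \<or> q \<in> closed_segment x d"
        using closed_segment_split e(5) open_closed_segment by blast
      then show ?thesis using nearest_unique[OF xq] u by (auto simp: nbrs_def)
    qed
  qed
  then have "nbrs x = {u1, u2, u3, u4}" using u(1) by blast
  then show ?thesis using e u unfolding crosses_def by blast
qed

lemma open_segment_xc:
  assumes "x \<in> open_segment u v"
  shows "xc u < xc x \<and> xc x < xc v \<or> xc v < xc x \<and> xc x < xc u \<or> xc u = xc v"
    "xc u \<noteq> xc v \<Longrightarrow> lg.sl (x, u) = lg.sl (x, v)"
proof -
  obtain c where c: "0 < c" "c < 1" "x = (1 - c) *\<^sub>R u + c *\<^sub>R v"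
    using assms by (auto simp: in_segment)
  have lin: "f x - f u = c * (f v - f u) \<and> f v - f x = (1 - c) * (f v - f u)"
    if "linear f" for f :: "real ^ 2 \<Rightarrow> real"
  proof -
    have "f x = (1 - c) * f u + c * f v" using that by (simp add: c(3) linear_add linear_scale)
    then show ?thesis by (simp add: algebra_simps)
  qed
  show "xc u < xc x \<and> xc x < xc v \<or> xc v < xc x \<and> xc x < xc u \<or> xc u = xc v"
    using lin[OF linear_xc] c(1,2)
    by (smt (verit) mult_pos_pos mult_pos_neg)
  assume ne: "xc u \<noteq> xc v"
  have "lg.sl (x, u) = (c * (yc v - yc u)) / (c * (xc v - xc u))"
    unfolding lg.sl_def fst_conv snd_conv using lin[OF linear_xc] lin[OF linear_yc]
    by (metis minus_diff_eq minus_divide_divide)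
  also have "\<dots> = ((1 - c) * (yc v - yc u)) / ((1 - c) * (xc v - xc u))" using c by simp
  also have "\<dots> = lg.sl (x, v)"
    unfolding lg.sl_def fst_conv snd_conv using lin[OF linear_xc] lin[OF linear_yc] by simp
  finally show "lg.sl (x, u) = lg.sl (x, v)" .
qed

text \<open>Opposite neighbours lie on a line through \<open>x\<close>, so \<open>u2\<close> and
  \<open>u4\<close> repeat the slopes of \<open>u1\<close> and \<open>u3\<close> on the right. The
  keys therefore increase in the order \<open>u1\<close>, \<open>u3\<close>, \<open>u2\<close>,
  \<open>u4\<close>, in which the two edges alternate.\<close>

lemma crosses_turn:
  assumes cr: "crosses x a b c d u1 u2 u3 u4"
    and left: "xc u1 < xc x" "xc u3 < xc x" and sl: "lg.sl (x, u3) < lg.sl (x, u1)"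
  shows "nx x u1 = u3" "nx x u3 = u2" "nx x u2 = u4" "nx x u4 = u1"
proof -
  have nb: "nbrs x = {u1, u2, u3, u4}" using cr by (simp add: crosses_def)
  have D: "(x, u) \<in> D" if "u \<in> {u1, u2, u3, u4}" for u using that nb by (auto simp: nbrs_def)
  have o: "x \<in> open_segment u1 u2" "x \<in> open_segment u3 u4" using cr by (auto simp: crosses_def)
  have W: "u1 \<in> W" "u2 \<in> W" "u3 \<in> W" "u4 \<in> W" using D by (auto simp: D_def)
  have "u1 \<noteq> u2" "u3 \<noteq> u4" using o by (auto simp: open_segment_def)
  then have ne: "xc u1 \<noteq> xc u2" "xc u3 \<noteq> xc u4" using inj_xc W by (auto dest: inj_onD)
  have right: "xc x < xc u2" "xc x < xc u4"
    using open_segment_xc(1)[OF o(1)] open_segment_xc(1)[OF o(2)] ne left by auto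
  have s: "lg.sl (x, u2) = lg.sl (x, u1)" "lg.sl (x, u4) = lg.sl (x, u3)"
    using open_segment_xc(2) o ne by auto
  have at: "arctan (lg.sl (x, u3)) < arctan (lg.sl (x, u1))" using sl by (simp add: arctan_less_iff)
  have k: "pl.key x u1 = - arctan (lg.sl (x, u1))" "pl.key x u2 = 4 - arctan (lg.sl (x, u1))"
    "pl.key x u3 = - arctan (lg.sl (x, u3))" "pl.key x u4 = 4 - arctan (lg.sl (x, u3))"
    using left right s by (auto simp: pl.key_def)
  note bd = pl.arctan_bounds[of "lg.sl (x, u1)"] pl.arctan_bounds[of "lg.sl (x, u3)"]
  show "nx x u1 = u3" unfolding nx_def'
    by (rule cyc_next_eqI[OF finite_nbrs' inj_key]) (use k at bd in \<open>auto simp: nb\<close>)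
  show "nx x u3 = u2" unfolding nx_def'
    by (rule cyc_next_eqI[OF finite_nbrs' inj_key]) (use k at bd in \<open>auto simp: nb\<close>)
  show "nx x u2 = u4" unfolding nx_def'
    by (rule cyc_next_eqI[OF finite_nbrs' inj_key]) (use k at bd in \<open>auto simp: nb\<close>)
  show "nx x u4 = u1" unfolding nx_def'
    by (rule cyc_next_wrapI[OF finite_nbrs' inj_key]) (use k at bd in \<open>auto simp: nb\<close>)
qed

lemma ex_crosses_turn:
  assumes "x \<in> C"
  obtains a b c d u1 u2 u3 u4 where "crosses x a b c d u1 u2 u3 u4"
    "nx x u1 = u3" "nx x u3 = u2" "nx x u2 = u4" "nx x u4 = u1"
proof -
  obtain a b c d u1 u2 u3 u4 where c0: "crosses x a b c d u1 u2 u3 u4" using ex_crosses[OF assms] by blast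
  have lr: "xc u < xc x \<or> xc v < xc x" if "x \<in> open_segment u v" "u \<in> nbrs x" "v \<in> nbrs x" for u v
  proof -
    have "u \<in> W" "v \<in> W" "u \<noteq> v" using that by (auto simp: nbrs_def D_def open_segment_def)
    then have "xc u \<noteq> xc v" using inj_xc by (auto dest: inj_onD)
    then show ?thesis using open_segment_xc(1)[OF that(1)] by auto
  qed
  have "\<exists>a b u1 u2. crosses x a b c d u1 u2 u3 u4 \<and> xc u1 < xc x"
  proof (cases "xc u1 < xc x")
    case False
    then have "xc u2 < xc x" using lr[of u1 u2] c0 by (auto simp: crosses_def)
    then show ?thesis using crosses_swap(1)[OF c0] by blast
  qed (use c0 in blast)
  then obtain a b u1 u2 where c1: "crosses x a b c d u1 u2 u3 u4" "xc u1 < xc x" by blast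
  have "\<exists>c d u3 u4. crosses x a b c d u1 u2 u3 u4 \<and> xc u3 < xc x"
  proof (cases "xc u3 < xc x")
    case False
    then have "xc u4 < xc x" using lr[of u3 u4] c1(1) by (auto simp: crosses_def)
    then show ?thesis using crosses_swap(2)[OF c1(1)] by blast
  qed (use c1(1) in blast)
  then obtain c d u3 u4 where c2: "crosses x a b c d u1 u2 u3 u4" "xc u3 < xc x" by blast
  have "lg.sl (x, u1) \<noteq> lg.sl (x, u3)"
  proof
    assume "lg.sl (x, u1) = lg.sl (x, u3)"
    then have "lg.sl (u1, x) = lg.sl (u3, x)" by (simp add: pl.sl_swap)
    moreover have "(u1, x) \<in> pl.left_edges x" "(u3, x) \<in> pl.left_edges x"
    proof -
      have "(x, u1) \<in> D" "(x, u3) \<in> D" using c2(1) by (auto simp: crosses_def nbrs_def set_eq_iff)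
      then show "(u1, x) \<in> pl.left_edges x" "(u3, x) \<in> pl.left_edges x"
        using c1(2) c2(2) D_sym by (auto simp: pl.left_edges_def S_iff)
    qed
    ultimately have "(u1, x) = (u3, x)" using pl.left_same_slope by blast
    then have "{u1, u2, u3, u4} = {u2, u3, u4}" by blast
    moreover have "card {u2, u3, u4} \<le> 3" by (simp add: card_insert_if)
    ultimately show False using c2(1) by (simp add: crosses_def)
  qed
  then consider "lg.sl (x, u3) < lg.sl (x, u1)" | "lg.sl (x, u1) < lg.sl (x, u3)" by linarith
  then show ?thesis
  proof cases
    case 1
    then show ?thesis using that[OF c2(1)] crosses_turn[OF c2(1) c1(2) c2(2)] by blast
  next
    case 2
    show ?thesis
      using that[OF crosses_swap(3)[OF c2(1)]]
        crosses_turn[OF crosses_swap(3)[OF c2(1)] c2(2) c1(2)] 2 by blast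
  qed
qed

lemma C_turn:
  assumes "x \<in> C" "(u, x) \<in> D"
  obtains a b where "{a, b} \<in> E" "x \<in> open_segment a b" "u \<in> closed_segment x a"
    "nx x (nx x u) \<in> closed_segment x b" "x \<in> open_segment u (nx x (nx x u))"
    "nx x u \<notin> closed_segment a b" "nx x (nx x (nx x (nx x u))) = u"
proof -
  obtain a b c d u1 u2 u3 u4 where cr: "crosses x a b c d u1 u2 u3 u4"
    and n: "nx x u1 = u3" "nx x u3 = u2" "nx x u2 = u4" "nx x u4 = u1"
    using ex_crosses_turn[OF assms(1)] by metis
  have e: "{a, b} \<in> E" "{c, d} \<in> E" "{a, b} \<noteq> {c, d}" "x \<in> open_segment a b" "x \<in> open_segment c d"
    and o: "x \<in> open_segment u1 u2" "x \<in> open_segment u3 u4"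
    and s: "u1 \<in> closed_segment x a" "u2 \<in> closed_segment x b"
      "u3 \<in> closed_segment x c" "u4 \<in> closed_segment x d"
    and nb: "nbrs x = {u1, u2, u3, u4}"
    using cr by (auto simp: crosses_def)
  have "u \<in> nbrs x" using D_sym[OF assms(2)] by (simp add: nbrs_def)
  then have u: "u \<in> {u1, u2, u3, u4}" using nb by simp
  have xx: "x \<in> closed_segment a b" "x \<in> closed_segment c d" using e by (auto simp: open_closed_segment)
  have "u1 \<noteq> x" "u2 \<noteq> x" "u3 \<noteq> x" "u4 \<noteq> x" using o by (auto simp: open_segment_def)
  moreover have "u1 \<in> closed_segment a b" "u2 \<in> closed_segment a b"
      "u3 \<in> closed_segment c d" "u4 \<in> closed_segment c d"
    using closed_segment_mono[OF s(1) xx(1)] closed_segment_mono[OF s(2) xx(1)]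
      closed_segment_mono[OF s(3) xx(2)] closed_segment_mono[OF s(4) xx(2)] by simp_all
  ultimately have off: "u3 \<notin> closed_segment a b" "u4 \<notin> closed_segment a b"
      "u1 \<notin> closed_segment c d" "u2 \<notin> closed_segment c d"
    using edges_meet_once[OF e(1-3) xx] by metis+
  from u consider "u = u1" | "u = u2" | "u = u3" | "u = u4" by blast
  then show ?thesis
  proof cases
    case 1
    show ?thesis by (rule that[of a b]) (use 1 n e s o off in simp_all)
  next
    case 2
    show ?thesis by (rule that[of b a])
        (use 2 n e s o off in \<open>simp_all add: insert_commute open_segment_commute closed_segment_commute\<close>)
  next
    case 3
    show ?thesis by (rule that[of c d]) (use 3 n e s o off in simp_all)
  next
    case 4
    show ?thesis by (rule that[of d c])
        (use 4 n e s o off in \<open>simp_all add: insert_commute open_segment_commute closed_segment_commute\<close>)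
  qed
qed

text \<open>Here the bound of two crossings is exploited: \<open>p\<close> and \<open>q\<close> each
  account for at least one crossing on the edge, so these are all. Hence one other edge passes
  through each, and the edge carries no further point of \<open>W\<close> besides its ends.\<close>

lemma inner_edge:
  assumes pq: "(p, q) \<in> D" "p \<notin> V" "q \<notin> V" and e: "{a, b} \<in> E" "p \<in> closed_segment a b" "q \<in> closed_segment a b"
  shows "p \<in> C" "q \<in> C" "p \<in> open_segment a b" "q \<in> open_segment a b"
    "W \<inter> closed_segment a b \<subseteq> {a, b, p, q}"
proof -
  have X: "p \<in> crosspoints" "q \<in> crosspoints" and ne: "p \<noteq> q" using pq by (auto simp: D_def W_def)
  then show o: "p \<in> open_segment a b" "q \<in> open_segment a b" using crosspoint_interior e by blast+
  define cr where "cr = crossings E (\<lambda>x. x) {a, b}"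
  have cr: "finite cr" "card cr \<le> 2" using crossings_le[OF e(1)] by (auto simp: cr_def)
  have ex: "\<exists>f. (f, r) \<in> cr" if r: "r \<in> crosspoints" "r \<in> open_segment a b" for r
  proof -
    obtain c d g h where cg: "{c, d} \<in> E" "{g, h} \<in> E" "{c, d} \<noteq> {g, h}"
      "r \<in> open_segment c d" "r \<in> open_segment g h" using crosspointE[OF r(1)] by metis
    show ?thesis
    proof (cases "{c, d} = {a, b}")
      case True
      then have "({g, h}, r) \<in> cr" using cg r by (simp add: cr_def crossings_def)
      then show ?thesis by blast
    next
      case False
      then have "({c, d}, r) \<in> cr" using cg r by (simp add: cr_def crossings_def)
      then show ?thesis by blast
    qed
  qed
  obtain f where f: "(f, p) \<in> cr" using ex X o by blast
  obtain g where g: "(g, q) \<in> cr" using ex X o by blast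
  have "card {(f, p), (g, q)} = 2" using ne by simp
  then have cr_eq: "cr = {(f, p), (g, q)}"
    using card_seteq[of cr "{(f, p), (g, q)}"] cr f g by simp
  have in_C: "r \<in> C" if r: "r \<in> crosspoints" "r \<in> open_segment a b"
    and k: "\<And>e'. (e', r) \<in> cr \<longleftrightarrow> e' = k" for r k
  proof -
    have "e' = {a, b} \<or> e' = k" if "e' \<in> E" "r \<in> edge_interior (\<lambda>x. x) e'" for e'
      using that r k[of e'] by (auto simp: cr_def crossings_def)
    moreover have "k \<in> E" "k \<noteq> {a, b}" "r \<in> edge_interior (\<lambda>x. x) k"
      using k[of k] by (auto simp: cr_def crossings_def)
    ultimately have "{e' \<in> E. r \<in> edge_interior (\<lambda>x. x) e'} = {{a, b}, k}"
      using e(1) r by auto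
    then show ?thesis using r \<open>k \<noteq> {a, b}\<close> by (simp add: C_def)
  qed
  show "p \<in> C" using in_C[of p f] X o cr_eq ne by auto
  show "q \<in> C" using in_C[of q g] X o cr_eq ne by auto
  show "W \<inter> closed_segment a b \<subseteq> {a, b, p, q}"
  proof
    fix r assume r: "r \<in> W \<inter> closed_segment a b"
    show "r \<in> {a, b, p, q}"
    proof (cases "r = a \<or> r = b")
      case False
      then have "r \<in> open_segment a b" using r by (simp add: open_segment_def)
      then have "r \<in> crosspoints" using interior_in_W_crosspoint e r by blast
      then obtain h where "(h, r) \<in> cr" using ex \<open>r \<in> open_segment a b\<close> by blast
      then show ?thesis using cr_eq by auto
    qed auto
  qed
qed

lemma nx_D: "(u, w) \<in> D \<Longrightarrow> (w, nx w u) \<in> D"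
  using cyc_next_in[OF finite_nbrs' inj_key, of u w] D_sym by (auto simp: nx_def' nbrs_def)

text \<open>The neighbour of \<open>p\<close> on the side away from \<open>q\<close> is a point of
  \<open>W\<close> on the edge, so by \<open>inner_edge\<close> it can only be the endpoint on that
  side.\<close>

lemma inner_opp:
  assumes pq: "(p, q) \<in> D" "p \<notin> V" "q \<notin> V"
  obtains a b where "{a, b} \<in> E" "p \<in> open_segment a b" "q \<in> closed_segment p a" "nx p (nx p q) = b"
proof -
  obtain c d where cd: "{c, d} \<in> E" "p \<in> closed_segment c d" "q \<in> closed_segment c d"
    using DE[OF pq(1)] by metis
  have "p \<in> C" using inner_edge[OF pq cd] by blast
  obtain a b where ab: "{a, b} \<in> E" "p \<in> open_segment a b" "q \<in> closed_segment p a"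
    "nx p (nx p q) \<in> closed_segment p b" "p \<in> open_segment q (nx p (nx p q))"
    using C_turn[OF \<open>p \<in> C\<close> D_sym[OF pq(1)]] by metis
  define o' where "o' = nx p (nx p q)"
  have p: "p \<in> closed_segment a b" using ab by (simp add: open_closed_segment)
  have q: "q \<in> closed_segment a b" using closed_segment_mono[OF ab(3) p] by simp
  have o'_ab: "o' \<in> closed_segment a b" using closed_segment_mono[OF ab(4) p] by (simp add: o'_def)
  have "(p, o') \<in> D" unfolding o'_def by (meson D_sym nx_D pq(1))
  then have "o' \<in> W" by (simp add: D_def)
  then have "o' \<in> {a, b, p, q}" using inner_edge(5)[OF pq ab(1) p q] o'_ab by blast
  moreover have "o' \<noteq> p" "o' \<noteq> q" using ab(5) by (auto simp: open_segment_def o'_def)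
  moreover have "o' \<noteq> a"
  proof
    assume "o' = a"
    then have "dist p b = dist p a + dist a b" using ab(4) between_dist by (simp add: o'_def)
    moreover have "dist a b = dist a p + dist p b" using p by (rule between_dist)
    ultimately have "a = p" by (simp add: dist_commute)
    then show False using ab(2) by (simp add: open_segment_def)
  qed
  ultimately show ?thesis using that ab by (auto simp: o'_def)
qed

lemma inner_ends:
  assumes pq: "(p, q) \<in> D" "p \<notin> V" "q \<notin> V"
  obtains a b where "{a, b} \<in> E" "p \<in> open_segment a b" "q \<in> open_segment a b"
    "nx p (nx p q) = a" "nx q (nx q p) = b" "p \<in> C" "q \<in> C"
proof -
  obtain a b where ab: "{a, b} \<in> E" "p \<in> open_segment a b" "q \<in> closed_segment p a" "nx p (nx p q) = b"
    using inner_opp[OF pq] by metis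
  obtain c d where cd: "{c, d} \<in> E" "q \<in> open_segment c d" "p \<in> closed_segment q c" "nx q (nx q p) = d"
    using inner_opp[OF D_sym[OF pq(1)] pq(3,2)] by metis
  have p: "p \<in> closed_segment a b" "p \<in> closed_segment c d"
    and q: "q \<in> closed_segment a b" "q \<in> closed_segment c d"
    using ab cd closed_segment_mono[of q p a a b] closed_segment_mono[of p q c c d]
    by (auto simp: open_closed_segment)
  have ne: "p \<noteq> q" using pq by (auto simp: D_def)
  then have eq: "{a, b} = {c, d}" using edges_meet_once[OF ab(1) cd(1) _ p q] by blast
  note i = inner_edge[OF pq ab(1) p(1) q(1)]
  have "d \<noteq> b"
  proof
    assume "d = b"
    then have "c = a" using eq edge_props(4)[OF ab(1)] by (auto simp: doubleton_eq_iff)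
    then have "dist p a = dist p q + dist q a" "dist q a = dist q p + dist p a"
      using ab(3) cd(3) between_dist by auto
    then show False using ne by (simp add: dist_commute)
  qed
  then have "d = a" using eq by (auto simp: doubleton_eq_iff)
  then show ?thesis
    using that[of b a] ab cd i by (simp add: insert_commute open_segment_commute)
qed

text \<open>The sides from \<open>x\<close> to \<open>z\<close> and from \<open>z\<close> to
  \<open>y\<close> lie on different edges, because one turn at the simple crossing \<open>z\<close>
  leaves the edge. The four outer points are the endpoints of these two unit edges, so
  \<open>crossing_dist_less\<close> applies.\<close>

lemma nx_short:
  assumes xz: "(x, z) \<in> D" "x \<notin> V" "z \<notin> V" and y: "y = nx z x" "y \<notin> V"
  shows "dist (nx x (nx x z)) (nx z (nx z y)) + dist (nx z (nx z x)) (nx y (nx y z)) < 2"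
proof -
  have zy: "(z, y) \<in> D" using nx_D[OF xz(1)] y by simp
  obtain a b where ab: "{a, b} \<in> E" "x \<in> open_segment a b" "z \<in> open_segment a b"
    "nx x (nx x z) = a" "nx z (nx z x) = b" "z \<in> C" using inner_ends[OF xz] by metis
  obtain c d where cd: "{c, d} \<in> E" "z \<in> open_segment c d" "y \<in> open_segment c d"
    "nx z (nx z y) = c" "nx y (nx y z) = d" using inner_ends[OF zy xz(3) y(2)] by metis
  obtain g h where gh: "{g, h} \<in> E" "z \<in> open_segment g h" "x \<in> closed_segment z g"
    "nx z x \<notin> closed_segment g h" using C_turn[OF ab(6) xz(1)] by metis
  have z: "z \<in> closed_segment a b" "z \<in> closed_segment g h" "z \<in> closed_segment c d"
    and x: "x \<in> closed_segment a b"
    using ab gh cd by (auto simp: open_closed_segment)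
  have "x \<in> closed_segment g h" using closed_segment_mono[OF gh(3) z(2)] by simp
  moreover have "x \<noteq> z" using xz by (auto simp: D_def)
  ultimately have "{a, b} = {g, h}" using edges_meet_once[OF ab(1) gh(1) _ z(1,2) x] by blast
  then have "y \<notin> closed_segment a b" using gh(4) y closed_segment_doubleton by blast
  moreover have "y \<in> closed_segment c d" using cd by (simp add: open_closed_segment)
  ultimately have "{a, b} \<noteq> {c, d}" using closed_segment_doubleton by blast
  then have "dist a c + dist b d < 2"
    using ab cd edge_props edges_meet_once[OF ab(1) cd(1) _ _ _ z(1,3)]
    by (intro crossing_dist_less[of z]) auto
  then show ?thesis using ab cd by simp
qed

interpretation cm: crossing_map D V C nx
proof unfold_locales
  show "finite D" by (rule finite_D)
  show "(p, p) \<notin> D" for p by (simp add: D_def)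
  show "(q, p) \<in> D" if "(p, q) \<in> D" for p q using that by (rule D_sym)
  show "(w, nx w u) \<in> D" if "(u, w) \<in> D" for u w using that by (rule nx_D)
  show "u = u'" if "(u, w) \<in> D" "(u', w) \<in> D" "nx w u = nx w u'" for u u' w
    using inj_onD[OF inj_on_cyc_next[OF finite_nbrs' inj_key], of w u u'] that D_sym
    by (auto simp: nx_def' nbrs_def)
  show "nx w u \<noteq> u" if uw: "(u, w) \<in> D" for u w
  proof -
    have "w \<in> W" using uw by (simp add: D_def)
    then obtain v where "v \<in> nbrs w" "v \<noteq> u" using two_nbrs by metis
    then show ?thesis unfolding nx_def' using uw D_sym
      by (intro cyc_next_neq[OF finite_nbrs' inj_key]) (auto simp: nbrs_def)
  qed
  show "x \<notin> V" if "x \<in> C" for x using that crosspoint_notin_V by (simp add: C_def)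
  show "nx x (nx x (nx x (nx x u))) = u" if "x \<in> C" "(u, x) \<in> D" for x u
    using C_turn[OF that] by metis
  show "x \<in> open_segment u (nx x (nx x u))" if "x \<in> C" "(u, x) \<in> D" for x u
    using C_turn[OF that] by metis
  show "x = y" if "(p, x) \<in> D" "(p, y) \<in> D" "x \<in> open_segment p a" "y \<in> open_segment p a" for p x y a
    using nearest_unique[OF that(1,2)] that(3,4) open_closed_segment by blast
  show "p \<in> C" if "(p, q) \<in> D" "p \<notin> V" "q \<notin> V" for p q
    using inner_ends[OF that] by metis
  show "nx p (nx p q) \<in> V" if "(p, q) \<in> D" "p \<notin> V" "q \<notin> V" for p q
    using inner_ends[OF that] edge_props(1) by metis
  show "p \<in> open_segment (nx p (nx p q)) (nx q (nx q p))" if "(p, q) \<in> D" "p \<notin> V" "q \<notin> V" for p q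
    using inner_ends[OF that] by metis
  show "dist (nx x (nx x z)) (nx z (nx z y)) + dist (nx z (nx z x)) (nx y (nx y z)) < 2"
    if "(x, z) \<in> D" "x \<notin> V" "z \<notin> V" "y = nx z x" "y \<notin> V" for x z y
    using that by (rule nx_short)
  show "dist p q = 1" if pq: "(p, q) \<in> D" "p \<in> V" "q \<in> V" for p q
  proof -
    obtain a b where ab: "{a, b} \<in> E" "p \<in> closed_segment a b" "q \<in> closed_segment a b"
      using DE[OF pq(1)] by metis
    then have "p \<in> {a, b}" "q \<in> {a, b}" using avoid[OF ab(1)] pq by (auto simp: open_segment_def)
    moreover have "p \<noteq> q" using pq by (auto simp: D_def)
    ultimately show ?thesis using edge_props(3)[OF ab(1)] by (auto simp: dist_commute)
  qed
qed

text \<open>Combines Euler's inequality on the planarised graph with the charge bound on its faces;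
  every edge of that graph carries two darts.\<close>

lemma card_edges_le_min_degree:
  assumes "V \<noteq> {}"
  shows "card E + 8 \<le> 4 * card V"
proof -
  have "W \<noteq> {}" using assms by (auto simp: W_def)
  then obtain w where "w \<in> W" by blast
  then obtain u where "u \<in> nbrs w" using two_nbrs by metis
  then have "D \<noteq> {}" by (auto simp: nbrs_def)
  then have S: "S \<noteq> {}" using darts_eq by (auto simp: pl.darts_def)
  have "pl.nbs v \<noteq> {}" if "v \<in> W" for v
    using two_nbrs[OF that] nbs_eq by (metis empty_iff)
  from pl.euler_inequality[OF S this] obtain l :: "_ \<Rightarrow> ((real ^ 2) \<times> (real ^ 2)) option"
    where l: "\<forall>(u, w)\<in>D. l (w, nx w u) = l (u, w)" "card S + 2 \<le> card W + card (l ` D)"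
    unfolding darts_eq by blast
  have f: "4 * real (card (l ` D)) \<le> card D + card {d \<in> D. fst d \<in> V} / 2"
    using l(1) by (intro cm.faces_le) blast
  have "card D = 2 * card S"
  proof -
    have swap: "prod.swap ` S = {(w, u). (u, w) \<in> S}" by force
    have "D = S \<union> prod.swap ` S" unfolding swap darts_eq[symmetric] pl.darts_def ..
    moreover have "S \<inter> prod.swap ` S = {}" unfolding swap by (auto simp: S_iff)
    moreover have "card (prod.swap ` S) = card S" by (rule card_image) simp
    moreover have "finite S" using finite_D by (rule finite_subset[rotated]) (auto simp: S_def)
    ultimately show ?thesis by (simp add: card_Un_disjoint)
  qed
  moreover have "card D = card {d \<in> D. fst d \<in> V} + card {d \<in> D. fst d \<notin> V}"
    using finite_D by (subst card_Un_disjoint[symmetric]) (auto intro: arg_cong[where f = card])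
  moreover have "card W = card V + card crosspoints"
    unfolding W_def using finite_V finite_crosspoints crosspoint_notin_V
    by (intro card_Un_disjoint) auto
  \<comment> \<open>With A and B darts at original and crossing points, \<open>card S\<close> is (A
    + B)/2. Eliminating the number of labels gives A/2 + B + 8 <= 4 (\<open>card V\<close> +
    \<open>card crosspoints\<close>), to which A >= 2 \<open>card E\<close> and B >= 4
    \<open>card crosspoints\<close> are applied.\<close>
  ultimately have "real (card E) + 8 \<le> 4 * real (card V)"
    using f l(2) card_darts_at_crosspoints card_darts_at_vertices by linarith
  then show ?thesis by linarith
qed

end

text \<open>A pair of points with different second coordinates excludes a single value of
  \<open>t\<close>, and a pair of distinct points with equal second coordinates excludes
  none.\<close>

lemma ex_injective_shear:
  fixes P :: "(real ^ 2) set"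
  assumes "finite P"
  obtains t where "inj_on (\<lambda>p. p $ 1 + t * p $ 2) P"
proof -
  define B where "B = (\<lambda>(p :: real ^ 2, q :: real ^ 2). (q $ 1 - p $ 1) / (p $ 2 - q $ 2)) ` (P \<times> P)"
  have "finite B" using assms by (simp add: B_def)
  then obtain t where t: "t \<notin> B" using ex_new_if_finite infinite_UNIV_char_0 by blast
  have "p = q" if pq: "p \<in> P" "q \<in> P" "p $ 1 + t * p $ 2 = q $ 1 + t * q $ 2" for p q
  proof -
    have *: "t * (p $ 2 - q $ 2) = q $ 1 - p $ 1" using pq by (simp add: algebra_simps)
    have "p $ 2 = q $ 2"
    proof (rule ccontr)
      assume "p $ 2 \<noteq> q $ 2"
      then have "t = (q $ 1 - p $ 1) / (p $ 2 - q $ 2)" using * by (simp add: eq_divide_eq)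
      then show False using t pq by (force simp: B_def)
    qed
    then show ?thesis using pq by (simp add: vec_eq_iff forall_2)
  qed
  then show ?thesis using that by (meson inj_onI)
qed

section \<open>Reduction to minimum degree two\<close>

lemma unit_drawing_mono:
  assumes "unit_drawing V E" "E' \<subseteq> E" "V' \<subseteq> V" "\<And>e. e \<in> E' \<Longrightarrow> e \<subseteq> V'"
  shows "unit_drawing V' E'"
proof -
  interpret unit_drawing V E by (rule assms(1))
  show ?thesis
  proof
    show "finite V'" using finite_V assms(3) finite_subset by blast
    show "\<exists>a b. e = {a, b} \<and> a \<in> V' \<and> b \<in> V' \<and> dist a b = 1" if "e \<in> E'" for e
    proof -
      have "e \<in> E" using that assms(2) by blast
      then obtain a b where "e = {a, b}" "dist a b = 1" using edgeE by metis
      then show ?thesis using assms(4)[OF that] by auto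
    qed
    show "v \<notin> open_segment a b" if "{a, b} \<in> E'" "v \<in> V'" for a b v
      using avoid[of a b v] that assms(2,3) by blast
    show "finite (crossings E' (\<lambda>x. x) e) \<and> card (crossings E' (\<lambda>x. x) e) \<le> 2" if "e \<in> E'" for e
    proof -
      have sub: "crossings E' (\<lambda>x. x) e \<subseteq> crossings E (\<lambda>x. x) e"
        using assms(2) by (auto simp: crossings_def)
      have c: "finite (crossings E (\<lambda>x. x) e)" "card (crossings E (\<lambda>x. x) e) \<le> 2"
        using crossings_le that assms(2) by blast+
      show ?thesis using finite_subset[OF sub c(1)] card_mono[OF c(1) sub] c(2) by linarith
    qed
  qed
qed

text \<open>Removing a vertex of degree at most one loses at most one edge, while the bound drops by
  4. The induction stops at three vertices, where at most 3 edges exist and 3 + 8 <= 12.\<close>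

theorem unit_drawing_card_edges_le:
  assumes "3 \<le> card V" "unit_drawing V E"
  shows "card E + 8 \<le> 4 * card V"
  using assms
proof (induction "card V" arbitrary: V E rule: less_induct)
  case less
  interpret ud: unit_drawing V E by (rule less.prems(2))
  show ?case
  proof (cases "card V = 3")
    case True
    have "E \<subseteq> {B. B \<subseteq> V \<and> card B = 2}"
    proof
      fix e assume "e \<in> E"
      then obtain a b where "e = {a, b}" "a \<in> V" "b \<in> V" "dist a b = 1" using ud.edgeE by metis
      moreover from this have "a \<noteq> b" by auto
      ultimately show "e \<in> {B. B \<subseteq> V \<and> card B = 2}" by simp
    qed
    moreover have "finite {B. B \<subseteq> V \<and> card B = 2}" using ud.finite_V by simp
    ultimately have "card E \<le> card {B. B \<subseteq> V \<and> card B = 2}" by (rule card_mono[rotated])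
    also have "\<dots> = card V choose 2" by (rule n_subsets[OF ud.finite_V])
    also have "card V choose 2 = 3" using True by (simp add: choose_two)
    finally show ?thesis using True by simp
  next
    case F: False
    show ?thesis
    proof (cases "\<forall>v\<in>V. \<exists>a b. a \<noteq> b \<and> {v, a} \<in> E \<and> {v, b} \<in> E")
      case True
      obtain t where "inj_on (\<lambda>p. p $ 1 + t * p $ 2) ud.W"
        using ex_injective_shear[OF ud.finite_W] by metis
      then interpret sheared_unit_drawing V E t
        by unfold_locales (use True in auto)
      show ?thesis using less.prems(1) by (intro card_edges_le_min_degree) auto
    next
      case False
      then obtain v where v: "v \<in> V" "\<And>a b. {v, a} \<in> E \<Longrightarrow> {v, b} \<in> E \<Longrightarrow> a = b" by blast
      define E' where "E' = {e \<in> E. v \<notin> e}"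
      have ve: "\<exists>a. e = {v, a}" if e: "e \<in> E" "v \<in> e" for e
      proof -
        obtain a b where "e = {a, b}" using ud.edgeE[OF e(1)] by metis
        then show ?thesis using e(2) by auto
      qed
      have "unit_drawing (V - {v}) E'"
      proof (rule unit_drawing_mono[OF less.prems(2)])
        fix e assume e: "e \<in> E'"
        then have "e \<in> E" by (simp add: E'_def)
        then obtain a b where "e = {a, b}" "a \<in> V" "b \<in> V" using ud.edgeE by metis
        then show "e \<subseteq> V - {v}" using e by (auto simp: E'_def)
      qed (auto simp: E'_def)
      moreover have cV: "card (V - {v}) = card V - 1" using v ud.finite_V by simp
      ultimately have IH: "card E' + 8 \<le> 4 * card (V - {v})"
        using less.prems(1) F by (intro less.hyps) auto
      have "card (E - E') \<le> 1"
      proof -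
        have "e = f" if "e \<in> E - E'" "f \<in> E - E'" for e f
        proof -
          have ef: "e \<in> E" "v \<in> e" "f \<in> E" "v \<in> f" using that by (auto simp: E'_def)
          obtain a b where "e = {v, a}" "f = {v, b}" using ve ef by metis
          then show ?thesis using v(2)[of a b] ef by simp
        qed
        then show ?thesis using ud.finite_E by (simp add: card_le_Suc0_iff_eq)
      qed
      moreover have "card E = card E' + card (E - E')"
        using ud.finite_E by (simp add: E'_def card_Diff_subset card_mono)
      ultimately show ?thesis using IH cV less.prems(1) by linarith
    qed
  qed
qed

text \<open>The drawing map is injective on the vertices, so replacing each vertex by its image
  keeps the numbers of vertices and edges and carries crossings over to crossings.\<close>

lemma k_planar_card_le:
  assumes "k_planar_unit_distance_graph 2 V E" "3 \<le> card V"
  shows "card E + 8 \<le> 4 * card V"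
proof -
  have fin: "finite V" and E: "\<And>e. e \<in> E \<Longrightarrow> e \<subseteq> V \<and> card e = 2"
    using assms unfolding k_planar_unit_distance_graph_def simple_graph_def by auto
  obtain \<phi> where \<phi>: "unit_distance_drawing V E \<phi>"
    and cr: "\<And>e. e \<in> E \<Longrightarrow> finite (crossings E \<phi> e) \<and> card (crossings E \<phi> e) \<le> 2"
    using assms unfolding k_planar_unit_distance_graph_def by blast
  have inj: "inj_on \<phi> V"
    and unit: "\<And>a b. {a, b} \<in> E \<Longrightarrow> dist (\<phi> a) (\<phi> b) = 1"
    and avoid: "\<And>e w. e \<in> E \<Longrightarrow> w \<in> V - e \<Longrightarrow> \<phi> w \<notin> edge_interior \<phi> e"
    using \<phi> unfolding unit_distance_drawing_def by simp_all
  define E' where "E' = (`) \<phi> ` E"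
  have inj_img: "inj_on ((`) \<phi>) E"
    using inj E by (meson inj_onI inj_on_image_eq_iff)
  have int: "edge_interior \<phi> {a, b} = open_segment (\<phi> a) (\<phi> b)" for a b
    unfolding edge_interior_def by (auto simp: doubleton_eq_iff open_segment_commute)
  have int': "edge_interior (\<lambda>x. x) (\<phi> ` e) = edge_interior \<phi> e" if e: "e \<in> E" for e
  proof -
    obtain a b where "e = {a, b}" using E[OF e] by (meson card_2_iff)
    then show ?thesis by (simp add: int)
  qed
  have "unit_drawing (\<phi> ` V) E'"
  proof
    show "finite (\<phi> ` V)" using fin by simp
    show "\<exists>a b. e = {a, b} \<and> a \<in> \<phi> ` V \<and> b \<in> \<phi> ` V \<and> dist a b = 1" if e: "e \<in> E'" for e
    proof -
      obtain e0 where e0: "e0 \<in> E" "e = \<phi> ` e0" using e by (auto simp: E'_def)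
      obtain a b where ab: "e0 = {a, b}" using E[OF e0(1)] by (meson card_2_iff)
      then have "e = {\<phi> a, \<phi> b}" "a \<in> V" "b \<in> V" using e0 E[OF e0(1)] by auto
      then show ?thesis using unit[of a b] e0 ab by blast
    qed
    show "v \<notin> open_segment a b" if abv: "{a, b} \<in> E'" "v \<in> \<phi> ` V" for a b v
    proof -
      obtain e0 where e0: "e0 \<in> E" "{a, b} = \<phi> ` e0" using abv by (auto simp: E'_def)
      obtain w where w: "w \<in> V" "v = \<phi> w" using abv by blast
      show ?thesis
      proof (cases "w \<in> e0")
        case True
        then have "v \<in> {a, b}" using e0 w by blast
        then show ?thesis by (auto simp: open_segment_def)
      next
        case False
        then have "v \<notin> edge_interior \<phi> e0" using avoid e0 w by blast
        then show ?thesis using int'[OF e0(1)] e0(2)[symmetric] by simp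
      qed
    qed
    show "finite (crossings E' (\<lambda>x. x) e) \<and> card (crossings E' (\<lambda>x. x) e) \<le> 2" if e: "e \<in> E'" for e
    proof -
      obtain e0 where e0: "e0 \<in> E" "e = \<phi> ` e0" using e by (auto simp: E'_def)
      have ne: "\<phi> ` f = \<phi> ` e0 \<longleftrightarrow> f = e0" if "f \<in> E" for f
        using inj_img e0(1) that by (auto dest: inj_onD)
      have "crossings E' (\<lambda>x. x) e = (\<lambda>(f, p). (\<phi> ` f, p)) ` crossings E \<phi> e0"
        unfolding crossings_def E'_def e0(2) using e0(1) by (auto simp: int' ne image_iff)
      then show ?thesis using cr[OF e0(1)] by (metis card_image_le finite_imageI le_trans)
    qed
  qed
  then have "card E' + 8 \<le> 4 * card (\<phi> ` V)"
    using assms(2) inj by (intro unit_drawing_card_edges_le) (simp_all add: card_image)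
  then show ?thesis using inj inj_img by (simp add: E'_def card_image)
qed

text \<open>The bound starts at \<open>n = 3\<close>: for one vertex its right-hand side is
  negative, and for two vertices it is 0 although a single unit edge can be drawn. Working in the
  integers keeps the subtraction exact.\<close>

theorem theorem2:
  fixes n :: nat
  assumes "n \<ge> 3"
  shows "int (u_max 2 n) \<le> 4 * int n - 8"
proof -
  have "u_max 2 n \<in> edge_counts 2 n"
    unfolding u_max_def using finite_edge_counts edge_counts_nonempty by (rule Max_in)
  then obtain V :: "nat set" and E where "u_max 2 n = card E" "card V = n"
    "k_planar_unit_distance_graph 2 V E"
    unfolding edge_counts_def by blast
  then show ?thesis using k_planar_card_le[of V E] assms by simp
qed

end
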